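(* Let $\alpha\in(0,1)$, $\alpha>\frac14$, $\alpha\neq\frac12$, and $q>\frac1\alpha$. Let $\boldsymbol\Gamma(\varepsilon)=(\Gamma(\varepsilon)^{(1)},\Gamma(\varepsilon)^{(2)})$, $\varepsilon>0$, be the analytic approximation of two-dimensional fractional Brownian motion with Hurst exponent $\alpha$ described in the context. Then, as $\varepsilon\to0$, almost surely, the increments $\boldsymbol\Gamma(\varepsilon)_t-\boldsymbol\Gamma(\varepsilon)_s$ converge with respect to the distance $d_1$ and the Lévy areas $\mathrm{Area}_{s,t}(\boldsymbol\Gamma(\varepsilon))$ converge with respect to the distance $d_2$.
   Context: Powers $z^\beta$ ($z\in\mathbb{C}\setminus\mathbb{R}_-$) use the principal logarithm. Let $\Gamma'^{+}$ be the complex centered Gaussian process on the open upper half-plane $\Pi^+$, a.s. analytic, with $\Gamma'^-_{\bar z}:=\overline{\Gamma'^+_z}$ and covariances $\mathbb{E}[\Gamma'^+_z\Gamma'^+_w]=\mathbb{E}[\Gamma'^-_{\bar z}\Gamma'^-_{\bar w}]=0$, $\mathbb{E}[\Gamma'^+_z\Gamma'^-_{\bar w}]=\frac{\alpha(1-2\alpha)}{2\cos\pi\alpha}(-i(z-\bar w))^{2\alpha-2}$. (Explicitly $\Gamma'^+_z=\sum_{k\ge0}f_k(z)\xi_k^+$ with $f_k(z)=2^{\alpha-1}\sqrt{\frac{\alpha(1-2\alpha)}{2\cos\pi\alpha}}\sqrt{\frac{(2-2\alpha)_k}{k!}}(\frac{z+i}{2i})^{2\alpha-2}(\frac{z-i}{z+i})^k$,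 $(x)_k=x(x+1)\cdots(x+k-1)$, and $\xi_k^+$ independent standard complex Gaussians with $\mathbb{E}|\xi_k^+|^2=1$, $\mathbb{E}[(\xi_k^+)^2]=0$.) Let $\Gamma^+_z=\int_0^z\Gamma'^+_u\,du$ (along any path in $\Pi^+$ from $0$ to $z$) and $\Gamma(\varepsilon)_x=2\operatorname{Re}\Gamma^+_{x+i\varepsilon}$ for $\varepsilon>0$, $x\in\mathbb{R}$; $\Gamma(\varepsilon)^{(1)},\Gamma(\varepsilon)^{(2)}$ are built from two independent copies of $\Gamma'^+$ (each used for all $\varepsilon$); $\Gamma'(\varepsilon)_x=\frac{d}{dx}\Gamma(\varepsilon)_x$. As $\varepsilon\to 0$, $\Gamma(\varepsilon)_x$ tends in $L^2$ to a fractional Brownian motion $\Gamma_x$. The Lévy area is $\mathrm{Area}_{s,t}(\boldsymbol\Gamma(\varepsilon))=\int_s^t\Gamma'(\varepsilon)^{(1)}_{x}dx\int_s^x\Gamma'(\varepsilon)^{(2)}_ydy$. For $k\ge1$, a fixed bounded interval $[s,t]$ and two functionals $A=(A_{u,v})$, $A'=(A'_{u,v})$, $s\le u\le v\le t$, with values in a Euclidean space, set $$d_k(A,A')_{s,t}=\left(\sup_{s=t_0<\cdots<t_n=t}\sum_{l=1}^n\|A_{t_{l-1},t_l}-A'_{t_{l-1},t_l}\|^{q/k}\right)^{k/q},$$ the supremum being over all finite partitions of $[s,t]$. Convergence with respect to $d_k$ means convergence of the functional $(u,v)\mapsto A(\varepsilon)_{u,v}$ to some limit functional in $d_k$ on every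 such interval. *)

theory Defs
  imports "HOL-Probability.Probability" "HOL-Complex_Analysis.Complex_Analysis"
begin

definition upper_half_plane :: "complex set" where
  "upper_half_plane = {z. Im z > 0}"

text \<open>Degenerate (almost surely vanishing) variables count as Gaussian.\<close>

definition centered_gaussian :: "'a measure \<Rightarrow> ('a \<Rightarrow> real) \<Rightarrow> bool" where
  "centered_gaussian M X \<longleftrightarrow>
     X \<in> borel_measurable M \<and>
     ((AE \<omega> in M. X \<omega> = 0) \<or> (\<exists>\<sigma>>0. distributed M lborel X (normal_density 0 \<sigma>)))"

text \<open>
  Joint Gaussianity of the real and imaginary parts: since
  \<open>Re ((a - \<i> b) * w) = a * Re w + b * Im w\<close>, the real parts of the complex linear
  combinations are exactly the real linear combinations of the \<open>Re (X z)\<close> and \<open>Im (X z)\<close>.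
\<close>

definition complex_centered_gaussian_process ::
    "'a measure \<Rightarrow> 'i set \<Rightarrow> ('i \<Rightarrow> 'a \<Rightarrow> complex) \<Rightarrow> bool" where
  "complex_centered_gaussian_process M I X \<longleftrightarrow>
     (\<forall>z\<in>I. X z \<in> borel_measurable M) \<and>
     (\<forall>F c. finite F \<and> F \<subseteq> I \<longrightarrow> centered_gaussian M (\<lambda>\<omega>. Re (\<Sum>z\<in>F. c z * X z \<omega>)))"

text \<open>The process \<open>\<Gamma>'\<^sup>-\<close> on the lower half-plane, \<open>\<Gamma>'\<^sup>-(cnj z) = cnj (\<Gamma>'\<^sup>+(z))\<close>.\<close>

definition lower_process :: "(complex \<Rightarrow> 'a \<Rightarrow> complex) \<Rightarrow> complex \<Rightarrow> 'a \<Rightarrow> complex" where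
  "lower_process X w \<omega> = cnj (X (cnj w) \<omega>)"

text \<open>
  The law of \<open>\<Gamma>'\<^sup>+\<close>. Only the values \<open>X z\<close> with \<open>z\<close> in the open upper half-plane matter.
  For \<open>z, w\<close> there, \<open>-\<i> * (z - cnj w)\<close> has positive real part, so the principal
  branch of \<open>powr\<close> is holomorphic at this point.
\<close>

definition is_Gamma_prime_plus ::
    "'a measure \<Rightarrow> real \<Rightarrow> (complex \<Rightarrow> 'a \<Rightarrow> complex) \<Rightarrow> bool" where
  "is_Gamma_prime_plus M \<alpha> X \<longleftrightarrow>
     complex_centered_gaussian_process M upper_half_plane X \<and>
     (AE \<omega> in M. (\<lambda>z. X z \<omega>) analytic_on upper_half_plane) \<and>
     (\<forall>z\<in>upper_half_plane. \<forall>w\<in>upper_half_plane.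
        (\<integral>\<omega>. X z \<omega> * X w \<omega> \<partial>M) = 0 \<and>
        (\<integral>\<omega>. lower_process X (cnj z) \<omega> * lower_process X (cnj w) \<omega> \<partial>M) = 0 \<and>
        (\<integral>\<omega>. X z \<omega> * lower_process X (cnj w) \<omega> \<partial>M) =
          complex_of_real (\<alpha> * (1 - 2 * \<alpha>) / (2 * cos (pi * \<alpha>))) *
          (- \<i> * (z - cnj w)) powr complex_of_real (2 * \<alpha> - 2))"

text \<open>Independence of the two processes as random elements of the space of functions on \<open>I\<close>.\<close>

definition independent_processes ::
    "'a measure \<Rightarrow> 'i set \<Rightarrow> ('i \<Rightarrow> 'a \<Rightarrow> complex) \<Rightarrow> ('i \<Rightarrow> 'a \<Rightarrow> complex) \<Rightarrow> bool" where
  "independent_processes M I X Y \<longleftrightarrow>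
     prob_space.indep_var M
       (PiM I (\<lambda>_. borel)) (\<lambda>\<omega>. \<lambda>z\<in>I. X z \<omega>)
       (PiM I (\<lambda>_. borel)) (\<lambda>\<omega>. \<lambda>z\<in>I. Y z \<omega>)"

text \<open>
  The following operate on a single trajectory \<open>g\<close> of \<open>\<Gamma>'\<^sup>+\<close>. As a representative of the
  paths in the upper half-plane from the boundary point \<open>0\<close> to \<open>z\<close> we take the segment;
  the contour integral is a Henstock-Kurzweil integral, hence allows for the singularity
  of \<open>g\<close> at \<open>0\<close> and does not depend on the value \<open>g 0\<close>.
\<close>

definition Gamma_plus :: "(complex \<Rightarrow> complex) \<Rightarrow> complex \<Rightarrow> complex" where
  "Gamma_plus g z = contour_integral (linepath 0 z) g"

definition Gamma_eps :: "(complex \<Rightarrow> complex) \<Rightarrow> real \<Rightarrow> real \<Rightarrow> real" where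
  "Gamma_eps g \<epsilon> x = 2 * Re (Gamma_plus g (Complex x \<epsilon>))"

definition Gamma_increment ::
    "(complex \<Rightarrow> complex) \<Rightarrow> (complex \<Rightarrow> complex) \<Rightarrow> real \<Rightarrow> real \<Rightarrow> real \<Rightarrow> real \<times> real" where
  "Gamma_increment g1 g2 \<epsilon> s t =
     (Gamma_eps g1 \<epsilon> t, Gamma_eps g2 \<epsilon> t) - (Gamma_eps g1 \<epsilon> s, Gamma_eps g2 \<epsilon> s)"

definition Levy_area ::
    "(complex \<Rightarrow> complex) \<Rightarrow> (complex \<Rightarrow> complex) \<Rightarrow> real \<Rightarrow> real \<Rightarrow> real \<Rightarrow> real" where
  "Levy_area g1 g2 \<epsilon> s t =
     integral {s..t} (\<lambda>x. deriv (Gamma_eps g1 \<epsilon>) x *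
       integral {s..x} (\<lambda>y. deriv (Gamma_eps g2 \<epsilon>) y))"

text \<open>The map \<open>x \<mapsto> x powr p\<close> on \<open>[0,\<infinity>]\<close>, for exponents \<open>p > 0\<close>.\<close>

definition ennreal_powr :: "ennreal \<Rightarrow> real \<Rightarrow> ennreal" where
  "ennreal_powr x p = (if x = \<infinity> then \<infinity> else ennreal (enn2real x powr p))"

definition is_partition :: "real \<Rightarrow> real \<Rightarrow> nat \<Rightarrow> (nat \<Rightarrow> real) \<Rightarrow> bool" where
  "is_partition s t n p \<longleftrightarrow> p 0 = s \<and> p n = t \<and> (\<forall>l<n. p l < p (Suc l))"

text \<open>The supremum may be infinite, so the distance takes values in \<open>[0,\<infinity>]\<close>.\<close>

definition d_dist ::
    "real \<Rightarrow> nat \<Rightarrow> (real \<Rightarrow> real \<Rightarrow> 'b::euclidean_space) \<Rightarrow> (real \<Rightarrow> real \<Rightarrow> 'b) \<Rightarrow>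
     real \<Rightarrow> real \<Rightarrow> ennreal" where
  "d_dist q k A A' s t =
     ennreal_powr
       (SUP (n, p) \<in> {(n, p). is_partition s t n p}.
          ennreal (\<Sum>l = 1..n. norm (A (p (l - 1)) (p l) - A' (p (l - 1)) (p l)) powr (q / real k)))
       (real k / q)"

text \<open>
  Convergence as \<open>\<epsilon> \<rightarrow> 0+\<close> on all bounded intervals, to a common limit functional. A single
  limit suffices: convergence in \<open>d_dist\<close> on an interval forces pointwise convergence there.
\<close>

definition converges_in_d ::
    "real \<Rightarrow> nat \<Rightarrow> (real \<Rightarrow> real \<Rightarrow> real \<Rightarrow> 'b::euclidean_space) \<Rightarrow> bool" where
  "converges_in_d q k A \<longleftrightarrow>
     (\<exists>L. \<forall>s t. s < t \<longrightarrow> ((\<lambda>\<epsilon>. d_dist q k (A \<epsilon>) L s t) \<longlongrightarrow> 0) (at_right 0))"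

end

theory Submission
  imports Defs
begin

text \<open>
  Write \<open>g1\<close>, \<open>g2\<close> for trajectories of the two copies of \<open>\<Gamma>'\<^sup>+\<close>. The proof separates what follows
  from the size of \<open>g1\<close>, \<open>g2\<close> near the real axis, which is deterministic, from the one quantity that
  needs probabilistic cancellation.

  Size. The variance of \<open>\<Gamma>'\<^sup>+(z)\<close> is a multiple of \<open>(Im z) powr (2 * \<alpha> - 2)\<close>, and Gaussian variables have
  comparable moments of every order. Cauchy's formula on countably many circles turns these
  moments into a pathwise bound: for each \<open>\<beta> < \<alpha>\<close>, almost surely
  \<open>norm (g z) \<le> C * Im z powr (\<beta> - 1)\<close>, locally uniformly in \<open>Re z\<close> (\<open>growth_AE\<close>). Integrating this
  bound vertically and horizontally, a primitive of \<open>g\<close> is \<open>\<beta>\<close>-Hoelder up to the boundary. The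
  increments over an interval of length \<open>h\<close> at two heights below \<open>\<epsilon>\<close> then differ by at most
  a constant times \<open>(min \<epsilon> h) powr \<beta>\<close>, hence by at most a constant times \<open>\<epsilon> powr \<kappa> * h powr (\<beta> - \<kappa>)\<close>. The \<open>q\<close>-th powers of
  \<open>h powr (\<beta> - \<kappa>)\<close> have bounded sums over partitions as soon as \<open>(\<beta> - \<kappa>) * q \<ge> 1\<close>, which gives
  convergence in \<open>d\<^sub>1\<close> (\<open>increments_converge\<close>).

  Reduction for the area. Let \<open>a(x, y)\<close>, \<open>b(x, y)\<close> be the two approximating paths at height \<open>y\<close>; they are
  harmonic functions. The derivative in \<open>y\<close> of the area over \<open>[s, t]\<close> is, after an integration by
  parts in \<open>x\<close>, a sum of boundary terms of size \<open>h powr \<beta> * y powr (\<beta> - 1)\<close>, which are integrable at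
  \<open>y = 0\<close>, and of the cross term
  \<open>F(y; s, t) = \<integral> (a\<^sub>x b\<^sub>y - a\<^sub>y b\<^sub>x) dx = \<integral> 4 Im (g1 * cnj g2) dx\<close>
  (\<open>area_deriv\<close>). So the areas converge in \<open>d\<^sub>2\<close> once the integral over \<open>0 < y < \<epsilon>\<close> of the absolute value of
  the cross term is at most \<open>\<epsilon> powr \<kappa> * W s t\<close>, where \<open>W\<close> has finite \<open>q/2\<close>-variation
  (\<open>areas_converge\<close>).

  The cross term. If \<open>\<alpha> > 1/2\<close>, the pathwise bound \<open>h * y powr (2 * \<beta> - 2)\<close> is integrable in \<open>y\<close>. If
  \<open>\<alpha> < 1/2\<close>, independence of the two copies gives
  \<open>E (F(y; u, v)\<^sup>2) \<le> C * \<integral>\<integral> norm (x - x' + 2 * \<i> * y) powr (4 * \<alpha> - 4) dx dx'\<close>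
  with \<open>x\<close>, \<open>x'\<close> ranging over \<open>[u, v]\<close>; for \<open>\<alpha> > 1/4\<close> this is small enough for the following scheme. A
  Garsia-Rodemich-Rumsey inequality with exponent 2 and the Cauchy-Schwarz inequality in \<open>y\<close> bound the
  integrated cross term by \<open>\<epsilon> powr \<kappa> * sqrt (h powr (2 * \<delta> - 1) * \<omega>(s, t))\<close>, where \<open>\<omega>\<close> is a weighted
  integral of \<open>F(y; u, v)\<^sup>2\<close> over \<open>y\<close> and over \<open>u\<close>, \<open>v\<close> in \<open>[s, t]\<close>. The function \<open>\<omega>\<close> is superadditive in
  the interval and has finite expectation (\<open>control_finite_AE\<close>). Superadditivity controls all partitions simultaneously; this is why
  second moments of the cross term suffice.
\<close>

section \<open>Convergence in variation\<close>

lemma ennreal_powr_le: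
  assumes "x \<le> ennreal y" "0 \<le> y" "0 < r"
  shows "ennreal_powr x r \<le> ennreal (y powr r)"
proof -
  have "x \<noteq> \<infinity>" using assms(1) by (auto simp: top_unique)
  then have "ennreal_powr x r = ennreal (enn2real x powr r)"
    by (simp add: ennreal_powr_def)
  also have "\<dots> \<le> ennreal (y powr r)"
    using assms by (intro ennreal_leI powr_mono2) (auto intro: enn2real_leI)
  finally show ?thesis .
qed

text \<open>
  The convergence proofs bound the difference of two functionals by a small factor \<open>c\<close> times a fixed
  weight \<open>W\<close> of bounded variation; the factor passes through the power \<open>q / k\<close> and its inverse.
\<close>

lemma d_dist_le:
  assumes q: "0 < q" "0 < k" and c: "0 \<le> c" "0 \<le> B"
    and W: "\<And>u v. 0 \<le> W u v"
    and A: "\<And>u v. s \<le> u \<Longrightarrow> u < v \<Longrightarrow> v \<le> t \<Longrightarrow> norm (A u v - L u v) \<le> c * W u v"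
    and B: "\<And>n p. is_partition s t n p \<Longrightarrow> (\<Sum>l=1..n. W (p (l - 1)) (p l) powr (q / real k)) \<le> B"
  shows "d_dist q k A L s t \<le> ennreal (c * B powr (real k / q))"
proof -
  define r where "r = q / real k"
  have r: "r > 0" using q by (simp add: r_def)
  have "(SUP (n, p) \<in> {(n, p). is_partition s t n p}.
          ennreal (\<Sum>l = 1..n. norm (A (p (l - 1)) (p l) - L (p (l - 1)) (p l)) powr r))
      \<le> ennreal (c powr r * B)"
  proof (rule SUP_least, clarify)
    fix n p assume p: "is_partition s t n p"
    have mono: "p i \<le> p j" if "i \<le> j" "j \<le> n" for i j
      using that
    proof (induction j)
      case (Suc j)
      show ?case
      proof (cases "i = Suc j")
        case False
        then have "p i \<le> p j" using Suc by auto
        also have "p j < p (Suc j)" using p Suc.prems by (auto simp: is_partition_def)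
        finally show ?thesis by simp
      qed simp
    qed simp
    have "(\<Sum>l = 1..n. norm (A (p (l - 1)) (p l) - L (p (l - 1)) (p l)) powr r)
      \<le> (\<Sum>l = 1..n. c powr r * W (p (l - 1)) (p l) powr r)"
    proof (rule sum_mono)
      fix l assume l: "l \<in> {1..n}"
      have "norm (A (p (l - 1)) (p l) - L (p (l - 1)) (p l)) \<le> c * W (p (l - 1)) (p l)"
      proof (rule A)
        show "s \<le> p (l - 1)" using mono[of 0 "l - 1"] l p by (auto simp: is_partition_def)
        show "p l \<le> t" using mono[of l n] l p by (auto simp: is_partition_def)
        have "l - 1 < n" "Suc (l - 1) = l" using l by auto
        then show "p (l - 1) < p l" using p unfolding is_partition_def by metis
      qed
      then have "norm (A (p (l - 1)) (p l) - L (p (l - 1)) (p l)) powr r \<le> (c * W (p (l - 1)) (p l)) powr r"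
        using r by (intro powr_mono2) auto
      then show "norm (A (p (l - 1)) (p l) - L (p (l - 1)) (p l)) powr r
          \<le> c powr r * W (p (l - 1)) (p l) powr r"
        using c W by (simp add: powr_mult)
    qed
    also have "\<dots> \<le> c powr r * B"
      using B[OF p] unfolding sum_distrib_left[symmetric] r_def by (intro mult_left_mono) auto
    finally show "ennreal (\<Sum>l = 1..n. norm (A (p (l - 1)) (p l) - L (p (l - 1)) (p l)) powr r)
        \<le> ennreal (c powr r * B)" by (rule ennreal_leI)
  qed
  then have "d_dist q k A L s t \<le> ennreal ((c powr r * B) powr (real k / q))"
    unfolding d_dist_def r_def[symmetric] using c q by (intro ennreal_powr_le) auto
  also have "(c powr r * B) powr (real k / q) = c * B powr (real k / q)"
    using c q by (simp add: powr_mult powr_powr r_def)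
  finally show ?thesis .
qed

lemma powr_tendsto_0:
  fixes D :: real
  assumes "0 < \<kappa>"
  shows "((\<lambda>\<epsilon>. D * \<epsilon> powr \<kappa>) \<longlongrightarrow> 0) (at_right 0)"
proof -
  have "((\<lambda>\<epsilon>. D * \<epsilon> powr \<kappa>) \<longlongrightarrow> D * 0 powr \<kappa>) (at_right 0)"
    using assms eventually_at_right_less[of "0::real"]
    by (intro tendsto_intros tendsto_powr') (auto elim!: eventually_mono)
  then show ?thesis by simp
qed

text \<open>
  The limit is taken along \<open>1 / (n + 1)\<close> so that it is one and the same term for all choices of
  the constants \<open>K\<close>, \<open>e\<close> and \<open>\<kappa>\<close>; below they depend on the interval, but the limit functional may not.
\<close>

lemma power_cauchy_limit:
  fixes f :: "real \<Rightarrow> 'b::banach"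
  assumes "0 < \<kappa>" "0 < e"
    and f: "\<And>\<epsilon> \<epsilon>'. 0 < \<epsilon>' \<Longrightarrow> \<epsilon>' \<le> \<epsilon> \<Longrightarrow> \<epsilon> \<le> e \<Longrightarrow> norm (f \<epsilon> - f \<epsilon>') \<le> K * \<epsilon> powr \<kappa>"
    and \<epsilon>: "0 < \<epsilon>" "\<epsilon> \<le> e"
  shows "norm (f \<epsilon> - lim (\<lambda>n. f (inverse (real (Suc n))))) \<le> K * \<epsilon> powr \<kappa>"
proof -
  have inv0: "filterlim (\<lambda>n. inverse (real (Suc n))) (at_right 0) sequentially"
    unfolding filterlim_at using LIMSEQ_inverse_real_of_nat by auto
  define x where "x = (\<lambda>n. f (inverse (real (Suc n))))"
  have d: "norm (x m - x n) \<le> K * inverse (real (Suc m)) powr \<kappa>"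
    if "m \<le> n" "inverse (real (Suc m)) \<le> e" for m n
    unfolding x_def using that by (intro f) auto
  have "Cauchy x"
  proof (rule metric_CauchyI)
    fix \<delta> :: real assume \<delta>: "\<delta> > 0"
    have "((\<lambda>m. K * inverse (real (Suc m)) powr \<kappa>) \<longlongrightarrow> 0) sequentially"
      by (rule filterlim_compose[OF powr_tendsto_0[OF assms(1)] inv0])
    then have "eventually (\<lambda>m. K * inverse (real (Suc m)) powr \<kappa> < \<delta> / 2) sequentially"
      using \<delta> by (intro order_tendstoD) auto
    moreover have "eventually (\<lambda>m. inverse (real (Suc m)) < e) sequentially"
      using LIMSEQ_inverse_real_of_nat assms(2) by (rule order_tendstoD)
    ultimately have "eventually (\<lambda>m. K * inverse (real (Suc m)) powr \<kappa> < \<delta> / 2 \<and> inverse (real (Suc m)) < e) sequentially"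
      by eventually_elim auto
    then obtain m where m: "K * inverse (real (Suc m)) powr \<kappa> < \<delta> / 2" "inverse (real (Suc m)) < e"
      unfolding eventually_sequentially by blast
    have *: "dist (x m) (x n) < \<delta> / 2" if "n \<ge> m" for n
      using d[OF that] m by (auto simp: dist_norm)
    show "\<exists>M. \<forall>m\<ge>M. \<forall>n\<ge>M. dist (x m) (x n) < \<delta>"
      using * by (intro exI[of _ m]) (metis dist_triangle_half_r)
  qed
  then have "x \<longlonglongrightarrow> lim x"
    using Cauchy_convergent_iff convergent_LIMSEQ_iff by blast
  then have "(\<lambda>n. norm (f \<epsilon> - x n)) \<longlonglongrightarrow> norm (f \<epsilon> - lim x)"
    by (intro tendsto_intros)
  moreover have "eventually (\<lambda>n. norm (f \<epsilon> - x n) \<le> K * \<epsilon> powr \<kappa>) sequentially"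
  proof -
    have "eventually (\<lambda>m. inverse (real (Suc m)) < \<epsilon>) sequentially"
      using LIMSEQ_inverse_real_of_nat \<epsilon>(1) by (rule order_tendstoD)
    then show ?thesis
      by eventually_elim (unfold x_def, rule f, use \<epsilon> in auto)
  qed
  ultimately show ?thesis
    unfolding x_def by (rule tendsto_upperbound) simp
qed

text \<open>
  A Cauchy condition on \<open>[- N, N]\<close> with a power of \<open>\<epsilon>\<close> as rate. The weight \<open>W\<close> carries the dependence on
  the interval, and its \<open>r\<close>-th powers have bounded sums over partitions.
\<close>

abbreviation Cauchy_with_rate :: "real \<Rightarrow> (real \<Rightarrow> real \<Rightarrow> real \<Rightarrow> 'b::real_normed_vector) \<Rightarrow> nat \<Rightarrow> bool" where
  "Cauchy_with_rate r A N \<equiv>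
    (\<exists>C \<kappa> e B W. 0 \<le> C \<and> 0 < \<kappa> \<and> 0 < e \<and> (\<forall>u v. 0 \<le> W u v) \<and>
      (\<forall>\<epsilon> \<epsilon>' u v. 0 < \<epsilon>' \<longrightarrow> \<epsilon>' \<le> \<epsilon> \<longrightarrow> \<epsilon> \<le> e \<longrightarrow> - real N \<le> u \<longrightarrow> u < v \<longrightarrow> v \<le> real N \<longrightarrow>
         norm (A \<epsilon> u v - A \<epsilon>' u v) \<le> C * \<epsilon> powr \<kappa> * W u v) \<and>
      (\<forall>s t n p. - real N \<le> s \<longrightarrow> t \<le> real N \<longrightarrow> is_partition s t n p \<longrightarrow>
         (\<Sum>l=1..n. W (p (l - 1)) (p l) powr (r)) \<le> B))"

lemma converges_in_dI:
  fixes A :: "real \<Rightarrow> real \<Rightarrow> real \<Rightarrow> 'b::euclidean_space"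
  assumes q: "0 < q" "0 < k"
    and H: "\<And>N::nat. Cauchy_with_rate (q / real k) A N"
  shows "converges_in_d q k A"
proof -
  define L where "L = (\<lambda>u v. lim (\<lambda>n. A (inverse (real (Suc n))) u v))"
  show ?thesis unfolding converges_in_d_def
  proof (intro exI[of _ L] allI impI)
    fix s t :: real assume st: "s < t"
    define N where "N = nat \<lceil>max \<bar>s\<bar> \<bar>t\<bar>\<rceil>"
    have N: "- real N \<le> s" "t \<le> real N" unfolding N_def by linarith+
    obtain C \<kappa> e B W where h: "0 \<le> C" "0 < \<kappa>" "0 < e" "\<And>u v. 0 \<le> W u v"
      and A: "\<And>\<epsilon> \<epsilon>' u v. 0 < \<epsilon>' \<Longrightarrow> \<epsilon>' \<le> \<epsilon> \<Longrightarrow> \<epsilon> \<le> e \<Longrightarrow> - real N \<le> u \<Longrightarrow> u < v \<Longrightarrow> v \<le> real N \<Longrightarrow>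
         norm (A \<epsilon> u v - A \<epsilon>' u v) \<le> C * \<epsilon> powr \<kappa> * W u v"
      and B: "\<And>s t n p. - real N \<le> s \<Longrightarrow> t \<le> real N \<Longrightarrow> is_partition s t n p \<Longrightarrow>
         (\<Sum>l=1..n. W (p (l - 1)) (p l) powr (q / real k)) \<le> B"
      using H[of N] apply (elim exE conjE)
      subgoal for C \<kappa> e B W by (rule that[of C \<kappa> e W B]) simp_all
      done
    have conv: "norm (A \<epsilon> u v - L u v) \<le> C * \<epsilon> powr \<kappa> * W u v"
      if \<epsilon>: "0 < \<epsilon>" "\<epsilon> \<le> e" and uv: "- real N \<le> u" "u < v" "v \<le> real N" for \<epsilon> u v
      using power_cauchy_limit[of \<kappa> e "\<lambda>\<epsilon>. A \<epsilon> u v" "C * W u v" \<epsilon>] h A[OF _ _ _ uv] \<epsilon>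
      by (simp add: L_def mult_ac)
    have bd: "eventually (\<lambda>\<epsilon>. d_dist q k (A \<epsilon>) L s t \<le> ennreal (C * (max B 0) powr (real k / q) * \<epsilon> powr \<kappa>)) (at_right 0)"
    proof -
      have "eventually (\<lambda>\<epsilon>::real. 0 < \<epsilon> \<and> \<epsilon> < e) (at_right 0)"
        using h(3) by (auto simp: eventually_at_right_field)
      then show ?thesis
      proof eventually_elim
        case (elim \<epsilon>)
        have "d_dist q k (A \<epsilon>) L s t \<le> ennreal ((C * \<epsilon> powr \<kappa>) * (max B 0) powr (real k / q))"
          using elim h N
          by (intro d_dist_le[where W=W] q conv order.trans[OF B[OF N]]) auto
        then show ?case by (simp add: mult_ac)
      qed
    qed
    have "((\<lambda>\<epsilon>. ennreal (C * (max B 0) powr (real k / q) * \<epsilon> powr \<kappa>)) \<longlongrightarrow> ennreal 0) (at_right 0)"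
      by (intro tendsto_ennrealI powr_tendsto_0 h)
    then show "((\<lambda>\<epsilon>. d_dist q k (A \<epsilon>) L s t) \<longlongrightarrow> 0) (at_right 0)"
      using bd by (intro tendsto_sandwich[OF _ bd tendsto_const]) auto
  qed
qed

lemma sum_powr_le:
  fixes a :: "'i \<Rightarrow> real"
  assumes "\<And>i. i \<in> I \<Longrightarrow> 0 \<le> a i" "sum a I \<le> A" "0 < A" "1 \<le> \<theta>" "finite I"
  shows "(\<Sum>i\<in>I. a i powr \<theta>) \<le> A powr \<theta>"
proof -
  have "(\<Sum>i\<in>I. a i powr \<theta>) \<le> (\<Sum>i\<in>I. A powr \<theta> * (a i / A))"
  proof (rule sum_mono)
    fix i assume i: "i \<in> I"
    have "a i \<le> sum a I" using assms i by (intro member_le_sum) auto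
    then have le: "a i / A \<le> 1" "0 \<le> a i / A" using assms i by auto
    have "a i powr \<theta> = A powr \<theta> * (a i / A) powr \<theta>"
      using assms i by (simp add: powr_divide)
    also have "\<dots> \<le> A powr \<theta> * (a i / A)"
    proof (rule mult_left_mono)
      show "(a i / A) powr \<theta> \<le> a i / A"
        using powr_le_one_le[of "a i / A" \<theta>] assms(4) le by (cases "a i / A = 0") auto
    qed simp
    finally show "a i powr \<theta> \<le> A powr \<theta> * (a i / A)" .
  qed
  also have "\<dots> = A powr \<theta> * (sum a I / A)"
    by (simp add: sum_distrib_left sum_divide_distrib)
  also have "\<dots> \<le> A powr \<theta> * 1"
    using assms by (intro mult_left_mono) auto
  finally show ?thesis by simp
qed

text \<open>
  A weak form of Hoelder's inequality: after normalizing the sums to 1, both factors are bounded by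
  powers of the same \<open>c i = a i / A + b i / B\<close>, and the sum of the \<open>c i\<close> is at most 2. In contrast to
  Hoelder's inequality this covers every pair of exponents with \<open>\<theta> + \<phi> \<ge> 1\<close>.
\<close>

lemma sum_powr_mult_le:
  fixes a b :: "'i \<Rightarrow> real"
  assumes a: "\<And>i. i \<in> I \<Longrightarrow> 0 \<le> a i" "sum a I \<le> A" "0 < A" "0 \<le> \<theta>"
    and b: "\<And>i. i \<in> I \<Longrightarrow> 0 \<le> b i" "sum b I \<le> B" "0 < B" "0 \<le> \<phi>"
    and "1 \<le> \<theta> + \<phi>" "finite I"
  shows "(\<Sum>i\<in>I. a i powr \<theta> * b i powr \<phi>) \<le> A powr \<theta> * B powr \<phi> * 2 powr (\<theta> + \<phi>)"
proof -
  define c where "c = (\<lambda>i. a i / A + b i / B)"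
  have c0: "0 \<le> c i" if "i \<in> I" for i using a b that by (auto simp: c_def)
  have cs: "sum c I \<le> 2"
  proof -
    have "sum c I = sum a I / A + sum b I / B"
      by (simp add: c_def sum.distrib sum_divide_distrib)
    also have "\<dots> \<le> 1 + 1" using a b by (intro add_mono) auto
    finally show ?thesis by simp
  qed
  have "(\<Sum>i\<in>I. a i powr \<theta> * b i powr \<phi>) \<le> (\<Sum>i\<in>I. A powr \<theta> * B powr \<phi> * c i powr (\<theta> + \<phi>))"
  proof (rule sum_mono)
    fix i assume i: "i \<in> I"
    have 1: "(a i / A) powr \<theta> \<le> c i powr \<theta>" "(b i / B) powr \<phi> \<le> c i powr \<phi>"
      using a b i by (auto intro!: powr_mono2 simp: c_def)
    have "a i powr \<theta> * b i powr \<phi> = A powr \<theta> * B powr \<phi> * ((a i / A) powr \<theta> * (b i / B) powr \<phi>)"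
      using a b i by (simp add: powr_divide)
    also have "\<dots> \<le> A powr \<theta> * B powr \<phi> * (c i powr \<theta> * c i powr \<phi>)"
      using 1 by (intro mult_left_mono mult_mono) auto
    finally show "a i powr \<theta> * b i powr \<phi> \<le> A powr \<theta> * B powr \<phi> * c i powr (\<theta> + \<phi>)"
      by (simp add: powr_add)
  qed
  also have "\<dots> \<le> A powr \<theta> * B powr \<phi> * 2 powr (\<theta> + \<phi>)"
    unfolding sum_distrib_left[symmetric]
    using sum_powr_le[of I c 2 "\<theta> + \<phi>"] c0 cs assms by (intro mult_left_mono) auto
  finally show ?thesis .
qed

lemma sum_partition_mesh:
  assumes "is_partition s t n p"
  shows "(\<Sum>l=1..n. p l - p (l - 1)) = t - s"
proof -
  have "(\<Sum>l=1..n. p l - p (l - 1)) = p n - p 0"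
    by (induction n) auto
  then show ?thesis using assms by (simp add: is_partition_def)
qed

lemma partition_less:
  assumes "is_partition s t n p" "i < j" "j \<le> n"
  shows "p i < p j"
  using assms(2,3)
proof (induction j)
  case (Suc j)
  have "p j < p (Suc j)" using assms(1) Suc.prems by (auto simp: is_partition_def)
  moreover have "i = j \<or> p i < p j" using Suc.IH Suc.prems by (cases "i = j") auto
  ultimately show ?case by auto
qed simp

section \<open>Holomorphic functions with controlled growth at the boundary\<close>

text \<open>
  The growth that \<open>g = P'\<close> must have for \<open>P\<close> to be \<open>\<beta>\<close>-Hoelder up to the real axis.
\<close>

definition growth_bound :: "real \<Rightarrow> real \<Rightarrow> real \<Rightarrow> (complex \<Rightarrow> complex) \<Rightarrow> bool" where
  "growth_bound \<beta> N C g \<longleftrightarrow>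
     (\<forall>z. \<bar>Re z\<bar> \<le> N \<longrightarrow> 0 < Im z \<longrightarrow> Im z \<le> N \<longrightarrow> norm (g z) \<le> C * Im z powr (\<beta> - 1))"

lemma growth_boundD:
  "growth_bound \<beta> N C g \<Longrightarrow> \<bar>x\<bar> \<le> N \<Longrightarrow> 0 < y \<Longrightarrow> y \<le> N \<Longrightarrow> norm (g (Complex x y)) \<le> C * y powr (\<beta> - 1)"
  unfolding growth_bound_def by (metis complex.sel)

lemma has_vector_derivative_Complex_vertical:
  assumes "(P has_field_derivative d) (at (Complex x y))"
  shows "((\<lambda>y. P (Complex x y)) has_vector_derivative \<i> * d) (at y within S)"
proof -
  have "((\<lambda>y. Complex x y) has_vector_derivative \<i>) (at y within S)"
    unfolding Complex_eq by (auto intro!: derivative_eq_intros simp: has_vector_derivative_def scaleR_conv_of_real)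
  from field_vector_diff_chain_within[OF this, of P d] assms show ?thesis
    by (simp add: o_def has_field_derivative_at_within)
qed

lemma has_vector_derivative_Complex_horizontal:
  assumes "(P has_field_derivative d) (at (Complex x y))"
  shows "((\<lambda>x. P (Complex x y)) has_vector_derivative d) (at x within S)"
proof -
  have "((\<lambda>x. Complex x y) has_vector_derivative 1) (at x within S)"
    unfolding Complex_eq by (auto intro!: derivative_eq_intros simp: has_vector_derivative_def scaleR_conv_of_real)
  from field_vector_diff_chain_within[OF this, of P d] assms show ?thesis
    by (simp add: o_def has_field_derivative_at_within)
qed

lemma powr_has_vector_derivative:
  fixes y :: real
  assumes "0 < y" "\<beta> \<noteq> 0"
  shows "((\<lambda>y. C / \<beta> * y powr \<beta>) has_vector_derivative C * y powr (\<beta> - 1)) (at y)"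
  using assms unfolding has_real_derivative_iff_has_vector_derivative[symmetric]
  by (auto intro!: derivative_eq_intros)

locale half_plane_primitive =
  fixes g P :: "complex \<Rightarrow> complex" and \<beta> N C :: real
  assumes prim: "\<And>z. Im z > 0 \<Longrightarrow> (P has_field_derivative g z) (at z)"
    and bnd: "growth_bound \<beta> N C g" and \<beta>: "0 < \<beta>" "\<beta> < 1" and C: "0 \<le> C"
begin

text \<open>
  The bound on the derivative is integrable down to height 0 because \<open>\<beta> > 0\<close>.
\<close>

lemma vertical_difference:
  assumes "\<bar>x\<bar> \<le> N" "0 < y'" "y' \<le> y" "y \<le> N"
  shows "norm (P (Complex x y) - P (Complex x y')) \<le> C / \<beta> * y powr \<beta>"
proof (cases "y' = y")
  case False
  have d: "((\<lambda>y. P (Complex x y)) has_vector_derivative \<i> * g (Complex x \<tau>)) (at \<tau> within S)" if "0 < \<tau>" for \<tau> S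
    using prim that by (intro has_vector_derivative_Complex_vertical) auto
  have "norm (P (Complex x y) - P (Complex x y')) \<le> C / \<beta> * y powr \<beta> - C / \<beta> * y' powr \<beta>"
  proof (rule differentiable_bound_general[where f' = "\<lambda>\<tau>. \<i> * g (Complex x \<tau>)" and \<phi>' = "\<lambda>\<tau>. C * \<tau> powr (\<beta> - 1)"])
    show "continuous_on {y'..y} (\<lambda>y. P (Complex x y))"
      by (rule continuous_on_vector_derivative, rule d) (use assms in auto)
    show "continuous_on {y'..y} (\<lambda>y. C / \<beta> * y powr \<beta>)"
      using assms by (intro continuous_intros) auto
    fix \<tau> assume \<tau>: "y' < \<tau>" "\<tau> < y"
    show "norm (\<i> * g (Complex x \<tau>)) \<le> C * \<tau> powr (\<beta> - 1)"
      using growth_boundD[OF bnd, of x \<tau>] assms \<tau> by (simp add: norm_mult)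
    show "((\<lambda>y. C / \<beta> * y powr \<beta>) has_vector_derivative C * \<tau> powr (\<beta> - 1)) (at \<tau>)"
      using \<tau> assms \<beta> by (intro powr_has_vector_derivative) auto
  qed (use assms False in \<open>auto intro!: d\<close>)
  moreover have "0 \<le> C / \<beta> * y' powr \<beta>" using C \<beta> by simp
  ultimately show ?thesis by linarith
qed (use C \<beta> in auto)

lemma horizontal_difference:
  assumes "- N \<le> u" "u \<le> v" "v \<le> N" "0 < y" "y \<le> N"
  shows "norm (P (Complex v y) - P (Complex u y)) \<le> C * y powr (\<beta> - 1) * (v - u)"
proof (cases "u = v")
  case False
  have d: "((\<lambda>x. P (Complex x y)) has_vector_derivative g (Complex x y)) (at x within S)" for x S
    using prim assms by (intro has_vector_derivative_Complex_horizontal) auto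
  have "norm (P (Complex v y) - P (Complex u y)) \<le> C * y powr (\<beta> - 1) * v - C * y powr (\<beta> - 1) * u"
  proof (rule differentiable_bound_general[where f' = "\<lambda>x. g (Complex x y)" and \<phi>' = "\<lambda>_. C * y powr (\<beta> - 1)"])
    show "continuous_on {u..v} (\<lambda>x. P (Complex x y))"
      using d by (intro continuous_on_vector_derivative) auto
    show "continuous_on {u..v} (\<lambda>x. C * y powr (\<beta> - 1) * x)"
      by (intro continuous_intros)
    fix x assume x: "u < x" "x < v"
    show "norm (g (Complex x y)) \<le> C * y powr (\<beta> - 1)"
      using growth_boundD[OF bnd, of x y] assms x by auto
    show "((\<lambda>x. C * y powr (\<beta> - 1) * x) has_vector_derivative C * y powr (\<beta> - 1)) (at x)"
      unfolding has_real_derivative_iff_has_vector_derivative[symmetric]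
      by (auto intro!: derivative_eq_intros)
  qed (use assms False in \<open>auto intro!: d\<close>)
  then show ?thesis by (simp add: algebra_simps)
qed auto

text \<open>
  At a height \<open>y\<close> below the length \<open>h = v - u\<close>, a direct horizontal path costs too much; the path instead
  climbs to height \<open>h\<close>, crosses there, and descends.
\<close>

lemma Holder_increment:
  assumes "- N \<le> u" "u < v" "v \<le> N" "v - u \<le> N" "0 < y" "y \<le> N"
  shows "norm (P (Complex v y) - P (Complex u y)) \<le> C * (1 + 2 / \<beta>) * (v - u) powr \<beta>"
proof -
  define h where "h = v - u"
  have h: "0 < h" "h \<le> N" using assms by (auto simp: h_def)
  have nn: "0 \<le> C / \<beta> * h powr \<beta>" using C \<beta> by simp
  have hh: "C * h powr (\<beta> - 1) * h = C * h powr \<beta>"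
    using h by (simp add: powr_diff)
  have ex: "C * (1 + 2 / \<beta>) * h powr \<beta> = C * h powr \<beta> + 2 * (C / \<beta> * h powr \<beta>)"
    by (simp add: algebra_simps)
  consider "h \<le> y" | "y < h" by linarith
  then show ?thesis
  proof cases
    case 1
    have "norm (P (Complex v y) - P (Complex u y)) \<le> C * y powr (\<beta> - 1) * h"
      using horizontal_difference[of u v y] assms by (simp add: h_def)
    also have "\<dots> \<le> C * h powr (\<beta> - 1) * h"
      using 1 h C \<beta> by (intro mult_right_mono mult_left_mono powr_mono2') auto
    finally show ?thesis using hh nn ex unfolding h_def by linarith
  next
    case 2
    have v: "norm (P (Complex x h) - P (Complex x y)) \<le> C / \<beta> * h powr \<beta>" if "\<bar>x\<bar> \<le> N" for x
      using vertical_difference[of x y h] that 2 h assms by auto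
    have "norm (P (Complex v h) - P (Complex u h)) \<le> C * h powr (\<beta> - 1) * h"
      using horizontal_difference[of u v h] h assms by (auto simp: h_def)
    then have "norm (P (Complex v h) - P (Complex u h)) \<le> C * h powr \<beta>"
      unfolding hh .
    moreover have "norm (P (Complex v h) - P (Complex v y)) \<le> C / \<beta> * h powr \<beta>"
      "norm (P (Complex u h) - P (Complex u y)) \<le> C / \<beta> * h powr \<beta>"
      using assms by (intro v; simp)+
    moreover have "norm (P (Complex v y) - P (Complex u y)) \<le>
       norm (P (Complex v h) - P (Complex u h)) + norm (P (Complex v h) - P (Complex v y))
       + norm (P (Complex u h) - P (Complex u y))" by norm
    ultimately show ?thesis using ex unfolding h_def by linarith
  qed
qed


text \<open>
  Below the length of the interval the vertical estimate is the better one, above it the Hoelder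
  estimate. Both are summarized by the power \<open>\<beta>\<close> of \<open>min y (v - u)\<close>, which is then split into a power \<open>\<kappa>\<close>
  of \<open>y\<close>, the rate of convergence, and a power \<open>\<beta> - \<kappa>\<close> of the length.
\<close>

lemma increment_Cauchy:
  assumes "- N \<le> u" "u < v" "v \<le> N" "v - u \<le> N" "0 < y'" "y' \<le> y" "y \<le> N" "0 < \<kappa>" "\<kappa> < \<beta>"
  shows "norm ((P (Complex v y) - P (Complex u y)) - (P (Complex v y') - P (Complex u y')))
      \<le> 2 * C * (1 + 2 / \<beta>) * (y powr \<kappa> * (v - u) powr (\<beta> - \<kappa>))" (is "norm ?D \<le> _")
proof -
  define h where "h = v - u"
  \<comment> \<open>the smaller of the two scales decides which estimate is used\<close>
  define m where "m = min y h"
  define K where "K = C * (1 + 2 / \<beta>)"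
  have h: "0 < h" "h \<le> N" using assms by (auto simp: h_def)
  have m: "0 < m" "m \<le> y" "m \<le> h" using assms h by (auto simp: m_def)
  have "0 \<le> C / \<beta>" "K = C + 2 * (C / \<beta>)" using C \<beta> by (auto simp: K_def algebra_simps)
  then have K: "0 \<le> K" "C / \<beta> \<le> K" using C by auto
  have "norm ?D \<le> 2 * K * m powr \<beta>"
  proof (cases "y \<le> h")
    case True
    have v: "norm (P (Complex x y) - P (Complex x y')) \<le> K * m powr \<beta>" if "\<bar>x\<bar> \<le> N" for x
    proof -
      have "norm (P (Complex x y) - P (Complex x y')) \<le> C / \<beta> * y powr \<beta>"
        using vertical_difference[of x y' y] that assms by auto
      also have "\<dots> \<le> K * y powr \<beta>" using K by (intro mult_right_mono) auto
      finally show ?thesis using True by (simp add: m_def)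
    qed
    have "norm ?D
       \<le> norm (P (Complex v y) - P (Complex v y')) + norm (P (Complex u y) - P (Complex u y'))" by norm
    moreover have "\<bar>u\<bar> \<le> N" "\<bar>v\<bar> \<le> N" using assms by auto
    ultimately show ?thesis using v[of u] v[of v] by linarith
  next
    case False
    have "norm (P (Complex v y) - P (Complex u y)) \<le> K * m powr \<beta>"
      "norm (P (Complex v y') - P (Complex u y')) \<le> K * m powr \<beta>"
      using Holder_increment[of u v y] Holder_increment[of u v y'] assms False by (auto simp: K_def m_def h_def)
    moreover have "norm ?D
       \<le> norm (P (Complex v y) - P (Complex u y)) + norm (P (Complex v y') - P (Complex u y'))" by norm
    ultimately show ?thesis by linarith
  qed
  also have "m powr \<beta> = m powr \<kappa> * m powr (\<beta> - \<kappa>)"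
    by (simp add: powr_add[symmetric])
  also have "2 * K * (m powr \<kappa> * m powr (\<beta> - \<kappa>)) \<le> 2 * K * (y powr \<kappa> * h powr (\<beta> - \<kappa>))"
    using K m assms by (intro mult_left_mono mult_mono powr_mono2) auto
  finally show ?thesis by (simp add: K_def h_def)
qed

end

text \<open>
  On every ray from the origin the primitive \<open>P\<close> extends continuously to 0, with one and the same limit
  for all rays. Hence the singular integral from 0 is evaluated by the fundamental theorem, and
  increments of \<^const>\<open>Gamma_plus\<close> are increments of \<open>P\<close>.
\<close>

lemma Gamma_plus_eq_primitive:
  fixes g P :: "complex \<Rightarrow> complex"
  assumes prim: "\<And>z. Im z > 0 \<Longrightarrow> (P has_field_derivative g z) (at z)"
    and bnd: "\<And>N::nat. \<exists>C\<ge>0. growth_bound \<beta> (real N) C g" and \<beta>: "0 < \<beta>" "\<beta> < 1"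
  shows "\<exists>c. \<forall>z. 0 < Im z \<longrightarrow> Gamma_plus g z = P z - c"
proof -
  define c where "c = lim (\<lambda>n. P (Complex 0 (inverse (real (Suc n)))))"
  have "Gamma_plus g z = P z - c" if z: "0 < Im z" for z
  proof -
    define N where "N = nat \<lceil>max \<bar>Re z\<bar> (Im z)\<rceil>"
    have N: "\<bar>Re z\<bar> \<le> N" "Im z \<le> N" unfolding N_def by linarith+
    obtain C where C: "0 \<le> C" "growth_bound \<beta> (real N) C g" using bnd by blast
    interpret half_plane_primitive g P \<beta> N C using prim C \<beta> by unfold_locales auto
    have lim: "norm (P (Complex 0 \<epsilon>) - c) \<le> C / \<beta> * \<epsilon> powr \<beta>" if "0 < \<epsilon>" "\<epsilon> \<le> N" for \<epsilon> :: real
      unfolding c_def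
      by (rule power_cauchy_limit[where e = "real N"]) (use that \<beta> vertical_difference[of 0] in auto)
    \<comment> \<open>The point \<open>t * z\<close> is reached from 0 by a vertical segment of height \<open>t * Im z\<close>
      followed by a horizontal one of length \<open>t * \<bar>Re z\<bar>\<close>.\<close>
    define D where "D = C * \<bar>Re z\<bar> * Im z powr (\<beta> - 1) + C / \<beta> * Im z powr \<beta>"
    have near: "norm (P (of_real t * z) - c) \<le> D * t powr \<beta>" if t: "0 < t" "t \<le> 1" for t
    proof -
      have tN: "t * \<bar>Re z\<bar> \<le> N" "t * Im z \<le> N" "0 < t * Im z"
        using N z t order.trans[OF mult_left_le_one_le[of "\<bar>Re z\<bar>" t]] order.trans[OF mult_left_le_one_le[of "Im z" t]] by auto
      have tz: "of_real t * z = Complex (t * Re z) (t * Im z)" by (simp add: complex_eq_iff)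
      have "norm (P (Complex (t * Re z) (t * Im z)) - P (Complex 0 (t * Im z))) \<le>
          C * (t * Im z) powr (\<beta> - 1) * (t * \<bar>Re z\<bar>)"
      proof (cases "0 \<le> Re z")
        case True
        then show ?thesis
          using horizontal_difference[of 0 "t * Re z" "t * Im z"] tN t by auto
      next
        case False
        then have "t * Re z \<le> 0" using t by (simp add: mult_nonneg_nonpos)
        then show ?thesis
          using horizontal_difference[of "t * Re z" 0 "t * Im z"] tN t False by (auto simp: norm_minus_commute)
      qed
      also have "\<dots> = C * \<bar>Re z\<bar> * Im z powr (\<beta> - 1) * t powr \<beta>"
        using t z by (simp add: powr_mult powr_diff)
      finally have 1: "norm (P (Complex (t * Re z) (t * Im z)) - P (Complex 0 (t * Im z))) \<le>
          C * \<bar>Re z\<bar> * Im z powr (\<beta> - 1) * t powr \<beta>" .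
      have "norm (P (Complex 0 (t * Im z)) - c) \<le> C / \<beta> * (t * Im z) powr \<beta>"
        using lim tN by auto
      also have "\<dots> = C / \<beta> * Im z powr \<beta> * t powr \<beta>"
        using t z by (simp add: powr_mult)
      finally have 2: "norm (P (Complex 0 (t * Im z)) - c) \<le> C / \<beta> * Im z powr \<beta> * t powr \<beta>" .
      have "norm (P (of_real t * z) - c) \<le> norm (P (Complex (t * Re z) (t * Im z)) - P (Complex 0 (t * Im z)))
        + norm (P (Complex 0 (t * Im z)) - c)" unfolding tz by norm
      with 1 2 show ?thesis by (simp add: D_def algebra_simps)
    qed
    define f where "f = (\<lambda>t. if t = 0 then c else P (of_real t * z))"
    have d: "(f has_vector_derivative g (of_real t * z) * z) (at t)" if "0 < t" for t
    proof -
      have "((\<lambda>t. of_real t * z) has_vector_derivative z) (at t)"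
        by (auto intro!: derivative_eq_intros simp: has_vector_derivative_def scaleR_conv_of_real)
      moreover have "(P has_field_derivative g (of_real t * z)) (at (of_real t * z))"
        using that z by (intro prim) auto
      ultimately have "((\<lambda>t. P (of_real t * z)) has_vector_derivative g (of_real t * z) * z) (at t)"
        using field_vector_diff_chain_at[of "\<lambda>t. of_real t * z" z t P] by (simp add: o_def mult.commute[of z])
      then show ?thesis
        by (rule has_vector_derivative_transform_within_open[where S = "{0<..}"]) (use that in \<open>auto simp: f_def\<close>)
    qed
    have "continuous_on {0..1} f"
      unfolding continuous_on_def
    proof
      fix t :: real assume t: "t \<in> {0..1}"
      show "(f \<longlongrightarrow> f t) (at t within {0..1})"
      proof (cases "t = 0")
        case True
        have "((\<lambda>t. f t - c) \<longlongrightarrow> 0) (at_right 0)"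
        proof (rule Lim_null_comparison[OF _ powr_tendsto_0[of \<beta> D, OF \<beta>(1)]])
          have "eventually (\<lambda>t::real. 0 < t \<and> t < 1) (at_right 0)"
            by (auto simp: eventually_at_right_field intro!: exI[of _ 1])
          then show "eventually (\<lambda>t. norm (f t - c) \<le> D * t powr \<beta>) (at_right 0)"
            by eventually_elim (use near in \<open>auto simp: f_def\<close>)
        qed
        then have "(f \<longlongrightarrow> c) (at_right 0)" by (simp add: LIM_zero_iff)
        then show ?thesis using True
          by (simp add: f_def at_within_Icc_at_right)
      next
        case False
        then have "continuous (at t within {0..1}) f"
          using t d[of t] by (auto intro: has_vector_derivative_continuous has_vector_derivative_at_within)
        then show ?thesis by (simp add: continuous_within)
      qed
    qed
    then have "((\<lambda>t. g (of_real t * z) * z) has_integral f 1 - f 0) {0..1}"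
      by (intro fundamental_theorem_of_calculus_interior) (auto intro!: d)
    then have "(g has_contour_integral P z - c) (linepath 0 z)"
      unfolding has_contour_integral_linepath by (simp add: f_def linepath_def scaleR_conv_of_real)
    then show ?thesis by (simp add: Gamma_plus_def contour_integral_unique)
  qed
  then show ?thesis by blast
qed


lemma continuous_on_Complex_pair:
  assumes "continuous_on {z. 0 < Im z} f" "S \<subseteq> {0<..} \<times> UNIV"
  shows "continuous_on S (\<lambda>p. f (Complex (snd p) (fst p)))"
  by (rule continuous_on_compose2[OF assms(1)])
     (use assms(2) in \<open>auto simp: Complex_eq intro!: continuous_intros\<close>)

lemma continuous_on_Complex_fst:
  assumes "continuous_on {z. 0 < Im z} f" "S \<subseteq> {0<..} \<times> UNIV"
  shows "continuous_on S (\<lambda>p. f (Complex s (fst p)))"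
  by (rule continuous_on_compose2[OF assms(1)])
     (use assms(2) in \<open>auto simp: Complex_eq intro!: continuous_intros\<close>)

text \<open>
  With \<open>a\<close>, \<open>b\<close> twice the real parts of primitives of \<open>g1\<close>, \<open>g2\<close>, the integrand is the Jacobian
  \<open>a\<^sub>x * b\<^sub>y - a\<^sub>y * b\<^sub>x\<close>.
\<close>

definition cross_integral :: "(complex \<Rightarrow> complex) \<Rightarrow> (complex \<Rightarrow> complex) \<Rightarrow> real \<Rightarrow> real \<Rightarrow> real \<Rightarrow> real" where
  "cross_integral g1 g2 y s t = integral {s..t} (\<lambda>x. 4 * Im (g1 (Complex x y) * cnj (g2 (Complex x y))))"

lemma cross_integral_continuous:
  assumes g: "g1 holomorphic_on {z. 0 < Im z}" "g2 holomorphic_on {z. 0 < Im z}" and a: "0 < a"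
  shows "continuous_on {a..b} (\<lambda>y. cross_integral g1 g2 y s t)"
proof -
  have "continuous_on (cbox a b \<times> cbox s t)
     (\<lambda>(y, x). 4 * Im (g1 (Complex x y) * cnj (g2 (Complex x y))))"
    unfolding case_prod_unfold using a
    by (intro continuous_intros g[THEN holomorphic_on_imp_continuous_on, THEN continuous_on_Complex_pair]) auto
  from integral_continuous_on_param[OF this]
  show ?thesis by (simp add: cross_integral_def)
qed

locale half_plane_pair =
  p1: half_plane_primitive g1 P1 \<beta> N C1 + p2: half_plane_primitive g2 P2 \<beta> N C2 for g1 P1 g2 P2 \<beta> N C1 C2 +
  assumes hol: "g1 holomorphic_on {z. 0 < Im z}" "g2 holomorphic_on {z. 0 < Im z}"
begin

abbreviation path1 :: "real \<Rightarrow> real \<Rightarrow> real" where "path1 x y \<equiv> 2 * Re (P1 (Complex x y))"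
abbreviation path2 :: "real \<Rightarrow> real \<Rightarrow> real" where "path2 x y \<equiv> 2 * Re (P2 (Complex x y))"

definition area :: "real \<Rightarrow> real \<Rightarrow> real \<Rightarrow> real" where
  "area y s t = integral {s..t} (\<lambda>x. 2 * Re (g1 (Complex x y)) * (path2 x y - path2 s y))"

abbreviation F :: "real \<Rightarrow> real \<Rightarrow> real \<Rightarrow> real" where
  "F \<equiv> cross_integral g1 g2"

definition area' :: "real \<Rightarrow> real \<Rightarrow> real \<Rightarrow> real" where
  "area' y s t = - 2 * Im (g1 (Complex t y)) * (path2 t y - path2 s y)
     + (path1 t y - path1 s y) * (2 * Im (g2 (Complex s y))) + F y s t"

lemma open_half_plane: "open {z. 0 < Im z}"
  by (rule open_halfspace_Im_gt)

lemma cont: "continuous_on {z. 0 < Im z} g1" "continuous_on {z. 0 < Im z} g2"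
  "continuous_on {z. 0 < Im z} P1" "continuous_on {z. 0 < Im z} P2"
  "continuous_on {z. 0 < Im z} (deriv g1)"
proof -
  show "continuous_on {z. 0 < Im z} g1" "continuous_on {z. 0 < Im z} g2"
    using hol by (auto intro: holomorphic_on_imp_continuous_on)
  show "continuous_on {z. 0 < Im z} (deriv g1)"
    using hol open_half_plane by (intro holomorphic_on_imp_continuous_on holomorphic_deriv) auto
  show "continuous_on {z. 0 < Im z} P1" "continuous_on {z. 0 < Im z} P2"
    using p1.prim p2.prim by (auto intro!: continuous_at_imp_continuous_on DERIV_isCont)
qed

lemmas cont_pair = cont[THEN continuous_on_Complex_pair]
lemmas cont_fst = cont[THEN continuous_on_Complex_fst]

lemma cont_x:
  assumes "continuous_on {z. 0 < Im z} f" "0 < y"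
  shows "continuous_on S (\<lambda>x. f (Complex x y))"
  by (rule continuous_on_compose2[OF assms(1)])
     (use assms(2) in \<open>auto simp: Complex_eq intro!: continuous_intros\<close>)

text \<open>
  Differentiating \<open>a\<^sub>x * (b - b(s))\<close> in \<open>y\<close> produces \<open>a\<^sub>x\<^sub>y * (b - b(s))\<close>, whose integral in \<open>x\<close> would be too
  singular to estimate. Integrating it by parts leaves a boundary term at \<open>t\<close> and \<open>- a\<^sub>y * b\<^sub>x\<close>. The latter combines
  with \<open>a\<^sub>x * b\<^sub>y\<close> to the cross term, and \<open>a\<^sub>x * b\<^sub>y(s)\<close> is integrated exactly.
\<close>

lemma area_deriv:
  assumes "0 < a" "a \<le> y" "y \<le> b" "s \<le> t"
  shows "((\<lambda>y. area y s t) has_vector_derivative area' y s t) (at y within {a..b})"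
proof -
  define f where "f = (\<lambda>y x. 2 * Re (g1 (Complex x y)) * (path2 x y - path2 s y))"
  \<comment> \<open>the \<open>y\<close>-derivative of the integrand \<open>f\<close>\<close>
  define fy where "fy = (\<lambda>y x. - 2 * Im (deriv g1 (Complex x y)) * (path2 x y - path2 s y)
     + 2 * Re (g1 (Complex x y)) * (- 2 * Im (g2 (Complex x y)) + 2 * Im (g2 (Complex s y))))"
  have dg1: "(g1 has_field_derivative deriv g1 z) (at z)" if "0 < Im z" for z
    using that hol open_half_plane by (intro holomorphic_derivI) auto
  have Dv: "((\<lambda>y. Re (h (Complex x y))) has_real_derivative - Im h') (at y within S)"
      and Dvi: "((\<lambda>y. Im (h (Complex x y))) has_real_derivative Re h') (at y within S)"
    if "(h has_field_derivative h') (at (Complex x y))" for h h' x y S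
    using has_vector_derivative_Complex_vertical[OF that, of S]
    unfolding has_real_derivative_iff_has_vector_derivative
    by (auto dest: bounded_linear.has_vector_derivative[OF bounded_linear_Re]
      bounded_linear.has_vector_derivative[OF bounded_linear_Im])
  have Dh: "((\<lambda>x. Re (h (Complex x y))) has_real_derivative Re h') (at x within S)"
      and Dhi: "((\<lambda>x. Im (h (Complex x y))) has_real_derivative Im h') (at x within S)"
    if "(h has_field_derivative h') (at (Complex x y))" for h h' x y S
    using has_vector_derivative_Complex_horizontal[OF that, of S]
    unfolding has_real_derivative_iff_has_vector_derivative
    by (auto dest: bounded_linear.has_vector_derivative[OF bounded_linear_Re]
      bounded_linear.has_vector_derivative[OF bounded_linear_Im])
  have "((\<lambda>y. integral (cbox s t) (f y)) has_field_derivative integral (cbox s t) (fy y)) (at y within {a..b})"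
  proof (rule leibniz_rule_field_derivative)
    fix y x assume "y \<in> {a..b}" "x \<in> cbox s t"
    then have "0 < y" using assms by auto
    then show "((\<lambda>y. f y x) has_field_derivative fy y x) (at y within {a..b})"
      unfolding f_def fy_def
      by (intro DERIV_cong[OF DERIV_mult[OF DERIV_cmult[OF Dv[OF dg1]]
            DERIV_diff[OF DERIV_cmult[OF Dv[OF p2.prim]] DERIV_cmult[OF Dv[OF p2.prim]]]]])
         (auto simp: algebra_simps)
  next
    fix y assume "y \<in> {a..b}"
    then show "f y integrable_on cbox s t" unfolding f_def
      using assms by (intro integrable_continuous continuous_intros cont_x cont) auto
  next
    have "continuous_on ({a..b} \<times> cbox s t) (\<lambda>p. fy (fst p) (snd p))"
      unfolding fy_def
      by (intro continuous_intros cont_pair cont_fst) (use assms in auto)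
    then show "continuous_on ({a..b} \<times> cbox s t) (\<lambda>(y, x). fy y x)" by (simp add: case_prod_unfold)
  qed (use assms in auto)
  moreover have "integral (cbox s t) (fy y) = area' y s t"
  proof -
    have y: "0 < y" using assms by auto
    \<comment> \<open>The integration by parts: the left-hand side is the \<open>x\<close>-derivative of \<open>a\<^sub>y * (b - b(s))\<close>. The facts 1, 2 and 3
      add up to the integral of \<open>fy y\<close>.\<close>
    have 1: "((\<lambda>x. - 2 * Im (deriv g1 (Complex x y)) * (path2 x y - path2 s y)
        - 2 * Im (g1 (Complex x y)) * (2 * Re (g2 (Complex x y)))) has_integral
        - 2 * Im (g1 (Complex t y)) * (path2 t y - path2 s y)
        - - 2 * Im (g1 (Complex s y)) * (path2 s y - path2 s y)) {s..t}"
      using y assms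
      by (intro fundamental_theorem_of_calculus, simp,
          unfold has_real_derivative_iff_has_vector_derivative[symmetric],
          intro DERIV_cong[OF DERIV_mult[OF DERIV_cmult[OF Dhi[OF dg1]]
            DERIV_diff[OF DERIV_cmult[OF Dh[OF p2.prim]] DERIV_const]]])
         (auto simp: algebra_simps)
    have 2: "((\<lambda>x. 2 * Re (g1 (Complex x y)) * (2 * Im (g2 (Complex s y)))) has_integral
        path1 t y * (2 * Im (g2 (Complex s y))) - path1 s y * (2 * Im (g2 (Complex s y)))) {s..t}"
      using y assms
      by (intro fundamental_theorem_of_calculus, simp,
          unfold has_real_derivative_iff_has_vector_derivative[symmetric],
          intro DERIV_cong[OF DERIV_cmult_right[OF DERIV_cmult[OF Dh[OF p1.prim]]]])
         auto
    have 3: "((\<lambda>x. 4 * Im (g1 (Complex x y) * cnj (g2 (Complex x y)))) has_integral F y s t) {s..t}"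
      unfolding cross_integral_def using y
      by (intro integrable_integral integrable_continuous_real continuous_intros cont_x cont) auto
    have "(fy y has_integral area' y s t) {s..t}"
      using has_integral_add[OF has_integral_add[OF 1 2] 3]
      by (rule has_integral_eq_rhs[OF has_integral_eq[rotated]]) (simp_all add: fy_def area'_def algebra_simps)
    then show ?thesis by (simp add: integral_unique)
  qed
  ultimately show ?thesis
    by (simp add: area_def[abs_def] f_def has_real_derivative_iff_has_vector_derivative)
qed


lemma P2_increment:
  assumes "- N \<le> s" "s < t" "t \<le> N" "t - s \<le> N" "0 < y" "y \<le> N"
  shows "\<bar>path2 t y - path2 s y\<bar> \<le> 2 * C2 * (1 + 2 / \<beta>) * (t - s) powr \<beta>"
proof -
  have "\<bar>Re (P2 (Complex t y) - P2 (Complex s y))\<bar> \<le> C2 * (1 + 2 / \<beta>) * (t - s) powr \<beta>"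
    using p2.Holder_increment[OF assms] abs_Re_le_cmod order.trans by blast
  then show ?thesis by (simp add: abs_le_iff)
qed

lemma P1_increment:
  assumes "- N \<le> s" "s < t" "t \<le> N" "t - s \<le> N" "0 < y" "y \<le> N"
  shows "\<bar>path1 t y - path1 s y\<bar> \<le> 2 * C1 * (1 + 2 / \<beta>) * (t - s) powr \<beta>"
proof -
  have "\<bar>Re (P1 (Complex t y) - P1 (Complex s y))\<bar> \<le> C1 * (1 + 2 / \<beta>) * (t - s) powr \<beta>"
    using p1.Holder_increment[OF assms] abs_Re_le_cmod order.trans by blast
  then show ?thesis by (simp add: abs_le_iff)
qed

lemma area'_bound:
  assumes "- N \<le> s" "s < t" "t \<le> N" "t - s \<le> N" "0 < y" "y \<le> N"
  shows "\<bar>area' y s t\<bar> \<le> 8 * C1 * C2 * (1 + 2 / \<beta>) * (t - s) powr \<beta> * y powr (\<beta> - 1) + \<bar>F y s t\<bar>"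
proof -
  have st: "\<bar>s\<bar> \<le> N" "\<bar>t\<bar> \<le> N" using assms by auto
  have g1: "\<bar>2 * Im (g1 (Complex t y))\<bar> \<le> 2 * (C1 * y powr (\<beta> - 1))"
    using growth_boundD[OF p1.bnd st(2) assms(5,6)] abs_Im_le_cmod[of "g1 (Complex t y)"] by (simp add: abs_mult)
  have g2: "\<bar>2 * Im (g2 (Complex s y))\<bar> \<le> 2 * (C2 * y powr (\<beta> - 1))"
    using growth_boundD[OF p2.bnd st(1) assms(5,6)] abs_Im_le_cmod[of "g2 (Complex s y)"] by (simp add: abs_mult)
  have 1: "\<bar>- 2 * Im (g1 (Complex t y)) * (path2 t y - path2 s y)\<bar>
     \<le> 2 * (C1 * y powr (\<beta> - 1)) * (2 * C2 * (1 + 2 / \<beta>) * (t - s) powr \<beta>)"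
    unfolding abs_mult using mult_mono[OF g1 P2_increment[OF assms]] p1.C by (simp add: abs_mult)
  have 2: "\<bar>(path1 t y - path1 s y) * (2 * Im (g2 (Complex s y)))\<bar>
     \<le> (2 * C1 * (1 + 2 / \<beta>) * (t - s) powr \<beta>) * (2 * (C2 * y powr (\<beta> - 1)))"
    using mult_mono[OF P1_increment[OF assms] g2] p1.C p1.\<beta> by (simp add: abs_mult)
  have "\<bar>area' y s t\<bar> \<le> 2 * (C1 * y powr (\<beta> - 1)) * (2 * C2 * (1 + 2 / \<beta>) * (t - s) powr \<beta>) +
      (2 * C1 * (1 + 2 / \<beta>) * (t - s) powr \<beta>) * (2 * (C2 * y powr (\<beta> - 1))) + \<bar>F y s t\<bar>"
    unfolding area'_def using 1 2 by linarith
  also have "\<dots> = 8 * C1 * C2 * (1 + 2 / \<beta>) * (t - s) powr \<beta> * y powr (\<beta> - 1) + \<bar>F y s t\<bar>"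
  proof -
    define Y B H where "Y = y powr (\<beta> - 1)" "B = 1 + 2 / \<beta>" "H = (t - s) powr \<beta>"
    show ?thesis unfolding Y_B_H_def[symmetric] by simp
  qed
  finally show ?thesis .
qed

lemma area_difference:
  assumes st: "- N \<le> s" "s < t" "t \<le> N" "t - s \<le> N" and y: "0 < y'" "y' \<le> y" "y \<le> N"
  shows "\<bar>area y s t - area y' s t\<bar> \<le>
    8 * C1 * C2 * (1 + 2 / \<beta>) / \<beta> * (t - s) powr \<beta> * y powr \<beta> + integral {y'..y} (\<lambda>y. \<bar>F y s t\<bar>)"
proof (cases "y' = y")
  case False
  define K where "K = 8 * C1 * C2 * (1 + 2 / \<beta>) * (t - s) powr \<beta>"
  have K: "0 \<le> K" using p1.C p2.C p1.\<beta> by (simp add: K_def)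
  define I where "I = (\<lambda>v. integral {y'..v} (\<lambda>y. \<bar>F y s t\<bar>))"
  have Fc: "continuous_on {y'..y} (\<lambda>y. \<bar>F y s t\<bar>)"
    using y by (intro continuous_intros cross_integral_continuous hol) auto
  have "norm (area y s t - area y' s t) \<le> (K / \<beta> * y powr \<beta> + I y) - (K / \<beta> * y' powr \<beta> + I y')"
  proof (rule differentiable_bound_general[where f' = "\<lambda>y. area' y s t" and \<phi>' = "\<lambda>y. K * y powr (\<beta> - 1) + \<bar>F y s t\<bar>"])
    show "continuous_on {y'..y} (\<lambda>y. area y s t)"
      by (rule continuous_on_vector_derivative, rule area_deriv) (use y st in auto)
    show "continuous_on {y'..y} (\<lambda>y. K / \<beta> * y powr \<beta> + I y)"
      unfolding I_def using y integrable_continuous_real[OF Fc]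
      by (intro continuous_on_add continuous_on_mult continuous_on_powr' indefinite_integral_continuous_1) (auto intro!: continuous_intros)
    fix \<tau> assume \<tau>: "y' < \<tau>" "\<tau> < y"
    have at: "at \<tau> within {y'..y} = at \<tau>"
      using \<tau> by (intro at_within_interior) auto
    show "((\<lambda>y. area y s t) has_vector_derivative area' \<tau> s t) (at \<tau>)"
      using area_deriv[of y' \<tau> y s t] \<tau> y st unfolding at by auto
    have "(I has_vector_derivative \<bar>F \<tau> s t\<bar>) (at \<tau>)"
      using integral_has_vector_derivative[OF Fc, of \<tau>] \<tau> unfolding at I_def by auto
    then show "((\<lambda>y. K / \<beta> * y powr \<beta> + I y) has_vector_derivative K * \<tau> powr (\<beta> - 1) + \<bar>F \<tau> s t\<bar>) (at \<tau>)"
      using \<tau> y p1.\<beta> by (intro has_vector_derivative_add powr_has_vector_derivative) auto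
    show "norm (area' \<tau> s t) \<le> K * \<tau> powr (\<beta> - 1) + \<bar>F \<tau> s t\<bar>"
      unfolding K_def using area'_bound[OF st, of \<tau>] \<tau> y by auto
  qed (use y False in auto)
  moreover have "0 \<le> K / \<beta> * y' powr \<beta>" using K p1.\<beta> by simp
  moreover have "I y' = 0" by (simp add: I_def)
  ultimately show ?thesis by (simp add: I_def K_def)
qed (use p1.C p2.C p1.\<beta> in \<open>auto intro!: mult_nonneg_nonneg\<close>)

text \<open>
  Above the length of the interval the paths are smooth at the relevant scale, and the crude
  bound by the supremum of the two derivatives suffices.
\<close>

lemma area_small:
  assumes st: "- N \<le> s" "s < t" "t \<le> N" and y: "0 < y" "y \<le> N"
    and \<kappa>: "0 < \<kappa>" and ty: "t - s \<le> y"
  shows "\<bar>area y s t\<bar> \<le> 4 * C1 * C2 * (y powr \<kappa> * (t - s) powr (2 * \<beta> - \<kappa>))"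
proof -
  define h where "h = t - s"
  have h0: "0 < h" "h \<le> y" using st ty by (auto simp: h_def)
  have "norm (area y s t) \<le> integral {s..t} (\<lambda>x. 4 * C1 * C2 * h * y powr (2 * \<beta> - 2))"
    unfolding area_def
  proof (rule integral_norm_bound_integral)
    show "(\<lambda>x. 2 * Re (g1 (Complex x y)) * (path2 x y - path2 s y)) integrable_on {s..t}"
      using y by (intro integrable_continuous_real continuous_intros cont_x cont) auto
    fix x assume x: "x \<in> {s..t}"
    have 1: "\<bar>2 * Re (g1 (Complex x y))\<bar> \<le> 2 * (C1 * y powr (\<beta> - 1))"
    proof -
      have "\<bar>x\<bar> \<le> N" using st x by auto
      from growth_boundD[OF p1.bnd this y] show ?thesis
        using abs_Re_le_cmod[of "g1 (Complex x y)"] by (simp add: abs_mult)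
    qed
    have "norm (P2 (Complex x y) - P2 (Complex s y)) \<le> C2 * y powr (\<beta> - 1) * (x - s)"
      using p2.horizontal_difference[of s x y] st y x by auto
    also have "\<dots> \<le> C2 * y powr (\<beta> - 1) * h"
      using x p2.C by (intro mult_left_mono) (auto simp: h_def)
    finally have "\<bar>Re (P2 (Complex x y) - P2 (Complex s y))\<bar> \<le> C2 * y powr (\<beta> - 1) * h"
      using abs_Re_le_cmod order.trans by blast
    then have 2: "\<bar>path2 x y - path2 s y\<bar> \<le> 2 * (C2 * y powr (\<beta> - 1) * h)"
      by (simp add: abs_le_iff)
    have "norm (2 * Re (g1 (Complex x y)) * (path2 x y - path2 s y))
      \<le> 2 * (C1 * y powr (\<beta> - 1)) * (2 * (C2 * y powr (\<beta> - 1) * h))"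
      using mult_mono[OF 1 2] p1.C by (simp add: abs_mult)
    also have "\<dots> = 4 * C1 * C2 * h * y powr (2 * \<beta> - 2)"
      using powr_add[of y "\<beta> - 1" "\<beta> - 1"] by simp
    finally show "norm (2 * Re (g1 (Complex x y)) * (path2 x y - path2 s y))
      \<le> 4 * C1 * C2 * h * y powr (2 * \<beta> - 2)" .
  qed auto
  also have "\<dots> = 4 * C1 * C2 * (h * h * y powr (2 * \<beta> - 2))" using h0 by (simp add: h_def)
  also have "h * h * y powr (2 * \<beta> - 2) \<le> y powr \<kappa> * h powr (2 * \<beta> - \<kappa>)"
  proof -
    have "h * h = h powr (2 * \<beta> - \<kappa>) * h powr (2 - 2 * \<beta> + \<kappa>)"
      using h0 by (simp add: powr_add[symmetric] powr_numeral power2_eq_square)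
    moreover have "h powr (2 - 2 * \<beta> + \<kappa>) \<le> y powr (2 - 2 * \<beta> + \<kappa>)"
      using h0 p1.\<beta> \<kappa> by (intro powr_mono2) auto
    ultimately have "h * h * y powr (2 * \<beta> - 2) \<le> h powr (2 * \<beta> - \<kappa>) * y powr (2 - 2 * \<beta> + \<kappa>) * y powr (2 * \<beta> - 2)"
      by (metis mult_left_mono mult_right_mono powr_ge_zero)
    also have "\<dots> = y powr \<kappa> * h powr (2 * \<beta> - \<kappa>)"
      using y by (simp add: powr_add[symmetric] mult_ac)
    finally show ?thesis .
  qed
  finally show ?thesis using p1.C p2.C by (simp add: h_def mult_left_mono)
qed

text \<open>
  The length \<open>h\<close> of the interval separates two regimes. Heights below \<open>h\<close> are compared by integrating the
  derivative in \<open>y\<close>; above \<open>h\<close> the area itself is already small. In either regime the bound is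
  turned into a power \<open>\<kappa>\<close> of the larger height by means of the comparison with \<open>h\<close>.
\<close>

lemma area_Cauchy:
  assumes st: "- N \<le> s" "s < t" "t \<le> N" "t - s \<le> N" and y: "0 < y'" "y' \<le> y" "y \<le> N"
    and \<kappa>: "0 < \<kappa>" "\<kappa> \<le> \<beta>" and W: "0 \<le> W"
    and F: "\<And>y y'. 0 < y' \<Longrightarrow> y' \<le> y \<Longrightarrow> y \<le> t - s \<Longrightarrow> integral {y'..y} (\<lambda>y. \<bar>F y s t\<bar>) \<le> y powr \<kappa> * W"
  shows "\<bar>area y s t - area y' s t\<bar> \<le>
    y powr \<kappa> * ((8 * C1 * C2 * (1 + 2 / \<beta>) / \<beta> + 8 * C1 * C2) * (t - s) powr (2 * \<beta> - \<kappa>) + W)"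
proof -
  define h where "h = t - s"
  define K where "K = 8 * C1 * C2 * (1 + 2 / \<beta>) / \<beta>"
  define D where "D = 4 * C1 * C2"
  define H where "H = h powr (2 * \<beta> - \<kappa>)"
  have h: "0 < h" "h \<le> N" using st by (auto simp: h_def)
  have nn: "0 \<le> K" "0 \<le> D" "0 \<le> H" using p1.C p2.C p1.\<beta> by (auto simp: K_def D_def H_def)
  have low: "\<bar>area y s t - area y' s t\<bar> \<le> y powr \<kappa> * (K * H + W)"
    if "0 < y'" "y' \<le> y" "y \<le> h" for y y'
  proof -
    have "\<bar>area y s t - area y' s t\<bar> \<le> K * h powr \<beta> * y powr \<beta> + integral {y'..y} (\<lambda>y. \<bar>F y s t\<bar>)"
      using area_difference[OF st, of y' y] that h by (simp add: K_def h_def)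
    also have "integral {y'..y} (\<lambda>y. \<bar>F y s t\<bar>) \<le> y powr \<kappa> * W"
      using F that by (simp add: h_def)
    also have "K * h powr \<beta> * y powr \<beta> \<le> K * (H * y powr \<kappa>)"
    proof -
      have "y powr \<beta> = y powr (\<beta> - \<kappa>) * y powr \<kappa>" by (simp add: powr_add[symmetric])
      also have "\<dots> \<le> h powr (\<beta> - \<kappa>) * y powr \<kappa>"
        using that \<kappa> by (intro mult_right_mono powr_mono2) auto
      finally have "h powr \<beta> * y powr \<beta> \<le> h powr \<beta> * (h powr (\<beta> - \<kappa>) * y powr \<kappa>)"
        by (intro mult_left_mono) auto
      also have "\<dots> = H * y powr \<kappa>" by (simp add: H_def powr_add[symmetric])
      finally show ?thesis using nn(1) by (simp add: mult.assoc mult_left_mono)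
    qed
    finally show ?thesis by (simp add: algebra_simps)
  qed
  have high: "\<bar>area y s t\<bar> \<le> D * (y powr \<kappa> * H)" if "h \<le> y" "y \<le> N" for y
    using area_small[of s t y \<kappa>] st that h \<kappa> by (auto simp: D_def H_def h_def)
  have "\<bar>area y s t - area y' s t\<bar> \<le> y powr \<kappa> * (K * H + W) + 2 * D * (y powr \<kappa> * H)"
  proof -
    have m: "D * (z powr \<kappa> * H) \<le> D * (y powr \<kappa> * H)" "z powr \<kappa> * (K * H + W) \<le> y powr \<kappa> * (K * H + W)"
      if "0 < z" "z \<le> y" for z
      using that nn \<kappa> W by (auto intro!: mult_left_mono mult_right_mono powr_mono2)
    have n: "0 \<le> y powr \<kappa> * (K * H + W)" "0 \<le> D * (y powr \<kappa> * H)" using nn W by auto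
    consider "y \<le> h" | "h \<le> y'" | "y' < h" "h < y" by linarith
    then show ?thesis
    proof cases
      case 1
      then show ?thesis using low[of y' y] y n by linarith
    next
      case 2
      then have "\<bar>area y s t\<bar> \<le> D * (y powr \<kappa> * H)" "\<bar>area y' s t\<bar> \<le> D * (y' powr \<kappa> * H)"
        using high y by auto
      then show ?thesis using m(1)[of y'] y n by linarith
    next
      case 3
      then have "\<bar>area y s t\<bar> \<le> D * (y powr \<kappa> * H)" "\<bar>area h s t\<bar> \<le> D * (h powr \<kappa> * H)"
        "\<bar>area h s t - area y' s t\<bar> \<le> h powr \<kappa> * (K * H + W)"
        using high low y h by auto
      then show ?thesis using m[of h] 3 h n by linarith
    qed
  qed
  then show ?thesis unfolding K_def[symmetric] h_def[symmetric] H_def[symmetric]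
    by (simp add: D_def algebra_simps)
qed

end

context
  fixes g P :: "complex \<Rightarrow> complex" and c :: complex
  assumes prim: "\<And>z. Im z > 0 \<Longrightarrow> (P has_field_derivative g z) (at z)"
    and Gp: "\<And>z. 0 < Im z \<Longrightarrow> Gamma_plus g z = P z - c"
begin

lemma Gamma_eps_primitive: "0 < \<epsilon> \<Longrightarrow> Gamma_eps g \<epsilon> x = 2 * Re (P (Complex x \<epsilon>)) - 2 * Re c"
  by (simp add: Gamma_eps_def Gp)

lemma Gamma_eps_has_derivative:
  assumes "0 < \<epsilon>"
  shows "((\<lambda>x. Gamma_eps g \<epsilon> x) has_vector_derivative 2 * Re (g (Complex x \<epsilon>))) (at x within S)"
proof -
  have eq: "Gamma_eps g \<epsilon> = (\<lambda>x. 2 * Re (P (Complex x \<epsilon>)) - 2 * Re c)"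
    using Gamma_eps_primitive assms by blast
  have "((\<lambda>x. P (Complex x \<epsilon>)) has_vector_derivative g (Complex x \<epsilon>)) (at x within S)"
    using assms prim by (intro has_vector_derivative_Complex_horizontal) auto
  from bounded_linear.has_vector_derivative[OF bounded_linear_Re this]
  have d: "((\<lambda>x. Re (P (Complex x \<epsilon>))) has_real_derivative Re (g (Complex x \<epsilon>))) (at x within S)"
    unfolding has_real_derivative_iff_has_vector_derivative .
  show ?thesis
    unfolding eq has_real_derivative_iff_has_vector_derivative[symmetric]
    by (rule DERIV_cong[OF DERIV_diff[OF DERIV_cmult[OF d] DERIV_const]]) simp
qed

lemma deriv_Gamma_eps:
  assumes "0 < \<epsilon>"
  shows "deriv (Gamma_eps g \<epsilon>) x = 2 * Re (g (Complex x \<epsilon>))"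
  using Gamma_eps_has_derivative[OF assms, of x UNIV]
  unfolding has_real_derivative_iff_has_vector_derivative[symmetric]
  by (rule DERIV_imp_deriv)

end

lemma (in half_plane_pair) Levy_area_eq_area:
  assumes c: "\<And>z. 0 < Im z \<Longrightarrow> Gamma_plus g1 z = P1 z - c1" "\<And>z. 0 < Im z \<Longrightarrow> Gamma_plus g2 z = P2 z - c2"
    and \<epsilon>: "0 < \<epsilon>"
  shows "Levy_area g1 g2 \<epsilon> s t = area \<epsilon> s t"
  unfolding Levy_area_def area_def
proof (rule integral_cong)
  fix x assume x: "x \<in> {s..t}"
  have "((\<lambda>x. 2 * Re (g2 (Complex x \<epsilon>))) has_integral Gamma_eps g2 \<epsilon> x - Gamma_eps g2 \<epsilon> s) {s..x}"
    using x by (intro fundamental_theorem_of_calculus Gamma_eps_has_derivative[OF p2.prim c(2) \<epsilon>]) auto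
  moreover have "deriv (Gamma_eps g2 \<epsilon>) = (\<lambda>x. 2 * Re (g2 (Complex x \<epsilon>)))"
    by (rule ext) (rule deriv_Gamma_eps[OF p2.prim c(2) \<epsilon>])
  ultimately show "deriv (Gamma_eps g1 \<epsilon>) x * integral {s..x} (deriv (Gamma_eps g2 \<epsilon>)) =
      2 * Re (g1 (Complex x \<epsilon>)) * (2 * Re (P2 (Complex x \<epsilon>)) - 2 * Re (P2 (Complex s \<epsilon>)))"
    by (simp only: deriv_Gamma_eps[OF p1.prim c(1) \<epsilon>] integral_unique Gamma_eps_primitive[OF p2.prim c(2) \<epsilon>]) simp
qed

definition boundary_growth :: "real \<Rightarrow> (complex \<Rightarrow> complex) \<Rightarrow> bool" where
  "boundary_growth \<beta> g \<longleftrightarrow> g holomorphic_on {z. 0 < Im z} \<and> (\<forall>N::nat. \<exists>C\<ge>0. growth_bound \<beta> (real N) C g)"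

lemma boundary_growth_primitive:
  assumes "boundary_growth \<beta> g" "0 < \<beta>" "\<beta> < 1"
  obtains P c where "\<And>z. Im z > 0 \<Longrightarrow> (P has_field_derivative g z) (at z)"
    "\<And>z. 0 < Im z \<Longrightarrow> Gamma_plus g z = P z - c"
proof -
  have g: "g holomorphic_on {z. 0 < Im z}" using assms by (auto simp: boundary_growth_def)
  have o: "open {z. 0 < Im z}" by (rule open_halfspace_Im_gt)
  obtain P where P0: "\<And>z. z \<in> {z. 0 < Im z} \<Longrightarrow> (P has_field_derivative g z) (at z within {z. 0 < Im z})"
    using holomorphic_convex_primitive'[OF convex_halfspace_Im_gt o g] by blast
  then have P: "(P has_field_derivative g z) (at z)" if "Im z > 0" for z
    using P0[of z] that at_within_open[OF _ o, of z] by auto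
  obtain c where "\<forall>z. 0 < Im z \<longrightarrow> Gamma_plus g z = P z - c"
    using Gamma_plus_eq_primitive[OF P, of \<beta>] assms by (auto simp: boundary_growth_def)
  with P show ?thesis using that by blast
qed

lemma powr_add_le:
  fixes a b r :: real
  assumes "0 \<le> a" "0 \<le> b" "0 \<le> r"
  shows "(a + b) powr r \<le> 2 powr r * (a powr r + b powr r)"
proof -
  have "(a + b) powr r \<le> (2 * max a b) powr r"
    using assms by (intro powr_mono2) auto
  also have "\<dots> = 2 powr r * max a b powr r" using assms by (simp add: powr_mult)
  also have "max a b powr r \<le> a powr r + b powr r" by (auto simp: max_def)
  finally show ?thesis by simp
qed

lemma sum_mesh_powr_le:
  assumes "is_partition s t n p" "t - s \<le> A" "0 < A" "1 \<le> \<theta>"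
  shows "(\<Sum>l=1..n. (p l - p (l - 1)) powr \<theta>) \<le> A powr \<theta>"
  using assms sum_partition_mesh[OF assms(1)] partition_less[OF assms(1)]
  by (intro sum_powr_le) (auto intro!: less_imp_le)

lemma increments_converge:
  assumes g: "boundary_growth \<beta> g1" "boundary_growth \<beta> g2" and \<beta>: "0 < \<kappa>" "\<kappa> < \<beta>" "\<beta> < 1"
    and q: "0 < q" "1 \<le> (\<beta> - \<kappa>) * q"
  shows "converges_in_d q 1 (Gamma_increment g1 g2)"
proof (rule converges_in_dI)
  fix N :: nat
  have \<beta>0: "0 < \<beta>" using \<beta> by simp
  obtain P1 c1 where P1: "\<And>z. Im z > 0 \<Longrightarrow> (P1 has_field_derivative g1 z) (at z)"
    "\<And>z. 0 < Im z \<Longrightarrow> Gamma_plus g1 z = P1 z - c1"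
    using boundary_growth_primitive[OF g(1) \<beta>0 \<beta>(3)] by blast
  obtain P2 c2 where P2: "\<And>z. Im z > 0 \<Longrightarrow> (P2 has_field_derivative g2 z) (at z)"
    "\<And>z. 0 < Im z \<Longrightarrow> Gamma_plus g2 z = P2 z - c2"
    using boundary_growth_primitive[OF g(2) \<beta>0 \<beta>(3)] by blast
  \<comment> \<open>The box on which the growth bounds are used must be as large as the longest interval in \<open>[- N, N]\<close>
    and must contain all heights up to 1.\<close>
  define N' where "N' = real (2 * N + 1)"
  obtain C1 where C1: "0 \<le> C1" "growth_bound \<beta> N' C1 g1" using g unfolding boundary_growth_def N'_def by blast
  obtain C2 where C2: "0 \<le> C2" "growth_bound \<beta> N' C2 g2" using g unfolding boundary_growth_def N'_def by blast
  interpret p1: half_plane_primitive g1 P1 \<beta> N' C1 using P1 C1 \<beta> by unfold_locales auto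
  interpret p2: half_plane_primitive g2 P2 \<beta> N' C2 using P2 C2 \<beta> by unfold_locales auto
  define C where "C = 2 * (2 * C1 * (1 + 2 / \<beta>)) + 2 * (2 * C2 * (1 + 2 / \<beta>))"
  define W where "W = (\<lambda>u v. (v - u) powr (\<beta> - \<kappa>))"
  define B where "B = (2 * real N + 1) powr ((\<beta> - \<kappa>) * q)"
  show "Cauchy_with_rate (q / real 1) (Gamma_increment g1 g2) N"
  proof (rule exI[of _ C], rule exI[of _ \<kappa>], rule exI[of _ 1], rule exI[of _ B], rule exI[of _ W], intro conjI allI impI)
    fix \<epsilon> \<epsilon>' u v :: real
    assume a: "0 < \<epsilon>'" "\<epsilon>' \<le> \<epsilon>" "\<epsilon> \<le> 1" "- real N \<le> u" "u < v" "v \<le> real N"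
    define D1 where "D1 = (P1 (Complex v \<epsilon>) - P1 (Complex u \<epsilon>)) - (P1 (Complex v \<epsilon>') - P1 (Complex u \<epsilon>'))"
    define D2 where "D2 = (P2 (Complex v \<epsilon>) - P2 (Complex u \<epsilon>)) - (P2 (Complex v \<epsilon>') - P2 (Complex u \<epsilon>'))"
    have "norm D1 \<le> 2 * C1 * (1 + 2 / \<beta>) * (\<epsilon> powr \<kappa> * W u v)"
      unfolding D1_def W_def by (rule p1.increment_Cauchy) (use a \<beta> in \<open>auto simp: N'_def\<close>)
    moreover have "norm D2 \<le> 2 * C2 * (1 + 2 / \<beta>) * (\<epsilon> powr \<kappa> * W u v)"
      unfolding D2_def W_def by (rule p2.increment_Cauchy) (use a \<beta> in \<open>auto simp: N'_def\<close>)
    moreover have eq: "Gamma_increment g1 g2 \<epsilon> u v - Gamma_increment g1 g2 \<epsilon>' u v = (2 * Re D1, 2 * Re D2)"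
      using a by (simp add: Gamma_increment_def D1_def D2_def Gamma_eps_primitive[OF P1] Gamma_eps_primitive[OF P2])
    moreover have "norm (2 * Re D1, 2 * Re D2) \<le> 2 * norm D1 + 2 * norm D2"
    proof -
      have "norm (2 * Re D1, 2 * Re D2) \<le> norm (2 * Re D1) + norm (2 * Re D2)"
        by (rule norm_Pair_le)
      also have "\<dots> \<le> 2 * norm D1 + 2 * norm D2"
        using abs_Re_le_cmod[of D1] abs_Re_le_cmod[of D2] by (simp add: abs_mult)
      finally show ?thesis .
    qed
    ultimately have "norm (Gamma_increment g1 g2 \<epsilon> u v - Gamma_increment g1 g2 \<epsilon>' u v)
       \<le> 2 * (2 * C1 * (1 + 2 / \<beta>) * (\<epsilon> powr \<kappa> * W u v)) + 2 * (2 * C2 * (1 + 2 / \<beta>) * (\<epsilon> powr \<kappa> * W u v))"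
      unfolding eq by linarith
    then show "norm (Gamma_increment g1 g2 \<epsilon> u v - Gamma_increment g1 g2 \<epsilon>' u v) \<le> C * \<epsilon> powr \<kappa> * W u v"
      by (simp only: C_def distrib_right mult.assoc)
  next
    fix s t n p assume "- real N \<le> s" "t \<le> real N" "is_partition s t n p"
    then have "(\<Sum>l=1..n. (p l - p (l - 1)) powr ((\<beta> - \<kappa>) * q)) \<le> B"
      unfolding B_def using q by (intro sum_mesh_powr_le) auto
    then show "(\<Sum>l=1..n. W (p (l - 1)) (p l) powr (q / real 1)) \<le> B"
      by (simp add: W_def powr_powr)
  qed (use C1 C2 \<beta> in \<open>auto simp: C_def W_def\<close>)
qed (use q in auto)

text \<open>
  What the convergence of the areas needs from the cross term: integrated over the heights below
  \<open>y\<close> it is small with \<open>y\<close>, with a weight of bounded \<open>r\<close>-variation.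
\<close>

abbreviation cross_dominated :: "real \<Rightarrow> real \<Rightarrow> (complex \<Rightarrow> complex) \<Rightarrow> (complex \<Rightarrow> complex) \<Rightarrow> nat \<Rightarrow> bool" where
  "cross_dominated \<kappa> r g1 g2 N \<equiv>
    (\<exists>W B. (\<forall>u v. 0 \<le> W u v) \<and>
       (\<forall>s t y y'. - real N \<le> s \<longrightarrow> s < t \<longrightarrow> t \<le> real N \<longrightarrow> 0 < y' \<longrightarrow> y' \<le> y \<longrightarrow> y \<le> t - s \<longrightarrow>
          integral {y'..y} (\<lambda>y. \<bar>cross_integral g1 g2 y s t\<bar>) \<le> y powr \<kappa> * W s t) \<and>
       (\<forall>s t n p. - real N \<le> s \<longrightarrow> t \<le> real N \<longrightarrow> is_partition s t n p \<longrightarrow>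
         (\<Sum>l=1..n. W (p (l - 1)) (p l) powr (r)) \<le> B))"

lemma areas_converge:
  assumes g: "boundary_growth \<beta> g1" "boundary_growth \<beta> g2" and \<beta>: "0 < \<kappa>" "\<kappa> \<le> \<beta>" "\<beta> < 1"
    and q: "0 < q" "1 \<le> (2 * \<beta> - \<kappa>) * (q / 2)"
    and W: "\<And>N::nat. cross_dominated \<kappa> (q / 2) g1 g2 N"
  shows "converges_in_d q 2 (Levy_area g1 g2)"
proof (rule converges_in_dI)
  fix N :: nat
  have \<beta>0: "0 < \<beta>" using \<beta> by simp
  obtain P1 c1 where P1: "\<And>z. Im z > 0 \<Longrightarrow> (P1 has_field_derivative g1 z) (at z)"
    "\<And>z. 0 < Im z \<Longrightarrow> Gamma_plus g1 z = P1 z - c1"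
    using boundary_growth_primitive[OF g(1) \<beta>0 \<beta>(3)] by blast
  obtain P2 c2 where P2: "\<And>z. Im z > 0 \<Longrightarrow> (P2 has_field_derivative g2 z) (at z)"
    "\<And>z. 0 < Im z \<Longrightarrow> Gamma_plus g2 z = P2 z - c2"
    using boundary_growth_primitive[OF g(2) \<beta>0 \<beta>(3)] by blast
  \<comment> \<open>as large as the longest interval in \<open>[- N, N]\<close>, and containing all heights up to 1\<close>
  define N' where "N' = real (2 * N + 1)"
  obtain C1 where C1: "0 \<le> C1" "growth_bound \<beta> N' C1 g1" using g unfolding boundary_growth_def N'_def by blast
  obtain C2 where C2: "0 \<le> C2" "growth_bound \<beta> N' C2 g2" using g unfolding boundary_growth_def N'_def by blast
  interpret half_plane_pair g1 P1 g2 P2 \<beta> N' C1 C2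
    using P1 C1 P2 C2 \<beta> g by unfold_locales (auto simp: boundary_growth_def)
  obtain W B where W: "\<And>u v. 0 \<le> W u v"
    "\<And>s t y y'. - real N \<le> s \<Longrightarrow> s < t \<Longrightarrow> t \<le> real N \<Longrightarrow> 0 < y' \<Longrightarrow> y' \<le> y \<Longrightarrow> y \<le> t - s \<Longrightarrow>
          integral {y'..y} (\<lambda>y. \<bar>F y s t\<bar>) \<le> y powr \<kappa> * W s t"
    "\<And>s t n p. - real N \<le> s \<Longrightarrow> t \<le> real N \<Longrightarrow> is_partition s t n p \<Longrightarrow>
         (\<Sum>l=1..n. W (p (l - 1)) (p l) powr (q / 2)) \<le> B"
    using W[of N] apply (elim exE conjE)
    subgoal for W B by (rule that[of W B]) simp_all
    done
  define K where "K = 8 * C1 * C2 * (1 + 2 / \<beta>) / \<beta> + 8 * C1 * C2"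
  have K: "0 \<le> K" using C1 C2 \<beta> by (simp add: K_def)
  define V where "V = (\<lambda>u v. K * (v - u) powr (2 * \<beta> - \<kappa>) + W u v)"
  define r where "r = q / 2"
  define A where "A = 2 powr r * (K powr r * (2 * real N + 1) powr ((2 * \<beta> - \<kappa>) * r) + B)"
  show "Cauchy_with_rate (q / real 2) (Levy_area g1 g2) N"
  proof (rule exI[of _ 1], rule exI[of _ \<kappa>], rule exI[of _ 1], rule exI[of _ A], rule exI[of _ V], intro conjI allI impI)
    fix \<epsilon> \<epsilon>' u v :: real
    assume a: "0 < \<epsilon>'" "\<epsilon>' \<le> \<epsilon>" "\<epsilon> \<le> 1" "- real N \<le> u" "u < v" "v \<le> real N"
    have "\<bar>area \<epsilon> u v - area \<epsilon>' u v\<bar> \<le> \<epsilon> powr \<kappa> * V u v"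
      unfolding V_def K_def by (rule area_Cauchy) (use a \<beta> W in \<open>auto simp: N'_def\<close>)
    then show "norm (Levy_area g1 g2 \<epsilon> u v - Levy_area g1 g2 \<epsilon>' u v) \<le> 1 * \<epsilon> powr \<kappa> * V u v"
      using Levy_area_eq_area[OF P1(2) P2(2), of _ u v] a by simp
  next
    fix s t n p assume p: "- real N \<le> s" "t \<le> real N" "is_partition s t n p"
    have "(\<Sum>l=1..n. V (p (l - 1)) (p l) powr r) \<le>
       (\<Sum>l=1..n. 2 powr r * (K powr r * (p l - p (l - 1)) powr ((2 * \<beta> - \<kappa>) * r) + W (p (l - 1)) (p l) powr r))"
    proof (rule sum_mono)
      fix l
      have "V (p (l - 1)) (p l) powr r \<le> 2 powr r * ((K * (p l - p (l - 1)) powr (2 * \<beta> - \<kappa>)) powr r + W (p (l - 1)) (p l) powr r)"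
        unfolding V_def using K W q by (intro powr_add_le) (auto simp: r_def)
      also have "(K * (p l - p (l - 1)) powr (2 * \<beta> - \<kappa>)) powr r = K powr r * (p l - p (l - 1)) powr ((2 * \<beta> - \<kappa>) * r)"
        using K by (simp add: powr_mult powr_powr)
      finally show "V (p (l - 1)) (p l) powr r \<le> 2 powr r * (K powr r * (p l - p (l - 1)) powr ((2 * \<beta> - \<kappa>) * r) + W (p (l - 1)) (p l) powr r)" .
    qed
    also have "\<dots> = 2 powr r * (K powr r * (\<Sum>l=1..n. (p l - p (l - 1)) powr ((2 * \<beta> - \<kappa>) * r)) + (\<Sum>l=1..n. W (p (l - 1)) (p l) powr r))"
      by (simp add: sum_distrib_left[symmetric] sum.distrib)
    also have "\<dots> \<le> A"
      unfolding A_def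
    proof (intro mult_left_mono add_mono)
      show "(\<Sum>l=1..n. (p l - p (l - 1)) powr ((2 * \<beta> - \<kappa>) * r)) \<le> (2 * real N + 1) powr ((2 * \<beta> - \<kappa>) * r)"
        using p q by (intro sum_mesh_powr_le) (auto simp: r_def)
      show "(\<Sum>l=1..n. W (p (l - 1)) (p l) powr r) \<le> B" using W(3)[OF p] by (simp add: r_def)
    qed auto
    finally show "(\<Sum>l=1..n. V (p (l - 1)) (p l) powr (q / real 2)) \<le> A" by (simp add: r_def)
  qed (use K W \<beta> in \<open>auto simp: V_def\<close>)
qed (use q in auto)

section \<open>A Garsia-Rodemich-Rumsey inequality\<close>

lemma nn_integral_Icc_eq_integral:
  fixes g :: "real \<Rightarrow> real"
  assumes "continuous_on {a..b} g" "\<And>x. x \<in> {a..b} \<Longrightarrow> 0 \<le> g x"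
  shows "(\<integral>\<^sup>+x\<in>{a..b}. ennreal (g x) \<partial>lborel) = ennreal (integral {a..b} g)"
proof -
  have i: "set_integrable lborel {a..b} g"
    using assms(1) by (rule borel_integrable_atLeastAtMost')
  have "(\<integral>\<^sup>+x\<in>{a..b}. ennreal (g x) \<partial>lborel) = (\<integral>\<^sup>+x. ennreal (indicator {a..b} x *\<^sub>R g x) \<partial>lborel)"
    by (intro nn_integral_cong) (auto simp: indicator_def)
  also have "\<dots> = ennreal (LINT x:{a..b}|lborel. g x)"
    using i assms(2) unfolding set_integrable_def set_lebesgue_integral_def
    by (intro nn_integral_eq_integral) (auto simp: indicator_def)
  also have "(LINT x:{a..b}|lborel. g x) = integral {a..b} g"
    using i by (rule set_borel_integral_eq_integral)
  finally show ?thesis .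
qed

text \<open>
  The square of the Gagliardo seminorm of order \<open>\<delta>\<close>. On the diagonal the integrand is \<open>0 / 0 = 0\<close>.
\<close>

abbreviation fractional_energy :: "real \<Rightarrow> (real \<Rightarrow> real) \<Rightarrow> real \<Rightarrow> real \<Rightarrow> ennreal" where
  "fractional_energy \<delta> f s t \<equiv>
    (\<integral>\<^sup>+u\<in>{s..t}. (\<integral>\<^sup>+v\<in>{s..t}. ennreal ((f u - f v)\<^sup>2 / \<bar>u - v\<bar> powr (2 * \<delta> + 1)) \<partial>lborel) \<partial>lborel)"

definition interval_mean :: "(real \<Rightarrow> real) \<Rightarrow> real \<Rightarrow> real \<Rightarrow> real" where
  "interval_mean f a b = integral {a..b} f / (b - a)"

lemma interval_mean_difference:
  assumes f: "continuous_on {a..b} f" and ab: "a < b"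
  shows "ennreal ((b - a) * \<bar>interval_mean f a b - c\<bar>) \<le> (\<integral>\<^sup>+v\<in>{a..b}. ennreal \<bar>c - f v\<bar> \<partial>lborel)"
proof -
  have "integral {a..b} (\<lambda>v. c - f v) = c * (b - a) - integral {a..b} f"
    using f ab by (subst integral_diff) (auto intro: integrable_continuous_real)
  also have "\<dots> = - ((b - a) * (interval_mean f a b - c))"
    using ab by (simp add: interval_mean_def right_diff_distrib) (simp add: algebra_simps)
  finally have "(b - a) * \<bar>interval_mean f a b - c\<bar> = \<bar>integral {a..b} (\<lambda>v. c - f v)\<bar>"
    using ab by (simp add: abs_mult)
  also have "\<dots> \<le> integral {a..b} (\<lambda>v. \<bar>c - f v\<bar>)"
    using f by (intro integral_norm_bound_integral[where 'a=real, simplified real_norm_def])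
      (auto intro!: integrable_continuous_real continuous_intros)
  also have "ennreal \<dots> = (\<integral>\<^sup>+v\<in>{a..b}. ennreal \<bar>c - f v\<bar> \<partial>lborel)"
    using f by (intro nn_integral_Icc_eq_integral[symmetric]) (auto intro!: continuous_intros)
  finally show ?thesis by (simp add: ennreal_leI)
qed

text \<open>
  The difference of the two means is an average of \<open>f u - f v\<close>. With \<open>l = b - a\<close> and
  \<open>c = l powr (\<delta> - 1 / 2) * sqrt J\<close>, the inequality \<open>r \<le> c / 2 + r\<^sup>2 / (2 * c)\<close> replaces
  Cauchy-Schwarz; this \<open>c\<close> balances the two terms.
\<close>

lemma interval_mean_step:
  fixes f :: "real \<Rightarrow> real"
  assumes f: "continuous_on {a..b} f" and ab: "a < b" "a \<le> a'" "a' < b'" "b' \<le> b" "b' - a' = (b - a) / 2"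
    and J: "0 < J" "fractional_energy \<delta> f a b \<le> ennreal J"
    and meas: "f \<in> borel_measurable borel" and \<delta>: "0 < \<delta>"
  shows "\<bar>interval_mean f a' b' - interval_mean f a b\<bar> \<le> 3 / 2 * ((b - a) powr (\<delta> - 1 / 2) * sqrt J)"
proof -
  define l where "l = b - a"
  define c where "c = l powr (\<delta> - 1 / 2) * sqrt J"
  define k where "k = (\<lambda>u v. (f u - f v)\<^sup>2 / \<bar>u - v\<bar> powr (2 * \<delta> + 1))"
  have l: "0 < l" using ab by (simp add: l_def)
  have c: "0 < c" using l J by (simp add: c_def)
  define d where "d = l powr (2 * \<delta> + 1) / (2 * c)"
  have d: "0 < d" using l c by (simp add: d_def)
  have pw: "\<bar>f u - f v\<bar> \<le> c / 2 + d * k u v" if uv: "u \<in> {a..b}" "v \<in> {a..b}" for u v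
  proof (cases "u = v")
    case False
    have "(f u - f v)\<^sup>2 = \<bar>u - v\<bar> powr (2 * \<delta> + 1) * k u v"
      using False by (simp add: k_def)
    also have "\<dots> \<le> l powr (2 * \<delta> + 1) * k u v"
      using uv \<delta> by (intro mult_right_mono powr_mono2) (auto simp: k_def l_def)
    finally have 1: "(f u - f v)\<^sup>2 / (2 * c) \<le> d * k u v"
      using c by (simp add: d_def field_simps)
    have "0 \<le> (\<bar>f u - f v\<bar> - c)\<^sup>2" by simp
    then have "2 * c * \<bar>f u - f v\<bar> \<le> c\<^sup>2 + (f u - f v)\<^sup>2" by (simp add: power2_diff algebra_simps)
    then have "\<bar>f u - f v\<bar> \<le> (c\<^sup>2 + (f u - f v)\<^sup>2) / (2 * c)"
      using c by (simp add: pos_le_divide_eq mult.commute)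
    also have "\<dots> = c / 2 + (f u - f v)\<^sup>2 / (2 * c)"
      using c by (simp add: add_divide_distrib power2_eq_square)
    finally show ?thesis using 1 by linarith
  qed (use c in \<open>simp add: k_def\<close>)
  have km[measurable]: "(\<lambda>(u, v). k u v) \<in> borel_measurable (lborel \<Otimes>\<^sub>M lborel)"
    using meas unfolding k_def by measurable
  have "ennreal ((b' - a') * (l * \<bar>interval_mean f a' b' - interval_mean f a b\<bar>)) =
     ennreal l * ennreal ((b' - a') * \<bar>interval_mean f a' b' - interval_mean f a b\<bar>)"
    using l by (simp add: ennreal_mult'[symmetric] mult_ac)
  also have "\<dots> \<le> ennreal l * (\<integral>\<^sup>+u\<in>{a'..b'}. ennreal \<bar>interval_mean f a b - f u\<bar> \<partial>lborel)"
    using ab by (intro mult_left_mono interval_mean_difference continuous_on_subset[OF f]) auto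
  also have "\<dots> = (\<integral>\<^sup>+u\<in>{a'..b'}. ennreal (l * \<bar>interval_mean f a b - f u\<bar>) \<partial>lborel)"
    using l meas by (subst nn_integral_cmult[symmetric]) (auto simp: ennreal_mult' mult_ac intro!: nn_integral_cong)
  also have "\<dots> \<le> (\<integral>\<^sup>+u\<in>{a'..b'}. (\<integral>\<^sup>+v\<in>{a..b}. ennreal (c / 2 + d * k u v) \<partial>lborel) \<partial>lborel)"
  proof (intro nn_integral_mono)
    fix u
    { assume u: "u \<in> {a'..b'}"
      have "ennreal (l * \<bar>interval_mean f a b - f u\<bar>) \<le> (\<integral>\<^sup>+v\<in>{a..b}. ennreal \<bar>f u - f v\<bar> \<partial>lborel)"
        unfolding l_def by (rule interval_mean_difference[OF f ab(1)])
      also have "\<dots> \<le> (\<integral>\<^sup>+v\<in>{a..b}. ennreal (c / 2 + d * k u v) \<partial>lborel)"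
        using pw[of u] u ab by (intro nn_integral_mono) (auto simp: indicator_def intro!: ennreal_leI)
      finally have "ennreal (l * \<bar>interval_mean f a b - f u\<bar>) \<le> (\<integral>\<^sup>+v\<in>{a..b}. ennreal (c / 2 + d * k u v) \<partial>lborel)" .
    } note * = this
    show "ennreal (l * \<bar>interval_mean f a b - f u\<bar>) * indicator {a'..b'} u \<le>
      (\<integral>\<^sup>+v\<in>{a..b}. ennreal (c / 2 + d * k u v) \<partial>lborel) * indicator {a'..b'} u"
      using * by (simp add: indicator_def)
  qed
  also have "\<dots> = (\<integral>\<^sup>+u\<in>{a'..b'}. (ennreal (c / 2 * l) + ennreal d * (\<integral>\<^sup>+v\<in>{a..b}. ennreal (k u v) \<partial>lborel)) \<partial>lborel)"
  proof (intro nn_integral_cong, goal_cases)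
    case (1 u)
    have "(\<integral>\<^sup>+v\<in>{a..b}. ennreal (c / 2 + d * k u v) \<partial>lborel) =
      (\<integral>\<^sup>+v. ennreal (c / 2) * indicator {a..b} v + ennreal d * (ennreal (k u v) * indicator {a..b} v) \<partial>lborel)"
      using c d by (intro nn_integral_cong) (auto simp: indicator_def k_def ennreal_mult'[symmetric] ennreal_plus[symmetric] simp del: ennreal_plus)
    also have "\<dots> = ennreal (c / 2 * l) + ennreal d * (\<integral>\<^sup>+v\<in>{a..b}. ennreal (k u v) \<partial>lborel)"
    proof -
      have "ennreal (c / 2) * ennreal (b - a) = ennreal (c * (b - a) / 2)"
        using c ab by (simp add: ennreal_mult'[symmetric])
      then show ?thesis
        using c ab by (subst nn_integral_add) (auto simp: nn_integral_cmult l_def)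
    qed
    finally show ?case by simp
  qed
  also have "\<dots> = (\<integral>\<^sup>+u. (ennreal (c / 2 * l) * indicator {a'..b'} u + ennreal d * (indicator {a'..b'} u * (\<integral>\<^sup>+v\<in>{a..b}. ennreal (k u v) \<partial>lborel))) \<partial>lborel)"
    by (intro nn_integral_cong) (simp add: indicator_def)
  also have "\<dots> = ennreal (c / 2 * l * (b' - a')) + ennreal d * (\<integral>\<^sup>+u. indicator {a'..b'} u * (\<integral>\<^sup>+v\<in>{a..b}. ennreal (k u v) \<partial>lborel) \<partial>lborel)"
  proof -
    have "ennreal (c / 2 * l) * ennreal (b' - a') = ennreal (c / 2 * l * (b' - a'))"
      using c l ab(1-4) by (simp add: ennreal_mult'[symmetric])
    then show ?thesis
      using c l ab(1-4) by (subst nn_integral_add) (auto simp: nn_integral_cmult)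
  qed
  also have "\<dots> \<le> ennreal (c / 2 * l * (b' - a')) + ennreal d * ennreal J"
  proof (intro add_left_mono mult_left_mono)
    have "(\<integral>\<^sup>+u. indicator {a'..b'} u * (\<integral>\<^sup>+v\<in>{a..b}. ennreal (k u v) \<partial>lborel) \<partial>lborel) \<le>
      (\<integral>\<^sup>+u\<in>{a..b}. (\<integral>\<^sup>+v\<in>{a..b}. ennreal (k u v) \<partial>lborel) \<partial>lborel)"
      using ab by (intro nn_integral_mono) (auto simp: indicator_def)
    also have "\<dots> \<le> ennreal J" using J(2) by (simp add: k_def)
    finally show "(\<integral>\<^sup>+u. indicator {a'..b'} u * (\<integral>\<^sup>+v\<in>{a..b}. ennreal (k u v) \<partial>lborel) \<partial>lborel) \<le> ennreal J" .
  qed auto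
  also have "\<dots> = ennreal (c / 2 * l * (b' - a') + d * J)"
    using c l ab d J by (simp add: ennreal_mult')
  finally have "(b' - a') * (l * \<bar>interval_mean f a' b' - interval_mean f a b\<bar>) \<le> c / 2 * l * (b' - a') + d * J"
    using c l ab(1-4) d J(1) by (subst (asm) ennreal_le_iff) auto
  then have "l / 2 * l * \<bar>interval_mean f a' b' - interval_mean f a b\<bar> \<le> c / 2 * l * (l / 2) + d * J"
    using ab(5) by (simp add: l_def mult_ac)
  also have "d * J = l / 2 * l * c"
  proof -
    have "c * c = l powr (2 * \<delta> - 1) * J"
      using J powr_add[of l "\<delta> - 1/2" "\<delta> - 1/2"] by (simp add: c_def)
    moreover have "l powr (2 * \<delta> + 1) = l powr (2 * \<delta> - 1) * (l * l)"
      using l powr_add[of l "2 * \<delta> - 1" 2] by (simp add: powr_numeral power2_eq_square add.commute)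
    ultimately have "l powr (2 * \<delta> + 1) * J = l * l * (c * c)" by simp
    then show ?thesis using c by (simp add: d_def field_simps)
  qed
  also have "c / 2 * l * (l / 2) + l / 2 * l * c = l / 2 * l * (3 / 2 * c)" by (simp add: algebra_simps)
  finally show ?thesis using l by (simp add: c_def l_def)
qed

lemma interval_mean_tendsto:
  fixes f :: "real \<Rightarrow> real"
  assumes f: "continuous_on {s..t} f" and st: "s < t"
    and a: "\<And>n. s \<le> a n" "\<And>n. a n + (t - s) / 2 ^ n \<le> t"
    and c: "\<And>n. a n \<le> c" "\<And>n. c \<le> a n + (t - s) / 2 ^ n"
  shows "(\<lambda>n. interval_mean f (a n) (a n + (t - s) / 2 ^ n)) \<longlonglongrightarrow> f c"
proof (rule LIMSEQ_I)
  fix e :: real assume e: "e > 0"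
  have "c \<in> {s..t}" using a(1)[of 0] c(1)[of 0] a(2)[of 0] c(2)[of 0] by auto
  then obtain d where d: "d > 0" "\<And>x. x \<in> {s..t} \<Longrightarrow> \<bar>x - c\<bar> < d \<Longrightarrow> \<bar>f x - f c\<bar> < e / 2"
    using f e unfolding continuous_on_iff dist_real_def by (metis half_gt_zero)
  have "(\<lambda>n. (t - s) * (1 / 2) ^ n) \<longlonglongrightarrow> (t - s) * 0"
    by (intro tendsto_intros LIMSEQ_abs_realpow_zero2) auto
  then have "eventually (\<lambda>n. (t - s) / 2 ^ n < d) sequentially"
    using d order_tendstoD(2) by (fastforce simp: power_divide)
  then obtain n0 where n0: "\<And>n. n \<ge> n0 \<Longrightarrow> (t - s) / 2 ^ n < d"
    unfolding eventually_sequentially by blast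
  show "\<exists>no. \<forall>n\<ge>no. norm (interval_mean f (a n) (a n + (t - s) / 2 ^ n) - f c) < e"
  proof (intro exI[of _ n0] allI impI)
    fix n assume n: "n \<ge> n0"
    define l where "l = (t - s) / 2 ^ n"
    have l: "0 < l" "l < d" using st n0[OF n] by (auto simp: l_def)
    have sub: "{a n..a n + l} \<subseteq> {s..t}" using a[of n] by (auto simp: l_def)
    have fc: "continuous_on {a n..a n + l} f" using f sub continuous_on_subset by blast
    have "\<bar>integral {a n..a n + l} (\<lambda>x. f x - f c)\<bar> \<le> integral {a n..a n + l} (\<lambda>x. e / 2)"
    proof (rule integral_norm_bound_integral[where 'a=real, simplified real_norm_def])
      show "(\<lambda>x. f x - f c) integrable_on {a n..a n + l}"
        using fc by (intro integrable_continuous_real continuous_intros)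
      fix x assume x: "x \<in> {a n..a n + l}"
      then have "\<bar>x - c\<bar> < d" using c[of n] l by (auto simp: l_def)
      then show "\<bar>f x - f c\<bar> \<le> e / 2" using d(2)[of x] x sub by force
    qed auto
    also have "\<dots> = l * (e / 2)" using l by simp
    finally have "\<bar>integral {a n..a n + l} (\<lambda>x. f x - f c)\<bar> \<le> l * (e / 2)" .
    moreover have "integral {a n..a n + l} (\<lambda>x. f x - f c) = l * (interval_mean f (a n) (a n + l) - f c)"
      using l fc by (subst integral_diff) (auto intro: integrable_continuous_real simp: interval_mean_def right_diff_distrib)
    ultimately have "l * \<bar>interval_mean f (a n) (a n + l) - f c\<bar> \<le> l * (e / 2)"
      using l by (simp add: abs_mult)
    then have "\<bar>interval_mean f (a n) (a n + l) - f c\<bar> \<le> e / 2"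
      using l by (simp only: mult_le_cancel_left_pos)
    then show "norm (interval_mean f (a n) (a n + (t - s) / 2 ^ n) - f c) < e"
      using e by (simp add: l_def)
  qed
qed

text \<open>
  Means over nested intervals of lengths \<open>h / 2 ^ n\<close> containing \<open>c\<close> converge to \<open>f c\<close>, and consecutive means
  differ by the terms of a geometric series, whose ratio \<open>2 powr (1 / 2 - \<delta>)\<close> is less than 1
  because \<open>\<delta> > 1 / 2\<close>.
\<close>

lemma GRR_one_sided:
  fixes f :: "real \<Rightarrow> real"
  assumes f: "continuous_on {s..t} f" "f \<in> borel_measurable borel" and st: "s < t"
    and J: "0 < J" "fractional_energy \<delta> f s t \<le> ennreal J"
    and \<delta>: "1 / 2 < \<delta>"
    and a: "\<And>n. s \<le> a n" "\<And>n. a n + (t - s) / 2 ^ n \<le> t"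
    and c: "\<And>n. a n \<le> c" "\<And>n. c \<le> a n + (t - s) / 2 ^ n"
    and nest: "\<And>n. a n \<le> a (Suc n)" "\<And>n. a (Suc n) + (t - s) / 2 ^ Suc n \<le> a n + (t - s) / 2 ^ n"
  shows "\<bar>f c - interval_mean f s t\<bar> \<le> 3 / 2 / (1 - 2 powr (1 / 2 - \<delta>)) * ((t - s) powr (\<delta> - 1 / 2) * sqrt J)"
proof -
  define h where "h = t - s"
  define \<rho> where "\<rho> = 2 powr (1 / 2 - \<delta>)"
  define m where "m = (\<lambda>n. interval_mean f (a n) (a n + h / 2 ^ n))"
  define D where "D = h powr (\<delta> - 1 / 2) * sqrt J"
  have h: "0 < h" using st by (simp add: h_def)
  have \<rho>: "0 < \<rho>" "\<rho> < 1" using \<delta> by (auto simp: \<rho>_def powr_less_one)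
  have D: "0 \<le> D" using J by (simp add: D_def)
  have "a 0 = s" using a(1)[of 0] a(2)[of 0] by auto
  then have m0: "m 0 = interval_mean f s t" by (simp add: m_def h_def)
  have step: "\<bar>m (Suc n) - m n\<bar> \<le> 3 / 2 * D * \<rho> ^ n" for n
  proof -
    have sub: "{a n..a n + h / 2 ^ n} \<subseteq> {s..t}" using a[of n] by (auto simp: h_def)
    have "\<bar>m (Suc n) - m n\<bar> \<le> 3 / 2 * ((a n + h / 2 ^ n - a n) powr (\<delta> - 1 / 2) * sqrt J)"
      unfolding m_def
    proof (rule interval_mean_step)
      show "continuous_on {a n..a n + h / 2 ^ n} f" using f sub continuous_on_subset by blast
      have "fractional_energy \<delta> f (a n) (a n + h / 2 ^ n)
        \<le> fractional_energy \<delta> f s t"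
        using sub by (intro nn_integral_mono mult_mono) (auto simp: indicator_def)
      also note J(2)
      finally show "fractional_energy \<delta> f (a n) (a n + h / 2 ^ n) \<le> ennreal J" .
    qed (use h f J nest[of n] \<delta> in \<open>auto simp: h_def\<close>)
    also have "(a n + h / 2 ^ n - a n) powr (\<delta> - 1 / 2) = h powr (\<delta> - 1 / 2) * \<rho> ^ n"
    proof -
      have "(2 ^ n) powr (\<delta> - 1 / 2) = (2::real) powr (real n * (\<delta> - 1 / 2))"
        by (simp add: powr_realpow[symmetric] powr_powr)
      moreover have "\<rho> ^ n = 2 powr (- (real n * (\<delta> - 1 / 2)))"
        by (simp add: \<rho>_def powr_realpow[symmetric] powr_powr algebra_simps)
      ultimately show ?thesis using h by (simp add: powr_divide powr_minus_divide)
    qed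
    finally show ?thesis by (simp add: D_def mult_ac)
  qed
  have bd: "\<bar>m n - m 0\<bar> \<le> 3 / 2 * D / (1 - \<rho>)" for n
  proof -
    have "m n - m 0 = (\<Sum>k<n. m (Suc k) - m k)" by (simp add: sum_lessThan_telescope)
    then have "\<bar>m n - m 0\<bar> \<le> (\<Sum>k<n. \<bar>m (Suc k) - m k\<bar>)" by (simp add: sum_abs)
    also have "\<dots> \<le> (\<Sum>k<n. 3 / 2 * D * \<rho> ^ k)" by (intro sum_mono step)
    also have "\<dots> = 3 / 2 * D * ((1 - \<rho> ^ n) / (1 - \<rho>))"
      using \<rho> by (simp only: sum_distrib_left[symmetric] sum_gp_strict) simp
    also have "\<dots> \<le> 3 / 2 * D * (1 / (1 - \<rho>))"
      using \<rho> D by (intro mult_left_mono divide_right_mono) auto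
    finally show ?thesis by simp
  qed
  have "m \<longlonglongrightarrow> f c"
    unfolding m_def h_def by (rule interval_mean_tendsto[OF f(1) st a c])
  then have "(\<lambda>n. \<bar>m n - m 0\<bar>) \<longlonglongrightarrow> \<bar>f c - m 0\<bar>" by (intro tendsto_intros)
  then have "\<bar>f c - m 0\<bar> \<le> 3 / 2 * D / (1 - \<rho>)"
    using bd by (intro LIMSEQ_le_const2) auto
  then show ?thesis by (simp add: m0 D_def \<rho>_def h_def mult_ac)
qed

definition GRR_const :: "real \<Rightarrow> real" where
  "GRR_const \<delta> = (3 / (1 - 2 powr (1 / 2 - \<delta>)))\<^sup>2"

lemma GRR_const_pos: "1 / 2 < \<delta> \<Longrightarrow> 0 < GRR_const \<delta>"
  using powr_less_one[of 2 "1/2 - \<delta>"] by (auto simp: GRR_const_def)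

text \<open>
  Both endpoints are compared with the mean over the whole interval. The statement in the extended
  reals also covers infinite energy, so it can be integrated over a parameter without first
  discarding exceptional values.
\<close>

lemma GRR:
  fixes f :: "real \<Rightarrow> real"
  assumes f: "continuous_on {s..t} f" "f \<in> borel_measurable borel" and st: "s < t"
    and \<delta>: "1 / 2 < \<delta>"
  shows "ennreal ((f t - f s)\<^sup>2) \<le> ennreal (GRR_const \<delta> * (t - s) powr (2 * \<delta> - 1)) *
    fractional_energy \<delta> f s t"
    (is "_ \<le> ennreal ?K * ?I")
proof (cases "?I = \<infinity>")
  case True
  then show ?thesis using GRR_const_pos[OF \<delta>] st by (simp add: ennreal_mult_top)
next
  case False
  then obtain J where J: "?I = ennreal J" "0 \<le> J" by (cases ?I) auto
  define h where "h = t - s"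
  have h: "0 < h" using st by (simp add: h_def)
  have pos: "(f t - f s)\<^sup>2 \<le> ?K * J'" if J': "J < J'" for J'
  proof -
    define D where "D = 3 / 2 / (1 - 2 powr (1 / 2 - \<delta>)) * ((t - s) powr (\<delta> - 1 / 2) * sqrt J')"
    have J'0: "0 < J'" "?I \<le> ennreal J'" using J J' by (auto intro: ennreal_leI)
    have half: "h / 2 ^ n \<le> h" "h / (2 * 2 ^ n) \<le> h / 2 ^ n" for n
      using h by (auto simp: field_simps self_le_power)
    have half': "s + (t - s) / 2 ^ n \<le> t" "s \<le> t - (t - s) / 2 ^ n" for n using half(1)[of n] by (simp_all add: h_def)
    have 1: "\<bar>f s - interval_mean f s t\<bar> \<le> D"
      unfolding D_def
      by (rule GRR_one_sided[OF f st J'0 \<delta>, where a = "\<lambda>n. s"]) (use h half half' in \<open>auto simp: h_def\<close>)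
    have 2: "\<bar>f t - interval_mean f s t\<bar> \<le> D"
      unfolding D_def
      by (rule GRR_one_sided[OF f st J'0 \<delta>, where a = "\<lambda>n. t - (t - s) / 2 ^ n"])
         (use h half half' in \<open>auto simp: h_def\<close>)
    have "\<bar>f t - f s\<bar> \<le> 2 * D" using 1 2 by linarith
    then have "(f t - f s)\<^sup>2 \<le> (2 * D)\<^sup>2" using abs_le_square_iff[of "f t - f s" "2 * D"] by linarith
    also have "(2 * D)\<^sup>2 = ?K * J'"
    proof -
      have "(h powr (\<delta> - 1 / 2))\<^sup>2 = h powr (2 * \<delta> - 1)"
        using h by (simp add: powr_power)
      moreover define \<rho> where "\<rho> = 1 - 2 powr (1 / 2 - \<delta>)"
      ultimately show ?thesis
        using J'0 unfolding D_def GRR_const_def \<rho>_def[symmetric]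
        by (simp add: power_mult_distrib h_def power_divide)
    qed
    finally show ?thesis .
  qed
  have K: "0 < ?K" using GRR_const_pos[OF \<delta>] h by (simp add: h_def)
  have "(f t - f s)\<^sup>2 \<le> ?K * J"
  proof (rule field_le_epsilon)
    fix e :: real assume "0 < e"
    then have "(f t - f s)\<^sup>2 \<le> ?K * (J + e / ?K)" using K by (intro pos) auto
    also have "?K * (e / ?K) = e" using K by (metis less_irrefl nonzero_mult_div_cancel_left times_divide_eq_right)
    then have "?K * (J + e / ?K) = ?K * J + e" by (simp only: distrib_left)
    finally show "(f t - f s)\<^sup>2 \<le> ?K * J + e" .
  qed
  then show ?thesis using K J by (simp add: J(1) ennreal_mult'[symmetric] ennreal_leI)
qed

section \<open>A superadditive control\<close>

text \<open>
  Integrating this kernel over all heights \<open>y\<close> in \<open>(0, R]\<close> and over all \<open>u\<close>, \<open>v\<close> in an interval gives the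
  fractional energies of the functions \<open>f y\<close>, averaged with weight \<open>y powr (1 - \<eta>)\<close>. The weight makes its
  own dual weight \<open>y powr (\<eta> - 1)\<close> integrable at 0. A single integral over triples is used so
  that one application of Fubini's theorem suffices for the expectation.
\<close>

definition control_kernel :: "real \<Rightarrow> real \<Rightarrow> real \<Rightarrow> (real \<Rightarrow> real \<Rightarrow> real) \<Rightarrow> real \<times> real \<times> real \<Rightarrow> ennreal" where
  "control_kernel \<delta> \<eta> R f = (\<lambda>(y, u, v).
     ennreal (y powr (1 - \<eta>) * ((f y u - f y v)\<^sup>2 / \<bar>u - v\<bar> powr (2 * \<delta> + 1))) * indicator {0<..R} y)"

definition control :: "real \<Rightarrow> real \<Rightarrow> real \<Rightarrow> (real \<Rightarrow> real \<Rightarrow> real) \<Rightarrow> real \<Rightarrow> real \<Rightarrow> ennreal" where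
  "control \<delta> \<eta> R f s t = (\<integral>\<^sup>+p. control_kernel \<delta> \<eta> R f p * indicator ({s..t} \<times> {s..t}) (snd p)
      \<partial>(lborel \<Otimes>\<^sub>M (lborel \<Otimes>\<^sub>M lborel)))"

lemma control_kernel_measurable:
  assumes [measurable]: "(\<lambda>(y, u). f y u) \<in> borel_measurable (borel \<Otimes>\<^sub>M borel)"
  shows "control_kernel \<delta> \<eta> R f \<in> borel_measurable (borel \<Otimes>\<^sub>M (borel \<Otimes>\<^sub>M borel))"
  unfolding control_kernel_def by measurable

lemma sets_Times_pair[measurable]: "{s..t::real} \<times> {s..t::real} \<in> sets (borel \<Otimes>\<^sub>M borel)"
  by measurable

text \<open>
  Closed intervals of a partition overlap in their endpoints, but two different points lie
  together in at most one of them, and the kernel vanishes on the diagonal.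
\<close>

lemma control_superadditive:
  assumes m: "(\<lambda>(y, u). f y u) \<in> borel_measurable (borel \<Otimes>\<^sub>M borel)"
    and p: "is_partition s t n p"
  shows "(\<Sum>l=1..n. control \<delta> \<eta> R f (p (l - 1)) (p l)) \<le> control \<delta> \<eta> R f s t"
proof -
  note [measurable] = control_kernel_measurable[OF m]
  have "(\<Sum>l=1..n. control \<delta> \<eta> R f (p (l - 1)) (p l)) =
    (\<integral>\<^sup>+x. (\<Sum>l=1..n. control_kernel \<delta> \<eta> R f x * indicator ({p (l - 1)..p l} \<times> {p (l - 1)..p l}) (snd x))
      \<partial>(lborel \<Otimes>\<^sub>M (lborel \<Otimes>\<^sub>M lborel)))"
    unfolding control_def by (subst nn_integral_sum) auto
  also have "\<dots> \<le> control \<delta> \<eta> R f s t"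
    unfolding control_def
  proof (intro nn_integral_mono, clarify)
    fix y u v :: real
    let ?k = "control_kernel \<delta> \<eta> R f (y, u, v)"
    have mono: "p i \<le> p j" if "i \<le> j" "j \<le> n" for i j
      using partition_less[OF p, of i j] that by (cases "i = j") auto
    define S where "S = {l \<in> {1..n}. u \<in> {p (l - 1)..p l} \<and> v \<in> {p (l - 1)..p l}}"
    have eq: "(\<Sum>l=1..n. ?k * indicator ({p (l - 1)..p l} \<times> {p (l - 1)..p l}) (snd (y, u, v))) = (\<Sum>l\<in>S. ?k)"
      by (rule sum.mono_neutral_cong_right) (auto simp: S_def indicator_def)
    have "(\<Sum>l\<in>S. ?k) \<le> ?k * indicator ({s..t} \<times> {s..t}) (u, v)"
    proof (cases "u = v \<or> S = {}")
      case True
      then show ?thesis by (auto simp: control_kernel_def)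
    next
      case False
      then obtain l where l: "l \<in> S" "u \<noteq> v" by auto
      have "l' = l" if "l' \<in> S" for l'
      proof (rule ccontr)
        assume "l' \<noteq> l"
        then consider "l' \<le> l - 1" | "l \<le> l' - 1" by linarith
        then show False
        proof cases
          case 1
          then have "p l' \<le> p (l - 1)" using l(1) by (intro mono) (auto simp: S_def)
          then show False using l that by (auto simp: S_def)
        next
          case 2
          then have "p l \<le> p (l' - 1)" using that by (intro mono) (auto simp: S_def)
          then show False using l that by (auto simp: S_def)
        qed
      qed
      then have "S = {l}" using l(1) by blast
      moreover have "s \<le> p (l - 1)" "p l \<le> t"
        using mono[of 0 "l - 1"] mono[of l n] l p by (auto simp: S_def is_partition_def)
      then have "u \<in> {s..t}" "v \<in> {s..t}" using l by (auto simp: S_def)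
      ultimately show ?thesis by simp
    qed
    then show "(\<Sum>l=1..n. ?k * indicator ({p (l - 1)..p l} \<times> {p (l - 1)..p l}) (snd (y, u, v)))
       \<le> ?k * indicator ({s..t} \<times> {s..t}) (snd (y, u, v))"
      unfolding eq by simp
  qed
  finally show ?thesis .
qed

lemma control_eq_iterated:
  assumes m: "(\<lambda>(y, u). f y u) \<in> borel_measurable (borel \<Otimes>\<^sub>M borel)"
  shows "control \<delta> \<eta> R f s t = (\<integral>\<^sup>+y\<in>{0<..R}. ennreal (y powr (1 - \<eta>)) *
     fractional_energy \<delta> (f y) s t \<partial>lborel)"
proof -
  note [measurable] = control_kernel_measurable[OF m] m
  define g where "g = (\<lambda>p. control_kernel \<delta> \<eta> R f p * indicator ({s..t} \<times> {s..t}) (snd p))"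
  have [measurable]: "g \<in> borel_measurable (borel \<Otimes>\<^sub>M (borel \<Otimes>\<^sub>M borel))" unfolding g_def by measurable
  have sets: "sets (lborel \<Otimes>\<^sub>M (lborel :: (real \<times> real) measure)) = sets ((borel :: real measure) \<Otimes>\<^sub>M (borel \<Otimes>\<^sub>M borel))"
    by (rule sets_pair_measure_cong) (simp_all only: borel_prod sets_lborel)
  have "control \<delta> \<eta> R f s t = (\<integral>\<^sup>+p. g p \<partial>(lborel \<Otimes>\<^sub>M (lborel :: (real \<times> real) measure)))"
    unfolding control_def g_def[symmetric] by (simp add: lborel_prod)
  also have "\<dots> = (\<integral>\<^sup>+y. (\<integral>\<^sup>+q. g (y, q) \<partial>lborel) \<partial>lborel)"
    by (rule lborel.nn_integral_fst[symmetric]) (simp add: measurable_cong_sets[OF sets refl])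
  also have "\<dots> = (\<integral>\<^sup>+y. (\<integral>\<^sup>+q. g (y, q) \<partial>(lborel \<Otimes>\<^sub>M lborel)) \<partial>lborel)"
    by (simp add: lborel_prod)
  also have "\<dots> = (\<integral>\<^sup>+y. (\<integral>\<^sup>+u. (\<integral>\<^sup>+v. g (y, u, v) \<partial>lborel) \<partial>lborel) \<partial>lborel)"
  proof (intro nn_integral_cong)
    fix y :: real
    show "(\<integral>\<^sup>+q. g (y, q) \<partial>(lborel \<Otimes>\<^sub>M lborel)) = (\<integral>\<^sup>+u. (\<integral>\<^sup>+v. g (y, u, v) \<partial>lborel) \<partial>lborel)"
      by (rule lborel.nn_integral_fst[symmetric, where f = "\<lambda>q. g (y, q)"]) simp
  qed
  also have "\<dots> = (\<integral>\<^sup>+y\<in>{0<..R}. ennreal (y powr (1 - \<eta>)) *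
     fractional_energy \<delta> (f y) s t \<partial>lborel)"
  proof (intro nn_integral_cong)
    fix y :: real
    let ?w = "ennreal (y powr (1 - \<eta>))"
    let ?k = "\<lambda>u v. ennreal ((f y u - f y v)\<^sup>2 / \<bar>u - v\<bar> powr (2 * \<delta> + 1))"
    have "(\<integral>\<^sup>+u. (\<integral>\<^sup>+v. g (y, u, v) \<partial>lborel) \<partial>lborel) =
      (\<integral>\<^sup>+u. (\<integral>\<^sup>+v. (?w * indicator {0<..R} y) * (indicator {s..t} u * (?k u v * indicator {s..t} v)) \<partial>lborel) \<partial>lborel)"
      by (intro nn_integral_cong) (auto simp: g_def control_kernel_def ennreal_mult'[symmetric] indicator_def)
    also have "\<dots> = (\<integral>\<^sup>+u. (?w * indicator {0<..R} y) * (indicator {s..t} u * (\<integral>\<^sup>+v. ?k u v * indicator {s..t} v \<partial>lborel)) \<partial>lborel)"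
      by (simp add: nn_integral_cmult)
    also have "\<dots> = (?w * indicator {0<..R} y) * (\<integral>\<^sup>+u. indicator {s..t} u * (\<integral>\<^sup>+v. ?k u v * indicator {s..t} v \<partial>lborel) \<partial>lborel)"
      by (rule nn_integral_cmult) simp
    finally show "(\<integral>\<^sup>+u. (\<integral>\<^sup>+v. g (y, u, v) \<partial>lborel) \<partial>lborel) = ?w *
     (\<integral>\<^sup>+u\<in>{s..t}. (\<integral>\<^sup>+v\<in>{s..t}. ?k u v \<partial>lborel) \<partial>lborel) * indicator {0<..R} y"
      by (simp add: mult_ac)
  qed
  finally show ?thesis .
qed

lemma nn_integral_powr_0:
  assumes "- 1 < a" "0 \<le> c"
  shows "(\<integral>\<^sup>+x\<in>{0<..c}. ennreal (x powr a) \<partial>lborel) = ennreal (c powr (a + 1) / (a + 1))"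
proof -
  have "((\<lambda>x. if x \<in> {0..c} then x powr a else 0) has_integral (c powr (a + 1) / (a + 1))) UNIV"
    using has_integral_powr_from_0[OF assms] by (subst has_integral_restrict_UNIV)
  then have "integral\<^sup>N lborel (\<lambda>x. if x \<in> {0..c} then x powr a else 0) = c powr (a + 1) / (a + 1)"
    by (intro nn_integral_has_integral_lborel) auto
  moreover have "(\<integral>\<^sup>+x\<in>{0<..c}. ennreal (x powr a) \<partial>lborel) = integral\<^sup>N lborel (\<lambda>x. ennreal (if x \<in> {0..c} then x powr a else 0))"
    by (intro nn_integral_cong) (auto simp: indicator_def)
  ultimately show ?thesis by simp
qed

text \<open>
  The Garsia-Rodemich-Rumsey inequality at each height, combined over the heights by Cauchy-Schwarz.
\<close>

lemma integral_increment_control: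
  assumes m: "(\<lambda>(y, u). f y u) \<in> borel_measurable (borel \<Otimes>\<^sub>M borel)"
    and \<delta>: "1 / 2 < \<delta>" and \<eta>: "0 < \<eta>" and st: "s < t" and y: "0 < y'" "y' \<le> y" "y \<le> R"
    and f: "\<And>y. 0 < y \<Longrightarrow> y \<le> R \<Longrightarrow> continuous_on {s..t} (f y)"
    and c: "continuous_on {y'..y} (\<lambda>y. f y t - f y s)"
    and fin: "control \<delta> \<eta> R f s t < \<infinity>"
  shows "integral {y'..y} (\<lambda>y. \<bar>f y t - f y s\<bar>) \<le>
    y powr (\<eta> / 2) * (sqrt (GRR_const \<delta> / \<eta>) * (t - s) powr (\<delta> - 1 / 2) * enn2real (control \<delta> \<eta> R f s t) powr (1 / 2))"
proof -
  note [measurable] = m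
  have mm[measurable]: "(\<lambda>y. f y u) \<in> borel_measurable borel" "f y \<in> borel_measurable borel" for y u
  proof -
    show "(\<lambda>y. f y u) \<in> borel_measurable borel"
      using measurable_compose[of "\<lambda>y. (y, u)" borel "borel \<Otimes>\<^sub>M borel" "\<lambda>(y, u). f y u" borel] m by simp
    show "f y \<in> borel_measurable borel"
      using measurable_compose[of "\<lambda>u. (y, u)" borel "borel \<Otimes>\<^sub>M borel" "\<lambda>(y, u). f y u" borel] m by simp
  qed
  define K where "K = GRR_const \<delta> * (t - s) powr (2 * \<delta> - 1)"
  have K: "0 \<le> K" using GRR_const_pos[OF \<delta>] by (simp add: K_def)
  define J where "J = (\<lambda>y. \<integral>\<^sup>+u\<in>{s..t}. (\<integral>\<^sup>+v\<in>{s..t}. ennreal ((f y u - f y v)\<^sup>2 / \<bar>u - v\<bar> powr (2 * \<delta> + 1)) \<partial>lborel) \<partial>lborel)"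
  have [measurable]: "J \<in> borel_measurable borel" unfolding J_def by measurable
  define \<Delta> where "\<Delta> = (\<lambda>y. \<bar>f y t - f y s\<bar>)"
  have [measurable]: "\<Delta> \<in> borel_measurable borel" unfolding \<Delta>_def by measurable
  have grr: "ennreal ((\<Delta> y)\<^sup>2) \<le> ennreal K * J y" if "0 < y" "y \<le> R" for y
    using GRR[OF f[OF that] mm(2) st \<delta>] by (simp add: K_def J_def \<Delta>_def)
  \<comment> \<open>The two weights are inverse to each other, so that \<open>A * B\<close> is the integrand on \<open>[y', y]\<close>.\<close>
  define A where "A = (\<lambda>z. ennreal (z powr ((\<eta> - 1) / 2)) * indicator {0<..y} z)"
  define B where "B = (\<lambda>z. ennreal (z powr ((1 - \<eta>) / 2) * \<Delta> z) * indicator {0<..y} z)"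
  have [measurable]: "A \<in> borel_measurable borel" "B \<in> borel_measurable borel" unfolding A_def B_def by measurable
  have "ennreal (integral {y'..y} \<Delta>) = (\<integral>\<^sup>+z\<in>{y'..y}. ennreal (\<Delta> z) \<partial>lborel)"
    using c by (intro nn_integral_Icc_eq_integral[symmetric]) (auto simp: \<Delta>_def intro!: continuous_intros)
  also have "\<dots> \<le> (\<integral>\<^sup>+z. A z * B z \<partial>lborel)"
  proof (intro nn_integral_mono)
    fix z
    have "z powr ((\<eta> - 1) / 2) * z powr ((1 - \<eta>) / 2) = 1" if "0 < z"
    proof -
      have "(\<eta> - 1) / 2 + (1 - \<eta>) / 2 = 0" by (simp add: field_simps)
      then show ?thesis using that by (simp add: powr_add[symmetric])
    qed
    then show "ennreal (\<Delta> z) * indicator {y'..y} z \<le> A z * B z"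
      using y by (auto simp: indicator_def A_def B_def ennreal_mult'[symmetric] mult.assoc[symmetric])
  qed
  finally have 1: "ennreal (integral {y'..y} \<Delta>) \<le> (\<integral>\<^sup>+z. A z * B z \<partial>lborel)" .
  have "(ennreal (integral {y'..y} \<Delta>))\<^sup>2 \<le> (\<integral>\<^sup>+z. A z * B z \<partial>lborel)\<^sup>2"
    using 1 by (rule power_mono) simp
  also have "\<dots> \<le> (\<integral>\<^sup>+z. (A z)\<^sup>2 \<partial>lborel) * (\<integral>\<^sup>+z. (B z)\<^sup>2 \<partial>lborel)"
    by (rule Cauchy_Schwarz_nn_integral) simp_all
  also have "\<dots> \<le> ennreal (y powr \<eta> / \<eta>) * (ennreal K * control \<delta> \<eta> R f s t)"
  proof (rule mult_mono)
    have sq: "(z powr (a / 2))\<^sup>2 = z powr a" for z a :: real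
      by (simp add: power2_eq_square powr_add[symmetric])
    have "(\<integral>\<^sup>+z. (A z)\<^sup>2 \<partial>lborel) = (\<integral>\<^sup>+z\<in>{0<..y}. ennreal (z powr (\<eta> - 1)) \<partial>lborel)"
      by (intro nn_integral_cong) (auto simp: A_def indicator_def ennreal_power sq)
    also have "\<dots> = ennreal (y powr \<eta> / \<eta>)"
      using nn_integral_powr_0[of "\<eta> - 1" y] \<eta> y by simp
    finally show "(\<integral>\<^sup>+z. (A z)\<^sup>2 \<partial>lborel) \<le> ennreal (y powr \<eta> / \<eta>)" by simp
    have "(\<integral>\<^sup>+z. (B z)\<^sup>2 \<partial>lborel) \<le> (\<integral>\<^sup>+z. ennreal K * (ennreal (z powr (1 - \<eta>)) * J z * indicator {0<..R} z) \<partial>lborel)"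
    proof (intro nn_integral_mono)
      fix z
      have "(B z)\<^sup>2 \<le> ennreal (z powr (1 - \<eta>)) * (ennreal K * J z)" if "0 < z" "z \<le> y"
      proof -
        have "(B z)\<^sup>2 = ennreal (z powr (1 - \<eta>)) * ennreal ((\<Delta> z)\<^sup>2)"
          using that by (simp add: B_def ennreal_power power_mult_distrib sq ennreal_mult' \<Delta>_def)
        also have "\<dots> \<le> ennreal (z powr (1 - \<eta>)) * (ennreal K * J z)"
          using that y by (intro mult_left_mono grr) auto
        finally show ?thesis .
      qed
      then show "(B z)\<^sup>2 \<le> ennreal K * (ennreal (z powr (1 - \<eta>)) * J z * indicator {0<..R} z)"
        using y by (auto simp: indicator_def mult_ac B_def)
    qed
    also have "\<dots> = ennreal K * control \<delta> \<eta> R f s t"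
      unfolding control_eq_iterated[OF m] J_def by (rule nn_integral_cmult) measurable
    finally show "(\<integral>\<^sup>+z. (B z)\<^sup>2 \<partial>lborel) \<le> ennreal K * control \<delta> \<eta> R f s t" .
  qed auto
  also have "control \<delta> \<eta> R f s t = ennreal (enn2real (control \<delta> \<eta> R f s t))"
    using fin by simp
  finally have 2: "(ennreal (integral {y'..y} \<Delta>))\<^sup>2 \<le> ennreal (y powr \<eta> / \<eta>) * (ennreal K * ennreal (enn2real (control \<delta> \<eta> R f s t)))" .
  have "0 \<le> integral {y'..y} \<Delta>"
    using c by (intro integral_nonneg) (auto simp: \<Delta>_def intro!: integrable_continuous_real continuous_intros)
  with 2 have "(integral {y'..y} \<Delta>)\<^sup>2 \<le> y powr \<eta> / \<eta> * (K * enn2real (control \<delta> \<eta> R f s t))"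
    (is "_ \<le> ?rhs") using \<eta> K by (simp add: ennreal_power ennreal_mult'[symmetric])
  then have "integral {y'..y} \<Delta> \<le> sqrt ?rhs" by (rule real_le_rsqrt)
  also have "sqrt ?rhs = y powr (\<eta> / 2) * (sqrt (GRR_const \<delta> / \<eta>) * (t - s) powr (\<delta> - 1 / 2) * enn2real (control \<delta> \<eta> R f s t) powr (1 / 2))"
  proof -
    have h: "sqrt (z powr a) = z powr (a / 2)" if "0 \<le> z" for z a :: real
      using that by (simp add: powr_half_sqrt[symmetric] powr_powr)
    have e: "(2 * \<delta> - 1) / 2 = \<delta> - 1 / 2" by (simp add: field_simps)
    have hd: "sqrt ((t - s) powr (2 * \<delta> - 1)) = (t - s) powr (\<delta> - 1 / 2)"
      using h[of "t - s" "2 * \<delta> - 1"] st unfolding e by simp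
    show ?thesis
      using y st by (simp add: K_def real_sqrt_mult real_sqrt_divide h hd powr_half_sqrt)
  qed
  finally show ?thesis by (simp add: \<Delta>_def)
qed


lemma control_mono:
  assumes "s \<le> s'" "t' \<le> t"
  shows "control \<delta> \<eta> R f s' t' \<le> control \<delta> \<eta> R f s t"
  unfolding control_def using assms
  by (intro nn_integral_mono mult_left_mono) (auto simp: indicator_def)

lemma partition_mono:
  assumes "is_partition s t n p" "i \<le> j" "j \<le> n"
  shows "p i \<le> p j"
  using partition_less[OF assms(1), of i j] assms by (cases "i = j") auto

text \<open>
  Powers of the lengths of the intervals of a partition, multiplied by powers of the control, have
  bounded sums, since both quantities are superadditive.
\<close>

lemma control_powr_sum:
  assumes m: "(\<lambda>(y, u). f y u) \<in> borel_measurable (borel \<Otimes>\<^sub>M borel)"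
    and p: "is_partition s t n p" and st: "a \<le> s" "t \<le> b"
    and A: "t - s \<le> A" "0 < A" and B: "control \<delta> \<eta> R f a b \<le> ennreal B" "0 < B"
    and r: "0 \<le> \<theta>" "0 \<le> \<phi>" "1 \<le> \<theta> + \<phi>"
  shows "(\<Sum>l=1..n. (p l - p (l - 1)) powr \<theta> * enn2real (control \<delta> \<eta> R f (p (l - 1)) (p l)) powr \<phi>)
    \<le> A powr \<theta> * B powr \<phi> * 2 powr (\<theta> + \<phi>)"
proof (rule sum_powr_mult_le)
  have fin: "control \<delta> \<eta> R f (p (l - 1)) (p l) < \<infinity>" if "l \<in> {1..n}" for l
  proof -
    have "p 0 \<le> p (l - 1)" "p l \<le> p n" using that by (auto intro!: partition_mono[OF p])
    moreover have "p 0 = s" "p n = t" using p by (auto simp: is_partition_def)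
    ultimately have "control \<delta> \<eta> R f (p (l - 1)) (p l) \<le> control \<delta> \<eta> R f a b"
      using st by (intro control_mono) auto
    also note B(1)
    also have "ennreal B < \<infinity>" by simp
    finally show ?thesis .
  qed
  show "(\<Sum>l=1..n. p l - p (l - 1)) \<le> A"
    using sum_partition_mesh[OF p] A by simp
  have "ennreal (\<Sum>l=1..n. enn2real (control \<delta> \<eta> R f (p (l - 1)) (p l))) =
     (\<Sum>l=1..n. control \<delta> \<eta> R f (p (l - 1)) (p l))"
    using fin by (subst sum_ennreal[symmetric]) (auto intro!: sum.cong)
  also have "\<dots> \<le> control \<delta> \<eta> R f s t" by (rule control_superadditive[OF m p])
  also have "\<dots> \<le> control \<delta> \<eta> R f a b" using st by (rule control_mono)
  also note B(1)
  finally show "(\<Sum>l=1..n. enn2real (control \<delta> \<eta> R f (p (l - 1)) (p l))) \<le> B"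
    using B(2) by (subst (asm) ennreal_le_iff) auto
  fix l assume "l \<in> {1..n}"
  then show "0 \<le> p l - p (l - 1)" using partition_mono[OF p, of "l - 1" l] by auto
qed (use A B r in auto)

section \<open>The Gaussian process\<close>

lemma centered_gaussian_moment:
  assumes "prob_space M" "centered_gaussian M R"
  shows "integrable M (\<lambda>\<omega>. R \<omega> ^ (2 * m))"
    and "(\<integral>\<omega>. R \<omega> ^ (2 * m) \<partial>M) = fact (2 * m) / (2 ^ m * fact m) * (\<integral>\<omega>. (R \<omega>)\<^sup>2 \<partial>M) ^ m"
proof -
  interpret prob_space M by fact
  have [measurable]: "R \<in> borel_measurable M" using assms by (simp add: centered_gaussian_def)
  have "integrable M (\<lambda>\<omega>. R \<omega> ^ (2 * m)) \<and>
    (\<integral>\<omega>. R \<omega> ^ (2 * m) \<partial>M) = fact (2 * m) / (2 ^ m * fact m) * (\<integral>\<omega>. (R \<omega>)\<^sup>2 \<partial>M) ^ m"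
  proof (cases "AE \<omega> in M. R \<omega> = 0")
    case True
    have z: "AE \<omega> in M. R \<omega> ^ k = 0 ^ k" for k using True by eventually_elim simp
    have "integrable M (\<lambda>\<omega>. R \<omega> ^ (2 * m))"
      by (subst integrable_cong_AE[OF _ _ z]) auto
    moreover have e: "(\<integral>\<omega>. R \<omega> ^ k \<partial>M) = 0 ^ k" for k
      by (subst integral_cong_AE[OF _ _ z]) (auto simp: prob_space)
    ultimately show ?thesis
      using e[of "2 * m"] e[of 2] by (cases "m = 0") (simp_all add: prob_space power_0_left)
  next
    case False
    then obtain \<sigma> where \<sigma>: "\<sigma> > 0" "distributed M lborel R (normal_density 0 \<sigma>)"
      using assms(2) by (auto simp: centered_gaussian_def)
    have b: "has_bochner_integral lborel (\<lambda>x. normal_density 0 \<sigma> x * x ^ (2 * k)) (fact (2 * k) / ((2 / \<sigma>\<^sup>2) ^ k * fact k))" for k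
      using normal_moment_even[of \<sigma> 0 k] \<sigma>(1) by simp
    have i: "(\<integral>\<omega>. R \<omega> ^ (2 * k) \<partial>M) = fact (2 * k) / ((2 / \<sigma>\<^sup>2) ^ k * fact k)" for k
      using distributed_integral[OF \<sigma>(2), of "\<lambda>x. x ^ (2 * k)"] has_bochner_integral_integral_eq[OF b[of k]] by simp
    have "integrable M (\<lambda>\<omega>. R \<omega> ^ (2 * m))"
      using distributed_integrable[OF \<sigma>(2), of "\<lambda>x. x ^ (2 * m)"] integrable.intros[OF b[of m]]
      by simp
    moreover have "(\<integral>\<omega>. (R \<omega>)\<^sup>2 \<partial>M) = \<sigma>\<^sup>2"
      using i[of 1] by (simp add: fact_2)
    ultimately show ?thesis using \<sigma>(1)
      by (simp add: i power_divide)
  qed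
  then show "integrable M (\<lambda>\<omega>. R \<omega> ^ (2 * m))"
    "(\<integral>\<omega>. R \<omega> ^ (2 * m) \<partial>M) = fact (2 * m) / (2 ^ m * fact m) * (\<integral>\<omega>. (R \<omega>)\<^sup>2 \<partial>M) ^ m" by auto
qed

lemma norm_powr_of_real:
  fixes w :: complex
  assumes "w \<noteq> 0"
  shows "norm (w powr complex_of_real a) = norm w powr a"
  using assms by (simp add: powr_def exp_minus norm_exp_eq_Re)

definition cov_const :: "real \<Rightarrow> real" where
  "cov_const \<alpha> = \<alpha> * (1 - 2 * \<alpha>) / (2 * cos (pi * \<alpha>))"

text \<open>
  The covariance \<open>E (\<Gamma>'\<^sup>+(z) * cnj (\<Gamma>'\<^sup>+(w)))\<close>.
\<close>

definition cov_kernel :: "real \<Rightarrow> complex \<Rightarrow> complex \<Rightarrow> complex" where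
  "cov_kernel \<alpha> z w = complex_of_real (cov_const \<alpha>) * (- \<i> * (z - cnj w)) powr complex_of_real (2 * \<alpha> - 2)"

locale Gamma_process = prob_space M for M :: "'a measure" +
  fixes \<alpha> :: real and X :: "complex \<Rightarrow> 'a \<Rightarrow> complex"
  assumes \<alpha>: "0 < \<alpha>" "\<alpha> < 1" and X: "is_Gamma_prime_plus M \<alpha> X"
begin

lemma gaussian: "complex_centered_gaussian_process M upper_half_plane X"
  using X by (simp add: is_Gamma_prime_plus_def)

lemma X_measurable: "0 < Im z \<Longrightarrow> X z \<in> borel_measurable M"
  using gaussian by (auto simp: complex_centered_gaussian_process_def upper_half_plane_def)

lemma covariance:
  assumes "0 < Im z" "0 < Im w"
  shows "(\<integral>\<omega>. X z \<omega> * X w \<omega> \<partial>M) = 0" "(\<integral>\<omega>. X z \<omega> * cnj (X w \<omega>) \<partial>M) = cov_kernel \<alpha> z w"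
  using X assms by (auto simp: is_Gamma_prime_plus_def upper_half_plane_def lower_process_def cov_kernel_def cov_const_def)

lemma centered_gaussian_Re_Im:
  assumes "0 < Im z"
  shows "centered_gaussian M (\<lambda>\<omega>. Re (X z \<omega>))" "centered_gaussian M (\<lambda>\<omega>. Im (X z \<omega>))"
proof -
  have *: "centered_gaussian M (\<lambda>\<omega>. Re (\<Sum>z\<in>{z}. c z * X z \<omega>))" for c
    using gaussian assms unfolding complex_centered_gaussian_process_def upper_half_plane_def by blast
  show "centered_gaussian M (\<lambda>\<omega>. Re (X z \<omega>))" using *[of "\<lambda>_. 1"] by simp
  show "centered_gaussian M (\<lambda>\<omega>. Im (X z \<omega>))" using *[of "\<lambda>_. - \<i>"] by simp
qed

lemma second_moment:
  assumes "0 < Im z"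
  shows "integrable M (\<lambda>\<omega>. (norm (X z \<omega>))\<^sup>2)"
    and "(\<integral>\<omega>. (norm (X z \<omega>))\<^sup>2 \<partial>M) = cov_const \<alpha> * (2 * Im z) powr (2 * \<alpha> - 2)"
proof -
  have i: "integrable M (\<lambda>\<omega>. (Re (X z \<omega>))\<^sup>2)" "integrable M (\<lambda>\<omega>. (Im (X z \<omega>))\<^sup>2)"
    using centered_gaussian_moment(1)[OF prob_space_axioms centered_gaussian_Re_Im(1)[OF assms], of 1]
      centered_gaussian_moment(1)[OF prob_space_axioms centered_gaussian_Re_Im(2)[OF assms], of 1] by auto
  then show int: "integrable M (\<lambda>\<omega>. (norm (X z \<omega>))\<^sup>2)" by (simp add: cmod_power2)
  have "complex_of_real (\<integral>\<omega>. (norm (X z \<omega>))\<^sup>2 \<partial>M) = (\<integral>\<omega>. X z \<omega> * cnj (X z \<omega>) \<partial>M)"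
    by (simp add: complex_norm_square[symmetric] flip: integral_complex_of_real)
  also have "\<dots> = complex_of_real (cov_const \<alpha> * (2 * Im z) powr (2 * \<alpha> - 2))"
  proof -
    have "- \<i> * (z - cnj z) = complex_of_real (2 * Im z)" by (simp add: complex_eq_iff)
    then show ?thesis using assms by (simp only: covariance cov_kernel_def powr_of_real) simp
  qed
  finally show "(\<integral>\<omega>. (norm (X z \<omega>))\<^sup>2 \<partial>M) = cov_const \<alpha> * (2 * Im z) powr (2 * \<alpha> - 2)"
    by (simp only: of_real_eq_iff)
qed

text \<open>
  The real and imaginary parts are Gaussian with variances at most that of the modulus.
\<close>

lemma higher_moment:
  assumes "0 < Im z"
  shows "integrable M (\<lambda>\<omega>. norm (X z \<omega>) ^ (2 * m))"
    and "(\<integral>\<omega>. norm (X z \<omega>) ^ (2 * m) \<partial>M) \<le>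
      2 ^ m * 2 * (fact (2 * m) / (2 ^ m * fact m)) * (cov_const \<alpha> * (2 * Im z) powr (2 * \<alpha> - 2)) ^ m"
proof -
  note [measurable] = X_measurable[OF assms]
  note g = centered_gaussian_moment[OF prob_space_axioms centered_gaussian_Re_Im(1)[OF assms]]
    centered_gaussian_moment[OF prob_space_axioms centered_gaussian_Re_Im(2)[OF assms]]
  define V where "V = cov_const \<alpha> * (2 * Im z) powr (2 * \<alpha> - 2)"
  have V: "(\<integral>\<omega>. (Re (X z \<omega>))\<^sup>2 \<partial>M) + (\<integral>\<omega>. (Im (X z \<omega>))\<^sup>2 \<partial>M) = V"
    using g(1)[of 1] g(3)[of 1] second_moment(2)[OF assms]
    by (simp add: cmod_power2 V_def)
  have nn: "0 \<le> (\<integral>\<omega>. (Re (X z \<omega>))\<^sup>2 \<partial>M)" "0 \<le> (\<integral>\<omega>. (Im (X z \<omega>))\<^sup>2 \<partial>M)" by auto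
  have pw: "norm (X z \<omega>) ^ (2 * m) \<le> 2 ^ m * (Re (X z \<omega>) ^ (2 * m) + Im (X z \<omega>) ^ (2 * m))" for \<omega>
  proof -
    define a b where "a = (Re (X z \<omega>))\<^sup>2" and "b = (Im (X z \<omega>))\<^sup>2"
    have ab: "0 \<le> a" "0 \<le> b" by (auto simp: a_def b_def)
    have "norm (X z \<omega>) ^ (2 * m) = (a + b) ^ m"
      by (simp add: power_mult cmod_power2 a_def b_def)
    also have "\<dots> \<le> (2 * max a b) ^ m" using ab by (intro power_mono) auto
    also have "\<dots> = 2 ^ m * max a b ^ m" by (simp add: power_mult_distrib)
    also have "max a b ^ m \<le> a ^ m + b ^ m" using ab by (auto simp: max_def)
    finally show ?thesis by (simp add: power_mult a_def b_def)
  qed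
  have i: "integrable M (\<lambda>\<omega>. 2 ^ m * (Re (X z \<omega>) ^ (2 * m) + Im (X z \<omega>) ^ (2 * m)))"
    using g(1)[of m] g(3)[of m] by auto
  show int: "integrable M (\<lambda>\<omega>. norm (X z \<omega>) ^ (2 * m))"
    by (rule Bochner_Integration.integrable_bound[OF i]) (use pw in \<open>auto intro: order.trans[OF _ abs_ge_self]\<close>)
  define c where "c = (fact (2 * m) / (2 ^ m * fact m) :: real)"
  have c: "0 \<le> c" by (simp add: c_def)
  have "(\<integral>\<omega>. norm (X z \<omega>) ^ (2 * m) \<partial>M) \<le> (\<integral>\<omega>. 2 ^ m * (Re (X z \<omega>) ^ (2 * m) + Im (X z \<omega>) ^ (2 * m)) \<partial>M)"
    by (rule integral_mono[OF int i pw])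
  also have "\<dots> = 2 ^ m * (c * (\<integral>\<omega>. (Re (X z \<omega>))\<^sup>2 \<partial>M) ^ m + c * (\<integral>\<omega>. (Im (X z \<omega>))\<^sup>2 \<partial>M) ^ m)"
    using g(1)[of m] g(3)[of m] by (simp add: g(2)[of m] g(4)[of m] c_def)
  also have "\<dots> \<le> 2 ^ m * (c * V ^ m + c * V ^ m)"
    using V nn c by (intro mult_left_mono add_mono power_mono) auto
  finally show "(\<integral>\<omega>. norm (X z \<omega>) ^ (2 * m) \<partial>M) \<le>
      2 ^ m * 2 * (fact (2 * m) / (2 ^ m * fact m)) * (cov_const \<alpha> * (2 * Im z) powr (2 * \<alpha> - 2)) ^ m"
    by (simp add: c_def V_def algebra_simps)
qed

lemma analytic_set:
  obtains G where "G \<in> sets M" "AE \<omega> in M. \<omega> \<in> G"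
    "\<And>\<omega>. \<omega> \<in> G \<Longrightarrow> (\<lambda>z. X z \<omega>) holomorphic_on {z. 0 < Im z}"
proof -
  have "AE \<omega> in M. (\<lambda>z. X z \<omega>) analytic_on upper_half_plane"
    using X by (simp add: is_Gamma_prime_plus_def)
  then obtain N where N: "{\<omega> \<in> space M. \<not> (\<lambda>z. X z \<omega>) analytic_on upper_half_plane} \<subseteq> N" "N \<in> null_sets M"
    unfolding eventually_ae_filter by auto
  have "AE \<omega> in M. \<omega> \<notin> N" using N(2) by (rule AE_not_in)
  then have ae: "AE \<omega> in M. \<omega> \<in> space M - N" by (auto elim: AE_mp)
  show ?thesis
  proof (rule that[of "space M - N"])
    fix \<omega> assume "\<omega> \<in> space M - N"
    then have "(\<lambda>z. X z \<omega>) analytic_on upper_half_plane" using N(1) by blast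
    then show "(\<lambda>z. X z \<omega>) holomorphic_on {z. 0 < Im z}"
      by (auto dest: analytic_imp_holomorphic simp: upper_half_plane_def)
  qed (use N ae in auto)
qed

end

text \<open>
  A function that is measurable in \<open>\<omega>\<close> and continuous in \<open>z\<close> is the limit of its values at grid points
  close to \<open>z\<close>, of which there are only countably many for each mesh. Imaginary parts are rounded
  up so that the grid points stay in the open upper half-plane.
\<close>

lemma jointly_measurable:
  fixes Y :: "complex \<Rightarrow> 'a \<Rightarrow> complex"
  assumes meas: "\<And>z. 0 < Im z \<Longrightarrow> Y z \<in> borel_measurable M"
    and cont: "\<And>\<omega>. \<omega> \<in> space M \<Longrightarrow> continuous_on {z. 0 < Im z} (\<lambda>z. Y z \<omega>)"
    and zero: "\<And>z \<omega>. Im z \<le> 0 \<Longrightarrow> Y z \<omega> = 0"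
  shows "(\<lambda>(z, \<omega>). Y z \<omega>) \<in> borel_measurable (borel \<Otimes>\<^sub>M M)"
proof -
  define \<zeta> where "\<zeta> = (\<lambda>(n::nat) z. Complex (of_int \<lfloor>2 ^ n * Re z\<rfloor> / 2 ^ n) (of_int \<lceil>2 ^ n * Im z\<rceil> / 2 ^ n))"
  have Y[measurable]: "Y z \<in> borel_measurable M" for z
  proof (cases "0 < Im z")
    case False
    then have "Y z = (\<lambda>_. 0)" using zero by force
    then show ?thesis by simp
  qed (rule meas)
  show ?thesis
  proof (rule borel_measurable_LIMSEQ_metric[where f = "\<lambda>n p. Y (\<zeta> n (fst p)) (snd p)"])
    show "(\<lambda>p. Y (\<zeta> n (fst p)) (snd p)) \<in> borel_measurable (borel \<Otimes>\<^sub>M M)" for n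
    proof -
      have "(\<lambda>p. (\<lambda>j p. Y (Complex (of_int \<lfloor>2 ^ n * Re (fst p)\<rfloor> / 2 ^ n) (of_int j / 2 ^ n)) (snd p))
          \<lceil>2 ^ n * Im (fst p)\<rceil> p) \<in> borel_measurable (borel \<Otimes>\<^sub>M M)"
      proof (rule measurable_compose_countable[where g = "\<lambda>p. \<lceil>2 ^ n * Im (fst p)\<rceil>" and
          f = "\<lambda>j p. Y (Complex (of_int \<lfloor>2 ^ n * Re (fst p)\<rfloor> / 2 ^ n) (of_int j / 2 ^ n)) (snd p)"])
        fix j :: int
        show "(\<lambda>p. Y (Complex (of_int \<lfloor>2 ^ n * Re (fst p)\<rfloor> / 2 ^ n) (of_int j / 2 ^ n)) (snd p)) \<in> borel_measurable (borel \<Otimes>\<^sub>M M)"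
          by (rule measurable_compose_countable[where f = "\<lambda>i p. Y (Complex (of_int i / 2 ^ n) (of_int j / 2 ^ n)) (snd p)"
             and g = "\<lambda>p. \<lfloor>2 ^ n * Re (fst p)\<rfloor>"])
             measurable
      qed measurable
      then show ?thesis by (simp add: \<zeta>_def)
    qed
    fix p :: "complex \<times> 'a" assume p: "p \<in> space (borel \<Otimes>\<^sub>M M)"
    obtain z \<omega> where z: "p = (z, \<omega>)" "\<omega> \<in> space M" using p by (cases p) (auto simp: space_pair_measure)
    have "(\<lambda>n. Y (\<zeta> n z) \<omega>) \<longlonglongrightarrow> Y z \<omega>"
    proof (cases "0 < Im z")
      case True
      have inv: "(\<lambda>n. 1 / 2 ^ n :: real) \<longlonglongrightarrow> 0"
        using LIMSEQ_abs_realpow_zero2[of "1 / 2 :: real"] by (simp add: power_divide)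
      have "(\<lambda>n. of_int \<lfloor>2 ^ n * Re z\<rfloor> / 2 ^ n) \<longlonglongrightarrow> Re z"
      proof (rule LIM_zero_cancel, rule Lim_null_comparison[OF _ inv], rule always_eventually, rule allI)
        fix n :: nat
        have 1: "\<bar>of_int \<lfloor>2 ^ n * Re z\<rfloor> - 2 ^ n * Re z\<bar> \<le> 1" by linarith
        have "of_int \<lfloor>2 ^ n * Re z\<rfloor> / 2 ^ n - Re z = (of_int \<lfloor>2 ^ n * Re z\<rfloor> - 2 ^ n * Re z) / 2 ^ n"
          by (simp add: diff_divide_distrib)
        also have "norm \<dots> \<le> 1 / 2 ^ n"
          using divide_right_mono[OF 1, of "2 ^ n"] by simp
        finally show "norm (of_int \<lfloor>2 ^ n * Re z\<rfloor> / 2 ^ n - Re z) \<le> 1 / 2 ^ n" .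
      qed
      moreover have "(\<lambda>n. of_int \<lceil>2 ^ n * Im z\<rceil> / 2 ^ n) \<longlonglongrightarrow> Im z"
      proof (rule LIM_zero_cancel, rule Lim_null_comparison[OF _ inv], rule always_eventually, rule allI)
        fix n :: nat
        have 1: "\<bar>of_int \<lceil>2 ^ n * Im z\<rceil> - 2 ^ n * Im z\<bar> \<le> 1" by linarith
        have "of_int \<lceil>2 ^ n * Im z\<rceil> / 2 ^ n - Im z = (of_int \<lceil>2 ^ n * Im z\<rceil> - 2 ^ n * Im z) / 2 ^ n"
          by (simp add: diff_divide_distrib)
        also have "norm \<dots> \<le> 1 / 2 ^ n"
          using divide_right_mono[OF 1, of "2 ^ n"] by simp
        finally show "norm (of_int \<lceil>2 ^ n * Im z\<rceil> / 2 ^ n - Im z) \<le> 1 / 2 ^ n" .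
      qed
      ultimately have lim: "(\<lambda>n. \<zeta> n z) \<longlonglongrightarrow> z"
        unfolding \<zeta>_def by (subst tendsto_complex_iff) simp
      have pos: "0 < Im (\<zeta> n z)" for n
        using True by (simp add: \<zeta>_def)
      show ?thesis
        by (rule continuous_on_tendsto_compose[OF cont[OF z(2)] lim]) (use True pos in auto)
    next
      case False
      have "Im (\<zeta> n z) \<le> 0" for n
        using False mult_nonneg_nonpos[of "2 ^ n" "Im z"] by (simp add: \<zeta>_def divide_nonpos_pos)
      then show ?thesis using zero False by simp
    qed
    then show "(\<lambda>n. Y (\<zeta> n (fst p)) (snd p)) \<longlonglongrightarrow> (case p of (z, \<omega>) \<Rightarrow> Y z \<omega>)" using z by simp
  qed
qed

section \<open>Almost sure growth at the boundary\<close>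

text \<open>
  Cauchy's formula for the holomorphic function \<open>f ^ n\<close> on the circle; points of the inner half of the
  disc have distance at least \<open>r / 2\<close> from it.
\<close>

lemma power_le_circle_integral:
  assumes f: "f holomorphic_on cball c r" and r: "0 < r" and z: "norm (z - c) \<le> r / 2"
  shows "norm (f z) ^ n \<le> 2 * integral {0..1} (\<lambda>\<theta>. norm (f (circlepath c r \<theta>)) ^ n)"
proof -
  define h where "h = (\<lambda>\<theta>. (f (circlepath c r \<theta>)) ^ n / (circlepath c r \<theta> - z) * vector_derivative (circlepath c r) (at \<theta> within {0..1}))"
  have "((\<lambda>u. f u ^ n / (u - z)) has_contour_integral 2 * of_real pi * \<i> * f z ^ n) (circlepath c r)"
    using z r f
    by (intro Cauchy_integral_circlepath_simple holomorphic_intros) (auto simp: dist_norm norm_minus_commute)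
  then have h: "(h has_integral 2 * of_real pi * \<i> * f z ^ n) {0..1}"
    by (simp add: has_contour_integral_def h_def)
  have onc: "circlepath c r \<theta> \<in> cball c r" for \<theta>
    using r by (simp add: circlepath dist_norm norm_mult)
  have cont: "continuous_on {0..1} (\<lambda>\<theta>. norm (f (circlepath c r \<theta>)) ^ n)"
  proof -
    have "continuous_on {0..1} (\<lambda>\<theta>. f (circlepath c r \<theta>))"
      by (rule continuous_on_compose2[OF holomorphic_on_imp_continuous_on[OF f]])
         (use onc in \<open>auto simp: circlepath intro!: continuous_intros\<close>)
    then show ?thesis by (intro continuous_intros)
  qed
  have "norm (integral {0..1} h) \<le> integral {0..1} (\<lambda>\<theta>. 4 * pi * norm (f (circlepath c r \<theta>)) ^ n)"
  proof (rule integral_norm_bound_integral)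
    show "h integrable_on {0..1}" using h by auto
    show "(\<lambda>\<theta>. 4 * pi * norm (f (circlepath c r \<theta>)) ^ n) integrable_on {0..1}"
      using cont by (intro integrable_continuous_real continuous_on_mult continuous_on_const)
    fix \<theta> :: real assume \<theta>: "\<theta> \<in> {0..1}"
    have v: "norm (vector_derivative (circlepath c r) (at \<theta> within {0..1})) = 2 * pi * r"
      using \<theta> r by (simp add: vector_derivative_circlepath01 norm_mult)
    have "norm (circlepath c r \<theta> - c) = r" using r by (simp add: circlepath norm_mult)
    then have "r / 2 \<le> norm (circlepath c r \<theta> - z)"
      using z norm_triangle_ineq[of "circlepath c r \<theta> - z" "z - c"] by simp
    then have "0 < norm (circlepath c r \<theta> - z)" "r / 2 \<le> norm (circlepath c r \<theta> - z)"
      using r by linarith+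
    then have "norm (h \<theta>) \<le> norm (f (circlepath c r \<theta>)) ^ n / (r / 2) * (2 * pi * r)"
      unfolding h_def norm_mult norm_divide v norm_power using r
      by (intro mult_right_mono divide_left_mono) (auto intro!: mult_pos_pos)
    also have "\<dots> = 4 * pi * norm (f (circlepath c r \<theta>)) ^ n" using r by simp
    finally show "norm (h \<theta>) \<le> 4 * pi * norm (f (circlepath c r \<theta>)) ^ n" .
  qed
  moreover have "norm (integral {0..1} h) = 2 * pi * norm (f z) ^ n"
    using integral_unique[OF h] by (simp add: norm_mult norm_power)
  ultimately have "2 * pi * norm (f z) ^ n \<le> 2 * pi * (2 * integral {0..1} (\<lambda>\<theta>. norm (f (circlepath c r \<theta>)) ^ n))"
    by simp
  then show ?thesis by (rule mult_left_le_imp_le) simp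
qed

text \<open>
  The sum of the \<open>T j\<close> with weights \<open>1 / (2 * \<sigma>) ^ j\<close> has finite expectation and is therefore almost surely
  finite.
\<close>

lemma geometric_moments_AE_bound:
  assumes T[measurable]: "\<And>j::nat. T j \<in> borel_measurable M"
    and K: "0 \<le> K" "0 < \<sigma>" and mom: "\<And>j. (\<integral>\<^sup>+\<omega>. T j \<omega> \<partial>M) \<le> ennreal (K * \<sigma> ^ j)"
  shows "AE \<omega> in M. \<exists>C\<ge>0. \<forall>j. T j \<omega> \<le> ennreal (C * (2 * \<sigma>) ^ j)"
proof -
  define w where "w = (\<lambda>j::nat. 1 / (2 * \<sigma>) ^ j)"
  have w: "0 < w j" for j using K by (simp add: w_def)
  have "(\<integral>\<^sup>+\<omega>. (\<Sum>j. ennreal (w j) * T j \<omega>) \<partial>M) = (\<Sum>j. ennreal (w j) * (\<integral>\<^sup>+\<omega>. T j \<omega> \<partial>M))"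
    by (subst nn_integral_suminf) (simp_all add: nn_integral_cmult)
  also have "\<dots> \<le> (\<Sum>j. ennreal (K * (1 / 2) ^ j))"
  proof (intro suminf_le allI)
    fix j
    have "ennreal (w j) * (\<integral>\<^sup>+\<omega>. T j \<omega> \<partial>M) \<le> ennreal (w j) * ennreal (K * \<sigma> ^ j)"
      by (intro mult_left_mono mom) simp
    also have "\<dots> = ennreal (w j * (K * \<sigma> ^ j))" using w[of j] by (simp add: ennreal_mult')
    also have "w j * (K * \<sigma> ^ j) = K * (1 / 2) ^ j"
      using K by (simp add: w_def power_mult_distrib power_divide field_simps)
    finally show "ennreal (w j) * (\<integral>\<^sup>+\<omega>. T j \<omega> \<partial>M) \<le> ennreal (K * (1 / 2) ^ j)" .
  qed auto
  also have "\<dots> < \<infinity>"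
    using K by (subst suminf_ennreal2) (auto intro!: summable_mult summable_geometric)
  finally have "AE \<omega> in M. (\<Sum>j. ennreal (w j) * T j \<omega>) \<noteq> \<infinity>"
    by (intro nn_integral_PInf_AE) auto
  then show ?thesis
  proof eventually_elim
    case (elim \<omega>)
    define C where "C = enn2real (\<Sum>j. ennreal (w j) * T j \<omega>)"
    have C: "(\<Sum>j. ennreal (w j) * T j \<omega>) = ennreal C" "0 \<le> C"
      using elim by (auto simp: C_def less_top)
    have "T j \<omega> \<le> ennreal (C * (2 * \<sigma>) ^ j)" for j
    proof -
      have "ennreal (w j) * T j \<omega> \<le> ennreal C"
        unfolding C(1)[symmetric] using sum_le_suminf[of "\<lambda>j. ennreal (w j) * T j \<omega>" "{j}"] by simp
      then have "ennreal ((2 * \<sigma>) ^ j) * (ennreal (w j) * T j \<omega>) \<le> ennreal ((2 * \<sigma>) ^ j) * ennreal C"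
        by (intro mult_left_mono) auto
      moreover have "ennreal ((2 * \<sigma>) ^ j) * ennreal (w j) = 1"
        using K by (simp add: ennreal_mult'[symmetric] w_def)
      then have "T j \<omega> = ennreal ((2 * \<sigma>) ^ j) * (ennreal (w j) * T j \<omega>)"
        by (simp only: mult.assoc[symmetric]) simp
      moreover have "ennreal ((2 * \<sigma>) ^ j) * ennreal C = ennreal (C * (2 * \<sigma>) ^ j)"
        using C K by (subst mult.commute) (simp add: ennreal_mult'[symmetric])
      ultimately show ?thesis by simp
    qed
    then show ?case using C(2) by blast
  qed
qed

lemma dyadic_scale:
  fixes y N :: real
  assumes "0 < y" "y \<le> N"
  obtains j :: nat where "N / 2 ^ Suc j < y" "y \<le> N / 2 ^ j"
proof -
  have "\<exists>n. N / 2 ^ n < y"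
  proof -
    obtain n :: nat where "N / y < 2 ^ n" using real_arch_pow[of 2 "N / y"] by auto
    then have "N / 2 ^ n < y" using assms by (simp add: field_simps)
    then show ?thesis ..
  qed
  then obtain n where n: "N / 2 ^ n < y" "\<And>m. m < n \<Longrightarrow> \<not> N / 2 ^ m < y"
    using exists_least_iff[of "\<lambda>n. N / 2 ^ n < y"] by auto
  obtain j where "n = Suc j" using n(1) assms by (cases n) auto
  then show ?thesis using that[of j] n(1) n(2)[of j] by (simp add: not_less)
qed

context Gamma_process
begin

lemma cov_const_nonneg: "0 \<le> cov_const \<alpha>"
proof -
  have "0 \<le> (\<integral>\<omega>. (norm (X \<i> \<omega>))\<^sup>2 \<partial>M)" by simp
  then have "0 \<le> cov_const \<alpha> * (2 * Im \<i>) powr (2 * \<alpha> - 2)"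
    by (subst (asm) second_moment) auto
  then show ?thesis by (simp add: zero_le_mult_iff)
qed

lemma moment_nn:
  assumes "0 < d" "d \<le> Im z"
  shows "(\<integral>\<^sup>+\<omega>. ennreal (norm (X z \<omega>) ^ (2 * m)) \<partial>M) \<le>
     ennreal (2 ^ m * 2 * (fact (2 * m) / (2 ^ m * fact m)) * (cov_const \<alpha> * (2 * d) powr (2 * \<alpha> - 2)) ^ m)"
proof -
  have z: "0 < Im z" using assms by simp
  have "(\<integral>\<^sup>+\<omega>. ennreal (norm (X z \<omega>) ^ (2 * m)) \<partial>M) = ennreal (\<integral>\<omega>. norm (X z \<omega>) ^ (2 * m) \<partial>M)"
    by (intro nn_integral_eq_integral higher_moment z) simp
  also have "\<dots> \<le> ennreal (2 ^ m * 2 * (fact (2 * m) / (2 ^ m * fact m)) * (cov_const \<alpha> * (2 * Im z) powr (2 * \<alpha> - 2)) ^ m)"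
    by (intro ennreal_leI higher_moment z)
  also have "\<dots> \<le> ennreal (2 ^ m * 2 * (fact (2 * m) / (2 ^ m * fact m)) * (cov_const \<alpha> * (2 * d) powr (2 * \<alpha> - 2)) ^ m)"
    using assms \<alpha> cov_const_nonneg
    by (intro ennreal_leI mult_left_mono power_mono powr_mono2') (auto intro!: mult_nonneg_nonneg)
  finally show ?thesis .
qed

text \<open>
  The region is covered by discs of radius \<open>2 * \<delta> j\<close> whose centres form a grid of mesh \<open>\<delta> j\<close> at
  heights comparable with \<open>N / 2 ^ j\<close>. On each disc the supremum of the \<open>2 * m\<close>-th power is bounded by a
  circle average, of known expectation. Summing over the grid and over the levels
  \<open>j\<close> costs a factor \<open>4 ^ j\<close>, hence a power \<open>1 / m\<close> of the height after taking roots; this is at most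
  \<open>\<alpha> - \<beta>\<close> for large \<open>m\<close>.
\<close>

lemma growth_AE_fixed:
  fixes N :: nat
  assumes \<beta>: "\<beta> < \<alpha>"
  shows "AE \<omega> in M. \<exists>C\<ge>0. growth_bound \<beta> (real N) C (\<lambda>z. X z \<omega>)"
proof (cases "N = 0")
  case True
  then show ?thesis by (auto simp: growth_bound_def intro!: exI[of _ 0])
next
  case False
  then have N: "0 < real N" by simp
  obtain G where G[measurable]: "G \<in> sets M" and AE_G: "AE \<omega> in M. \<omega> \<in> G"
    and hol: "\<And>\<omega>. \<omega> \<in> G \<Longrightarrow> (\<lambda>z. X z \<omega>) holomorphic_on {z. 0 < Im z}"
    using analytic_set by blast
  define Y where "Y = (\<lambda>z \<omega>. if \<omega> \<in> G \<and> 0 < Im z then X z \<omega> else 0)"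
  have "(\<lambda>(z, \<omega>). Y z \<omega>) \<in> borel_measurable (borel \<Otimes>\<^sub>M M)"
  proof (rule jointly_measurable)
    fix z :: complex assume z: "0 < Im z"
    note [measurable] = X_measurable[OF z]
    have "(\<lambda>\<omega>. if \<omega> \<in> G then X z \<omega> else 0) \<in> borel_measurable M" by measurable
    then show "Y z \<in> borel_measurable M" using z by (simp add: Y_def)
  next
    fix \<omega>
    show "continuous_on {z. 0 < Im z} (\<lambda>z. Y z \<omega>)"
    proof (cases "\<omega> \<in> G")
      case True
      show ?thesis
        using holomorphic_on_imp_continuous_on[OF hol[OF True]]
        by (rule continuous_on_eq) (simp add: Y_def True)
    qed (simp add: Y_def)
  qed (simp add: Y_def)
  note Yj = this
  have Ym: "(\<lambda>x. Y (f x) (g x)) \<in> borel_measurable L"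
    if "f \<in> borel_measurable L" "g \<in> measurable L M" for f g and L :: "'z measure"
    using measurable_compose[OF measurable_Pair[OF that] Yj] by simp
  obtain m :: nat where m: "1 / (\<alpha> - \<beta>) < real m" using reals_Archimedean2 by blast
  have m0: "0 < m" using m \<beta> by (cases m) (auto simp: field_simps)
  have m1: "1 / real m \<le> \<alpha> - \<beta>" using m m0 \<beta> by (simp add: field_simps)
  \<comment> \<open>Heights in \<open>(N / 2 ^ (j + 1), N / 2 ^ j]\<close> are between \<open>8 * \<delta> j\<close> and \<open>16 * \<delta> j\<close>. Circles of radius \<open>4 * \<delta> j\<close> around
    grid points of height at least \<open>8 * \<delta> j\<close> stay above height \<open>\<delta> j\<close>.\<close>
  define \<delta> where "\<delta> = (\<lambda>j::nat. real N / 2 ^ j / 16)"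
  have \<delta>: "0 < \<delta> j" for j using N by (simp add: \<delta>_def)
  define S where "S = (\<lambda>c r \<omega>. \<integral>\<^sup>+\<theta>\<in>{0..1}. ennreal (norm (Y (circlepath c r \<theta>) \<omega>) ^ (2 * m)) \<partial>lborel)"
  have cm: "circlepath c r \<in> borel_measurable borel" for c r
    unfolding circlepath by (intro borel_measurable_continuous_onI continuous_intros)
  have inm: "(\<lambda>p. ennreal (norm (Y (circlepath c r (fst p)) (snd p)) ^ (2 * m)) * indicator {0..1} (fst p))
      \<in> borel_measurable (lborel \<Otimes>\<^sub>M M)" for c r
  proof -
    have [measurable]: "circlepath c r \<in> borel_measurable lborel" using cm by (simp add: measurable_lborel1)
    have [measurable]: "(\<lambda>p. circlepath c r (fst p)) \<in> borel_measurable (lborel \<Otimes>\<^sub>M M)" by measurable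
    have [measurable]: "(\<lambda>p. Y (circlepath c r (fst p)) (snd p)) \<in> borel_measurable (lborel \<Otimes>\<^sub>M M)"
      by (rule Ym) measurable
    show ?thesis by measurable
  qed
  interpret P: pair_sigma_finite lborel M ..
  have Sm[measurable]: "S c r \<in> borel_measurable M" for c r
  proof -
    have "(\<lambda>(\<omega>, \<theta>). ennreal (norm (Y (circlepath c r \<theta>) \<omega>) ^ (2 * m)) * indicator {0..1} \<theta>) \<in> borel_measurable (M \<Otimes>\<^sub>M lborel)"
      using measurable_compose[OF measurable_pair_swap' inm[of c r]] by (simp add: case_prod_unfold)
    then show ?thesis unfolding S_def by (rule lborel.borel_measurable_nn_integral)
  qed
  define Cm where "Cm = 2 ^ m * 2 * (fact (2 * m) / (2 ^ m * fact m) :: real)"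
  have Cm: "0 \<le> Cm" by (simp add: Cm_def)
  define B where "B = (\<lambda>j. Cm * (cov_const \<alpha> * (2 * \<delta> j) powr (2 * \<alpha> - 2)) ^ m)"
  have ES: "(\<integral>\<^sup>+\<omega>. S c (4 * \<delta> j) \<omega> \<partial>M) \<le> ennreal (B j)" if c: "5 * \<delta> j \<le> Im c" for c j
  proof -
    have "(\<integral>\<^sup>+\<omega>. S c (4 * \<delta> j) \<omega> \<partial>M) = (\<integral>\<^sup>+\<theta>. (\<integral>\<^sup>+\<omega>. ennreal (norm (Y (circlepath c (4 * \<delta> j) \<theta>) \<omega>) ^ (2 * m)) * indicator {0..1} \<theta> \<partial>M) \<partial>lborel)"
      unfolding S_def using inm[of c "4 * \<delta> j"] by (intro P.Fubini') (simp add: case_prod_unfold)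
    also have "\<dots> \<le> (\<integral>\<^sup>+\<theta>. ennreal (B j) * indicator {0..1} (\<theta>::real) \<partial>lborel)"
    proof (intro nn_integral_mono)
      fix \<theta> :: real
      let ?z = "circlepath c (4 * \<delta> j) \<theta>"
      have "norm (?z - c) = 4 * \<delta> j" using \<delta>[of j] by (simp add: circlepath norm_mult)
      then have Im: "\<delta> j \<le> Im ?z"
        using abs_Im_le_cmod[of "?z - c"] c by (auto simp: abs_le_iff)
      have "(\<integral>\<^sup>+\<omega>. ennreal (norm (Y ?z \<omega>) ^ (2 * m)) \<partial>M) = (\<integral>\<^sup>+\<omega>. ennreal (norm (X ?z \<omega>) ^ (2 * m)) \<partial>M)"
        using AE_G by (intro nn_integral_cong_AE, eventually_elim) (use Im \<delta>[of j] in \<open>simp add: Y_def\<close>)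
      also have "\<dots> \<le> ennreal (B j)"
        unfolding B_def Cm_def by (rule moment_nn[OF \<delta> Im])
      finally have "(\<integral>\<^sup>+\<omega>. ennreal (norm (Y ?z \<omega>) ^ (2 * m)) \<partial>M) \<le> ennreal (B j)" .
      then show "(\<integral>\<^sup>+\<omega>. ennreal (norm (Y ?z \<omega>) ^ (2 * m)) * indicator {0..1} \<theta> \<partial>M) \<le> ennreal (B j) * indicator {0..1} \<theta>"
        by (auto simp: indicator_def)
    qed
    also have "\<dots> = ennreal (B j)" by (simp add: nn_integral_cmult)
    finally show ?thesis .
  qed
  define T where "T = (\<lambda>(j::nat) \<omega>. \<Sum>k\<in>{-(16 * 2 ^ j)..16 * 2 ^ j}. \<Sum>l\<in>{8..16}.
      S (Complex (of_int k * \<delta> j) (of_int l * \<delta> j)) (4 * \<delta> j) \<omega>)"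
  have Tm[measurable]: "T j \<in> borel_measurable M" for j unfolding T_def by measurable
  \<comment> \<open>The growth per level: a factor 2 from the number of grid points, the rest from the moments.\<close>
  define \<sigma> where "\<sigma> = 2 powr (1 + (2 - 2 * \<alpha>) * m)"
  define K where "K = 33 * 9 * (Cm * (cov_const \<alpha> * (real N / 8) powr (2 * \<alpha> - 2)) ^ m)"
  have K: "0 \<le> K" using Cm cov_const_nonneg by (simp add: K_def)
  have ET: "(\<integral>\<^sup>+\<omega>. T j \<omega> \<partial>M) \<le> ennreal (K * \<sigma> ^ j)" for j
  proof -
    have B0: "0 \<le> B j" using Cm cov_const_nonneg by (simp add: B_def)
    have "(\<integral>\<^sup>+\<omega>. T j \<omega> \<partial>M) = (\<Sum>k\<in>{-(16 * 2 ^ j)..16 * 2 ^ j}. \<Sum>l\<in>{8..16}.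
      (\<integral>\<^sup>+\<omega>. S (Complex (of_int k * \<delta> j) (of_int l * \<delta> j)) (4 * \<delta> j) \<omega> \<partial>M))"
      unfolding T_def by (simp add: nn_integral_sum)
    also have "\<dots> \<le> (\<Sum>k\<in>{-(16 * 2 ^ j)..(16 * 2 ^ j)::int}. \<Sum>l\<in>{8..16::int}. ennreal (B j))"
      using \<delta>[of j] by (intro sum_mono ES) (auto intro!: mult_right_mono)
    also have "\<dots> = ennreal (\<Sum>k\<in>{-(16 * 2 ^ j)..(16 * 2 ^ j)::int}. \<Sum>l\<in>{8..16::int}. B j)"
      using B0 by (simp only: sum_ennreal sum_nonneg)
    also have "(\<Sum>k\<in>{-(16 * 2 ^ j)..(16 * 2 ^ j)::int}. \<Sum>l\<in>{8..16::int}. B j) = real (nat (32 * 2 ^ j + 1)) * (9 * B j)"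
      by simp
    also have "\<dots> \<le> ennreal (33 * 2 ^ j * (9 * B j))"
    proof (intro ennreal_leI mult_right_mono)
      have "real (nat (32 * 2 ^ j + 1)) = 32 * 2 ^ j + 1" by (simp add: nat_add_distrib nat_mult_distrib nat_power_eq)
      also have "\<dots> \<le> 33 * 2 ^ j" using one_le_power[of "2::real" j] by simp
      finally show "real (nat (32 * 2 ^ j + 1)) \<le> 33 * 2 ^ j" .
    qed (use B0 in auto)
    also have "33 * 2 ^ j * (9 * B j) = K * \<sigma> ^ j"
    proof -
      have "(2 * \<delta> j) powr (2 * \<alpha> - 2) = (real N / 8) powr (2 * \<alpha> - 2) * (2 powr (2 - 2 * \<alpha>)) ^ j"
      proof -
        have "2 * \<delta> j = real N / 8 / 2 ^ j" by (simp add: \<delta>_def)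
        then have "(2 * \<delta> j) powr (2 * \<alpha> - 2) = (real N / 8) powr (2 * \<alpha> - 2) / (2 ^ j) powr (2 * \<alpha> - 2)"
          by (simp only: powr_divide)
        also have "\<dots> = (real N / 8) powr (2 * \<alpha> - 2) * (2 ^ j) powr (2 - 2 * \<alpha>)"
          using powr_minus_divide[of "2 ^ j" "2 * \<alpha> - 2"] by simp
        also have "(2 ^ j) powr (2 - 2 * \<alpha>) = (2 powr (2 - 2 * \<alpha>)) ^ j"
          by (simp add: powr_realpow[symmetric] powr_powr mult.commute)
        finally show ?thesis .
      qed
      moreover have "\<sigma> = 2 * (2 powr (2 - 2 * \<alpha>)) ^ m"
        by (simp add: \<sigma>_def powr_add powr_powr powr_realpow[symmetric])
      ultimately show ?thesis
        by (simp add: B_def K_def power_mult_distrib power_mult[symmetric] mult_ac)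
    qed
    finally show ?thesis .
  qed
  have "AE \<omega> in M. \<exists>C\<ge>0. \<forall>j. T j \<omega> \<le> ennreal (C * (2 * \<sigma>) ^ j)"
    by (rule geometric_moments_AE_bound[OF Tm K _ ET]) (simp add: \<sigma>_def)
  with AE_G show ?thesis
  proof eventually_elim
    case (elim \<omega>)
    then obtain C where C: "0 \<le> C" "\<And>j. T j \<omega> \<le> ennreal (C * (2 * \<sigma>) ^ j)" by blast
    define e where "e = 2 + (2 - 2 * \<alpha>) * m"
    have e: "0 < e" using \<alpha> m0 by (auto simp: e_def intro!: add_pos_nonneg)
    define C' where "C' = (2 * C) powr (1 / (2 * m)) * real N powr (1 - \<beta>)"
    have "growth_bound \<beta> (real N) C' (\<lambda>z. X z \<omega>)"
      unfolding growth_bound_def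
    proof (intro allI impI)
      fix z assume z: "\<bar>Re z\<bar> \<le> real N" "0 < Im z" "Im z \<le> real N"
      obtain j where j: "real N / 2 ^ Suc j < Im z" "Im z \<le> real N / 2 ^ j"
        using dyadic_scale[OF z(2,3)] by blast
      define k l where "k = \<lfloor>Re z / \<delta> j\<rfloor>" and "l = \<lfloor>Im z / \<delta> j\<rfloor>"
      define c where "c = Complex (of_int k * \<delta> j) (of_int l * \<delta> j)"
      have kz: "of_int k * \<delta> j \<le> Re z" "Re z < of_int k * \<delta> j + \<delta> j"
        using floor_divide_lower[OF \<delta>[of j], of "Re z"] floor_divide_upper[OF \<delta>[of j], of "Re z"]
        by (auto simp: k_def algebra_simps)
      have lz: "of_int l * \<delta> j \<le> Im z" "Im z < of_int l * \<delta> j + \<delta> j"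
        using floor_divide_lower[OF \<delta>[of j], of "Im z"] floor_divide_upper[OF \<delta>[of j], of "Im z"]
        by (auto simp: l_def algebra_simps)
      have l: "l \<in> {8..16}"
      proof -
        have "8 < Im z / \<delta> j" "Im z / \<delta> j \<le> 16"
          using j N by (auto simp: \<delta>_def field_simps)
        then show ?thesis unfolding l_def by (auto simp: le_floor_iff floor_le_iff)
      qed
      have k: "k \<in> {-(16 * 2 ^ j)..16 * 2 ^ j}"
      proof -
        have "\<bar>Re z / \<delta> j\<bar> = \<bar>Re z\<bar> / \<delta> j" using \<delta>[of j] by simp
        also have "\<dots> \<le> real N / \<delta> j" using z(1) \<delta>[of j] by (intro divide_right_mono) auto
        also have "\<dots> = 16 * 2 ^ j" using N by (simp add: \<delta>_def)
        finally have "\<bar>Re z / \<delta> j\<bar> \<le> 16 * 2 ^ j" .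
        then have "- (16 * 2 ^ j) \<le> Re z / \<delta> j" "Re z / \<delta> j \<le> 16 * 2 ^ j" by linarith+
        then show ?thesis unfolding k_def by (auto simp: le_floor_iff floor_le_iff)
      qed
      have zc: "norm (z - c) \<le> 4 * \<delta> j / 2"
        using cmod_le[of "z - c"] kz lz by (simp add: c_def)
      have cb: "cball c (4 * \<delta> j) \<subseteq> {z. 0 < Im z}"
      proof
        fix w assume "w \<in> cball c (4 * \<delta> j)"
        then have "\<bar>Im c - Im w\<bar> \<le> 4 * \<delta> j"
          using abs_Im_le_cmod[of "c - w"] by (auto simp: dist_norm)
        moreover have "8 * \<delta> j \<le> Im c" using l \<delta>[of j] by (auto simp: c_def intro!: mult_right_mono)
        ultimately show "w \<in> {z. 0 < Im z}" using \<delta>[of j] by auto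
      qed
      have circ: "circlepath c (4 * \<delta> j) \<theta> \<in> {z. 0 < Im z}" for \<theta>
        by (rule subsetD[OF cb]) (use \<delta>[of j] in \<open>simp add: circlepath dist_norm norm_mult\<close>)
      have holc: "(\<lambda>z. X z \<omega>) holomorphic_on cball c (4 * \<delta> j)"
        using hol[OF elim(1)] cb by (rule holomorphic_on_subset)
      have "norm (X z \<omega>) ^ (2 * m) \<le> 2 * integral {0..1} (\<lambda>\<theta>. norm (X (circlepath c (4 * \<delta> j) \<theta>) \<omega>) ^ (2 * m))"
        using \<delta>[of j] by (intro power_le_circle_integral[OF holc _ zc]) simp
      then have "ennreal (norm (X z \<omega>) ^ (2 * m)) \<le> ennreal (2 * integral {0..1} (\<lambda>\<theta>. norm (X (circlepath c (4 * \<delta> j) \<theta>) \<omega>) ^ (2 * m)))"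
        by (rule ennreal_leI)
      also have "\<dots> = 2 * ennreal (integral {0..1} (\<lambda>\<theta>. norm (X (circlepath c (4 * \<delta> j) \<theta>) \<omega>) ^ (2 * m)))"
        by (simp add: ennreal_mult')
      also have "ennreal (integral {0..1} (\<lambda>\<theta>. norm (X (circlepath c (4 * \<delta> j) \<theta>) \<omega>) ^ (2 * m))) = S c (4 * \<delta> j) \<omega>"
      proof -
        have "continuous_on {0..1} (\<lambda>\<theta>. X (circlepath c (4 * \<delta> j) \<theta>) \<omega>)"
          by (rule continuous_on_compose2[OF holomorphic_on_imp_continuous_on[OF hol[OF elim(1)]]])
             (use circ in \<open>auto simp: circlepath intro!: continuous_intros\<close>)
        then have "ennreal (integral {0..1} (\<lambda>\<theta>. norm (X (circlepath c (4 * \<delta> j) \<theta>) \<omega>) ^ (2 * m))) =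
          (\<integral>\<^sup>+\<theta>\<in>{0..1}. ennreal (norm (X (circlepath c (4 * \<delta> j) \<theta>) \<omega>) ^ (2 * m)) \<partial>lborel)"
          by (intro nn_integral_Icc_eq_integral[symmetric] continuous_intros) auto
        also have "\<dots> = S c (4 * \<delta> j) \<omega>"
          unfolding S_def using circ elim(1) by (simp add: Y_def)
        finally show ?thesis .
      qed
      also have "2 * S c (4 * \<delta> j) \<omega> \<le> 2 * T j \<omega>"
      proof (rule mult_left_mono)
        have "S c (4 * \<delta> j) \<omega> \<le> (\<Sum>l\<in>{8..16}. S (Complex (of_int k * \<delta> j) (of_int l * \<delta> j)) (4 * \<delta> j) \<omega>)"
          unfolding c_def using l
          by (intro member_le_sum[of l _ "\<lambda>l. S (Complex (of_int k * \<delta> j) (of_int l * \<delta> j)) (4 * \<delta> j) \<omega>"]) auto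
        also have "\<dots> \<le> T j \<omega>"
          unfolding T_def using k
          by (intro member_le_sum[of k _ "\<lambda>k. \<Sum>l\<in>{8..16}. S (Complex (of_int k * \<delta> j) (of_int l * \<delta> j)) (4 * \<delta> j) \<omega>"]) auto
        finally show "S c (4 * \<delta> j) \<omega> \<le> T j \<omega>" .
      qed simp
      also have "2 * T j \<omega> \<le> 2 * ennreal (C * (2 * \<sigma>) ^ j)"
        by (intro mult_left_mono C) simp
      also have "\<dots> = ennreal (2 * (C * (2 * \<sigma>) ^ j))" by (simp add: ennreal_mult')
      finally have "norm (X z \<omega>) ^ (2 * m) \<le> 2 * (C * (2 * \<sigma>) ^ j)"
        using C by (subst (asm) ennreal_le_iff) (auto simp: \<sigma>_def)
      also have "(2 * \<sigma>) ^ j = (2 ^ j) powr e"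
      proof -
        have "2 * \<sigma> = 2 powr e" using powr_add[of 2 1 "1 + (2 - 2 * \<alpha>) * m"] by (simp add: \<sigma>_def e_def)
        then show ?thesis by (simp add: powr_realpow[symmetric] powr_powr mult.commute)
      qed
      also have "(2 ^ j) powr e \<le> (real N / Im z) powr e"
        using j(2) z N e by (intro powr_mono2) (auto simp: field_simps)
      finally have le: "norm (X z \<omega>) ^ (2 * m) \<le> 2 * C * (real N / Im z) powr e"
        using C by (simp add: mult_left_mono)
      have "norm (X z \<omega>) = (norm (X z \<omega>) ^ (2 * m)) powr (1 / (2 * m))"
      proof (cases "norm (X z \<omega>) = 0")
        case False
        then show ?thesis using m0 by (simp add: powr_realpow[symmetric] powr_powr)
      qed (use m0 in simp)
      also have "\<dots> \<le> (2 * C * (real N / Im z) powr e) powr (1 / (2 * m))"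
        using le by (intro powr_mono2) auto
      also have "\<dots> = (2 * C) powr (1 / (2 * m)) * (real N / Im z) powr (e * (1 / (2 * m)))"
        using C by (simp add: powr_mult powr_powr)
      also have "\<dots> \<le> (2 * C) powr (1 / (2 * m)) * (real N / Im z) powr (1 - \<beta>)"
      proof (intro mult_left_mono powr_mono)
        have "e * (1 / (2 * m)) = 1 / m + 1 - \<alpha>" using m0 by (simp add: e_def field_simps)
        then show "e * (1 / (2 * m)) \<le> 1 - \<beta>" using m1 by simp
        show "1 \<le> real N / Im z" using z by simp
      qed auto
      also have "(real N / Im z) powr (1 - \<beta>) = real N powr (1 - \<beta>) * Im z powr (\<beta> - 1)"
        using z powr_minus_divide[of "Im z" "1 - \<beta>"] by (simp add: powr_divide)
      finally show "norm (X z \<omega>) \<le> C' * Im z powr (\<beta> - 1)"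
        by (simp add: C'_def mult.assoc)
    qed
    moreover have "0 \<le> C'" by (simp add: C'_def)
    ultimately show ?case by blast
  qed
qed

lemma growth_AE:
  assumes "\<beta> < \<alpha>"
  shows "AE \<omega> in M. boundary_growth \<beta> (\<lambda>z. X z \<omega>)"
proof -
  obtain G where AE_G: "AE \<omega> in M. \<omega> \<in> G"
    and hol: "\<And>\<omega>. \<omega> \<in> G \<Longrightarrow> (\<lambda>z. X z \<omega>) holomorphic_on {z. 0 < Im z}"
    using analytic_set by blast
  have "AE \<omega> in M. \<forall>N::nat. \<exists>C\<ge>0. growth_bound \<beta> (real N) C (\<lambda>z. X z \<omega>)"
    using growth_AE_fixed[OF assms] by (simp add: AE_all_countable)
  with AE_G show ?thesis
    by eventually_elim (simp add: boundary_growth_def hol)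
qed

end

section \<open>Second moments of the cross term\<close>

locale Gamma_pair = p1: Gamma_process M \<alpha> X1 + p2: Gamma_process M \<alpha> X2
  for M :: "'a measure" and \<alpha> X1 X2 +
  assumes indep: "independent_processes M upper_half_plane X1 X2"
begin

lemma measurable_cnj: "cnj \<in> borel_measurable borel"
  by (intro borel_measurable_continuous_onI continuous_intros)

lemma product_integrable:
  assumes "Gamma_process M \<alpha> X" "0 < Im z" "0 < Im w"
  shows "integrable M (\<lambda>\<omega>. X z \<omega> * cnj (X w \<omega>))"
proof -
  interpret Gamma_process M \<alpha> X by fact
  note [measurable] = measurable_cnj X_measurable[OF assms(2)] X_measurable[OF assms(3)]
  show ?thesis
  proof (rule Bochner_Integration.integrable_bound)
    show "integrable M (\<lambda>\<omega>. (norm (X z \<omega>))\<^sup>2 + (norm (X w \<omega>))\<^sup>2)"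
      using second_moment(1) assms by auto
    have "norm a * norm b \<le> \<bar>(norm a)\<^sup>2 + (norm b)\<^sup>2\<bar>" for a b :: complex
      using sum_squares_bound[of "norm a" "norm b"] mult_nonneg_nonneg[of "norm a" "norm b"] by (simp add: abs_if)
    then show "AE \<omega> in M. norm (X z \<omega> * cnj (X w \<omega>)) \<le> norm ((norm (X z \<omega>))\<^sup>2 + (norm (X w \<omega>))\<^sup>2)"
      by (simp add: norm_mult)
  qed measurable
qed

text \<open>
  By independence the expectation factors into the covariance kernel and its conjugate, so the
  covariance of \<open>g1 * cnj g2\<close> is the positive function \<open>norm (cov_kernel \<alpha> z w)\<^sup>2\<close>.
\<close>

lemma cross_covariance:
  assumes z: "0 < Im z" and w: "0 < Im w"
  shows "integrable M (\<lambda>\<omega>. (X1 z \<omega> * cnj (X1 w \<omega>)) * (cnj (X2 z \<omega>) * X2 w \<omega>))"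
    and "(\<integral>\<omega>. (X1 z \<omega> * cnj (X1 w \<omega>)) * (cnj (X2 z \<omega>) * X2 w \<omega>) \<partial>M) = complex_of_real ((norm (cov_kernel \<alpha> z w))\<^sup>2)"
proof -
  have zw: "z \<in> upper_half_plane" "w \<in> upper_half_plane" using z w by (auto simp: upper_half_plane_def)
  note [measurable] = measurable_cnj
  have "p1.indep_var borel ((\<lambda>f. f z * cnj (f w)) \<circ> (\<lambda>\<omega>. \<lambda>z\<in>upper_half_plane. X1 z \<omega>))
     borel ((\<lambda>f. cnj (f z) * f w) \<circ> (\<lambda>\<omega>. \<lambda>z\<in>upper_half_plane. X2 z \<omega>))"
    using zw
    by (intro p1.indep_var_compose[OF indep[unfolded independent_processes_def]]) measurable
  then have iv: "p1.indep_var borel (\<lambda>\<omega>. X1 z \<omega> * cnj (X1 w \<omega>)) borel (\<lambda>\<omega>. cnj (X2 z \<omega>) * X2 w \<omega>)"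
    using zw by (simp add: o_def)
  have i1: "integrable M (\<lambda>\<omega>. X1 z \<omega> * cnj (X1 w \<omega>))"
    by (rule product_integrable[OF p1.Gamma_process_axioms z w])
  have eq: "(\<lambda>\<omega>. cnj (X2 z \<omega>) * X2 w \<omega>) = (\<lambda>\<omega>. cnj (X2 z \<omega> * cnj (X2 w \<omega>)))" by simp
  have i2: "integrable M (\<lambda>\<omega>. cnj (X2 z \<omega>) * X2 w \<omega>)"
    unfolding eq using product_integrable[OF p2.Gamma_process_axioms z w] by (simp only: integrable_cnj)
  show "integrable M (\<lambda>\<omega>. (X1 z \<omega> * cnj (X1 w \<omega>)) * (cnj (X2 z \<omega>) * X2 w \<omega>))"
    by (rule p1.indep_var_integrable[OF iv i1 i2])
  have "(\<integral>\<omega>. (X1 z \<omega> * cnj (X1 w \<omega>)) * (cnj (X2 z \<omega>) * X2 w \<omega>) \<partial>M) =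
     (\<integral>\<omega>. X1 z \<omega> * cnj (X1 w \<omega>) \<partial>M) * (\<integral>\<omega>. cnj (X2 z \<omega>) * X2 w \<omega> \<partial>M)"
    by (rule p1.indep_var_lebesgue_integral[OF iv i1 i2])
  also have "(\<integral>\<omega>. cnj (X2 z \<omega>) * X2 w \<omega> \<partial>M) = cnj (cov_kernel \<alpha> z w)"
    unfolding eq p2.covariance(2)[OF z w, symmetric]
    by (rule Bochner_Integration.integral_cnj)
  finally show "(\<integral>\<omega>. (X1 z \<omega> * cnj (X1 w \<omega>)) * (cnj (X2 z \<omega>) * X2 w \<omega>) \<partial>M) = complex_of_real ((norm (cov_kernel \<alpha> z w))\<^sup>2)"
    unfolding p1.covariance(2)[OF z w] by (simp add: complex_norm_square[symmetric])
qed

end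

text \<open>
  The processes are analytic only almost surely, and the set of exceptional \<open>\<omega>\<close> may fail to be
  measurable; so one measurable set \<open>G\<close> of good \<open>\<omega>\<close> is fixed.
\<close>

locale Gamma_pair_paths = Gamma_pair +
  fixes G
  assumes G[measurable]: "G \<in> sets M" and AE_G: "AE \<omega> in M. \<omega> \<in> G"
    and hol: "\<And>\<omega>. \<omega> \<in> G \<Longrightarrow> (\<lambda>z. X1 z \<omega>) holomorphic_on {z. 0 < Im z}"
      "\<And>\<omega>. \<omega> \<in> G \<Longrightarrow> (\<lambda>z. X2 z \<omega>) holomorphic_on {z. 0 < Im z}"
begin

text \<open>
  Setting the product to zero outside \<open>G\<close> makes all trajectories continuous on the half-plane, so that
  the product is jointly measurable.
\<close>

definition cross_density :: "complex \<Rightarrow> 'a \<Rightarrow> complex" where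
  "cross_density z \<omega> = (if \<omega> \<in> G \<and> 0 < Im z then X1 z \<omega> * cnj (X2 z \<omega>) else 0)"

lemma cross_density_measurable[measurable]: "(\<lambda>p. cross_density (fst p) (snd p)) \<in> borel_measurable (borel \<Otimes>\<^sub>M M)"
proof -
  have "(\<lambda>(z, \<omega>). cross_density z \<omega>) \<in> borel_measurable (borel \<Otimes>\<^sub>M M)"
  proof (rule jointly_measurable)
    fix z :: complex assume z: "0 < Im z"
    note [measurable] = measurable_cnj p1.X_measurable[OF z] p2.X_measurable[OF z]
    have "(\<lambda>\<omega>. if \<omega> \<in> G then X1 z \<omega> * cnj (X2 z \<omega>) else 0) \<in> borel_measurable M" by measurable
    then show "cross_density z \<in> borel_measurable M" using z by (simp add: cross_density_def[abs_def])
  next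
    fix \<omega>
    show "continuous_on {z. 0 < Im z} (\<lambda>z. cross_density z \<omega>)"
    proof (cases "\<omega> \<in> G")
      case True
      have "continuous_on {z. 0 < Im z} (\<lambda>z. X1 z \<omega> * cnj (X2 z \<omega>))"
        using hol[OF True] by (intro continuous_intros) (auto intro: holomorphic_on_imp_continuous_on)
      then show ?thesis
        by (rule continuous_on_eq) (simp add: cross_density_def True)
    qed (simp add: cross_density_def)
  qed (simp add: cross_density_def)
  then show ?thesis by (simp add: case_prod_unfold)
qed

lemma cross_density_compose_measurable[measurable (raw)]:
  "f \<in> borel_measurable N \<Longrightarrow> g \<in> measurable N M \<Longrightarrow> (\<lambda>x. cross_density (f x) (g x)) \<in> borel_measurable N"
  using measurable_compose[OF measurable_Pair cross_density_measurable, of f N g] by simp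

lemma cross_density_continuous:
  assumes "\<omega> \<in> G" "0 < y"
  shows "continuous_on S (\<lambda>x. cross_density (Complex x y) \<omega>)"
proof -
  have c: "continuous_on {z. 0 < Im z} (\<lambda>z. X1 z \<omega> * cnj (X2 z \<omega>))"
    using hol[OF assms(1)] by (intro continuous_intros) (auto intro: holomorphic_on_imp_continuous_on)
  have "continuous_on S (\<lambda>x. X1 (Complex x y) \<omega> * cnj (X2 (Complex x y) \<omega>))"
    by (rule continuous_on_compose2[OF c]) (use assms in \<open>auto simp: Complex_eq intro!: continuous_intros\<close>)
  then show ?thesis
    by (rule continuous_on_eq) (simp add: cross_density_def assms)
qed

lemma cross_density_AE: "0 < Im z \<Longrightarrow> AE \<omega> in M. cross_density z \<omega> = X1 z \<omega> * cnj (X2 z \<omega>)"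
  using AE_G by eventually_elim (simp add: cross_density_def)

lemma cross_density_covariance:
  assumes "0 < Im z" "0 < Im w"
  shows "integrable M (\<lambda>\<omega>. cross_density z \<omega> * cnj (cross_density w \<omega>))"
    "(\<integral>\<omega>. cross_density z \<omega> * cnj (cross_density w \<omega>) \<partial>M) = complex_of_real ((norm (cov_kernel \<alpha> z w))\<^sup>2)"
proof -
  note [measurable] = measurable_cnj p1.X_measurable[OF assms(1)] p2.X_measurable[OF assms(1)]
    p1.X_measurable[OF assms(2)] p2.X_measurable[OF assms(2)]
  have ae: "AE \<omega> in M. cross_density z \<omega> * cnj (cross_density w \<omega>) = (X1 z \<omega> * cnj (X1 w \<omega>)) * (cnj (X2 z \<omega>) * X2 w \<omega>)"
    using cross_density_AE[OF assms(1)] cross_density_AE[OF assms(2)] by eventually_elim simp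
  show "integrable M (\<lambda>\<omega>. cross_density z \<omega> * cnj (cross_density w \<omega>))"
    by (subst integrable_cong_AE[OF _ _ ae]) (use cross_covariance(1)[OF assms] in auto)
  show "(\<integral>\<omega>. cross_density z \<omega> * cnj (cross_density w \<omega>) \<partial>M) = complex_of_real ((norm (cov_kernel \<alpha> z w))\<^sup>2)"
    by (subst integral_cong_AE[OF _ _ ae]) (use cross_covariance(2)[OF assms] in auto)
qed

lemma norm_cov_kernel:
  assumes "0 < y"
  shows "norm (cov_kernel \<alpha> (Complex x y) (Complex x' y)) = \<bar>cov_const \<alpha>\<bar> * norm (Complex (x - x') (2 * y)) powr (2 * \<alpha> - 2)"
proof -
  have "Complex x y - cnj (Complex x' y) = Complex (x - x') (2 * y)" by (simp add: complex_eq_iff)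
  moreover have "Complex (x - x') (2 * y) \<noteq> 0" using assms by (simp add: complex_eq_iff)
  moreover from this have "norm ((- \<i> * Complex (x - x') (2 * y)) powr complex_of_real (2 * \<alpha> - 2)) =
      norm (Complex (x - x') (2 * y)) powr (2 * \<alpha> - 2)"
    by (subst norm_powr_of_real) (simp_all add: norm_mult)
  ultimately show ?thesis
    unfolding cov_kernel_def norm_mult by (simp only: norm_of_real)
qed

lemma cross_density_second_moment:
  assumes "0 < y"
  shows "(\<integral>\<^sup>+\<omega>. ennreal (norm (cross_density (Complex x y) \<omega> * cnj (cross_density (Complex x' y) \<omega>))) \<partial>M)
     \<le> ennreal (2 * (\<bar>cov_const \<alpha>\<bar> * (2 * y) powr (2 * \<alpha> - 2))\<^sup>2)"
proof -
  define B where "B = (\<bar>cov_const \<alpha>\<bar> * (2 * y) powr (2 * \<alpha> - 2))\<^sup>2"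
  have sq2: "sqrt (4 * y\<^sup>2) = 2 * y" using assms by (simp add: real_sqrt_mult)
  have sq: "(\<integral>\<^sup>+\<omega>. ennreal ((norm (cross_density (Complex x y) \<omega>))\<^sup>2) \<partial>M) = ennreal B" for x
  proof -
    have "complex_of_real (\<integral>\<omega>. (norm (cross_density (Complex x y) \<omega>))\<^sup>2 \<partial>M) = complex_of_real B"
      using cross_density_covariance(2)[of "Complex x y" "Complex x y"] assms
      unfolding norm_cov_kernel[OF assms] complex_norm_square[symmetric] integral_complex_of_real
      by (simp add: B_def complex_norm sq2)
    moreover have "integrable M (\<lambda>\<omega>. (norm (cross_density (Complex x y) \<omega>))\<^sup>2)"
      using cross_density_covariance(1)[of "Complex x y" "Complex x y"] assms
      unfolding complex_norm_square[symmetric] complex_of_real_integrable_eq by simp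
    ultimately show ?thesis by (subst nn_integral_eq_integral) auto
  qed
  have "(\<integral>\<^sup>+\<omega>. ennreal (norm (cross_density (Complex x y) \<omega> * cnj (cross_density (Complex x' y) \<omega>))) \<partial>M) \<le>
    (\<integral>\<^sup>+\<omega>. ennreal ((norm (cross_density (Complex x y) \<omega>))\<^sup>2) + ennreal ((norm (cross_density (Complex x' y) \<omega>))\<^sup>2) \<partial>M)"
  proof (intro nn_integral_mono)
    fix \<omega>
    have *: "a * b \<le> a\<^sup>2 + b\<^sup>2" if "0 \<le> a" "0 \<le> b" for a b :: real
      using sum_squares_bound[of a b] mult_nonneg_nonneg[OF that] by linarith
    have "norm (cross_density (Complex x y) \<omega> * cnj (cross_density (Complex x' y) \<omega>)) \<le> (norm (cross_density (Complex x y) \<omega>))\<^sup>2 + (norm (cross_density (Complex x' y) \<omega>))\<^sup>2"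
      using * by (simp add: norm_mult)
    then show "ennreal (norm (cross_density (Complex x y) \<omega> * cnj (cross_density (Complex x' y) \<omega>))) \<le>
       ennreal ((norm (cross_density (Complex x y) \<omega>))\<^sup>2) + ennreal ((norm (cross_density (Complex x' y) \<omega>))\<^sup>2)"
      by (simp add: ennreal_plus[symmetric] del: ennreal_plus)
  qed
  also have "\<dots> = ennreal B + ennreal B"
    by (subst nn_integral_add) (simp_all add: sq)
  also have "\<dots> = ennreal (2 * B)"
    by (simp add: B_def ennreal_plus[symmetric] del: ennreal_plus)
  finally show ?thesis by (simp add: B_def)
qed

definition cross_density_integral :: "real \<Rightarrow> real \<Rightarrow> real \<Rightarrow> 'a \<Rightarrow> complex" where
  "cross_density_integral y u v \<omega> = (\<integral>x. indicator {u..v} x *\<^sub>R cross_density (Complex x y) \<omega> \<partial>lborel)"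

text \<open>
  The squared modulus of the integral is a double integral, and the expectation is taken inside by
  Fubini's theorem; what remains is the covariance of the density.
\<close>

lemma cross_density_integral_second_moment:
  assumes y: "0 < y" and uv: "u \<le> v"
  shows "(\<integral>\<^sup>+\<omega>. ennreal ((norm (cross_density_integral y u v \<omega>))\<^sup>2) \<partial>M) =
    (\<integral>\<^sup>+x\<in>{u..v}. (\<integral>\<^sup>+x'\<in>{u..v}. ennreal ((norm (cov_kernel \<alpha> (Complex x y) (Complex x' y)))\<^sup>2) \<partial>lborel) \<partial>lborel)"
proof -
  note [measurable] = measurable_cnj
  define \<nu> where "\<nu> = density lborel (\<lambda>x. ennreal (indicator {u..v} x))"
  have [measurable_cong, simp]: "sets \<nu> = sets borel" by (simp add: \<nu>_def)
  have [simp]: "space \<nu> = UNIV" by (simp add: \<nu>_def)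
  have em: "emeasure \<nu> UNIV = ennreal (v - u)"
    using uv by (simp add: \<nu>_def emeasure_density ennreal_indicator)
  interpret N: finite_measure \<nu> by (rule finite_measureI) (simp add: em)
  interpret NN: pair_sigma_finite \<nu> \<nu> ..
  have finQ: "finite_measure (\<nu> \<Otimes>\<^sub>M \<nu>)"
    by (rule finite_measureI) (simp add: space_pair_measure N.emeasure_pair_measure_Times em ennreal_mult_eq_top_iff flip: UNIV_Times_UNIV)
  interpret Q: finite_measure "\<nu> \<Otimes>\<^sub>M \<nu>" by (rule finQ)
  interpret P: pair_sigma_finite M "\<nu> \<Otimes>\<^sub>M \<nu>" ..
  define B where "B = 2 * (\<bar>cov_const \<alpha>\<bar> * (2 * y) powr (2 * \<alpha> - 2))\<^sup>2"
  \<comment> \<open>Clamping \<open>x\<close> to \<open>[u, v]\<close> makes each trajectory bounded on the whole line, so that Fubini's theorem applies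
    to the finite measure \<open>\<nu>\<close>, the restriction of Lebesgue measure to \<open>[u, v]\<close>.\<close>
  define V where "V = (\<lambda>x \<omega>. cross_density (Complex (max u (min v x)) y) \<omega>)"
  have [measurable]: "(\<lambda>x. Complex (f x) y) \<in> borel_measurable N" if "f \<in> borel_measurable N" for f and N :: "'z measure"
    unfolding Complex_eq using that by measurable
  have Vm[measurable]: "(\<lambda>p. V (f p) (g p)) \<in> borel_measurable N"
    if [measurable]: "f \<in> borel_measurable N" "g \<in> measurable N M" for f g and N :: "'z measure"
    unfolding V_def Complex_eq by measurable
  define h where "h = (\<lambda>\<omega> q. V (fst q) \<omega> * cnj (V (snd q) \<omega>))"
  have hm[measurable]: "case_prod h \<in> borel_measurable (M \<Otimes>\<^sub>M (\<nu> \<Otimes>\<^sub>M \<nu>))"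
    unfolding h_def case_prod_unfold by (intro borel_measurable_times measurable_compose[OF _ measurable_cnj] Vm) measurable
  have int: "integrable (M \<Otimes>\<^sub>M (\<nu> \<Otimes>\<^sub>M \<nu>)) (case_prod h)"
  proof (rule integrableI_bounded)
    have "(\<integral>\<^sup>+x. ennreal (norm (case x of (x, xa) \<Rightarrow> h x xa)) \<partial>(M \<Otimes>\<^sub>M (\<nu> \<Otimes>\<^sub>M \<nu>))) =
      (\<integral>\<^sup>+q. (\<integral>\<^sup>+\<omega>. ennreal (norm (h \<omega> q)) \<partial>M) \<partial>(\<nu> \<Otimes>\<^sub>M \<nu>))"
      by (subst P.nn_integral_snd[symmetric]) auto
    also have "\<dots> \<le> (\<integral>\<^sup>+q. ennreal B \<partial>(\<nu> \<Otimes>\<^sub>M \<nu>))"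
      unfolding h_def V_def B_def by (intro nn_integral_mono cross_density_second_moment y)
    also have "\<dots> < \<infinity>"
    proof -
      have "emeasure (\<nu> \<Otimes>\<^sub>M \<nu>) (space (\<nu> \<Otimes>\<^sub>M \<nu>)) < \<infinity>"
        using Q.emeasure_finite[of "space (\<nu> \<Otimes>\<^sub>M \<nu>)"] by (simp add: less_top[symmetric])
      then show ?thesis by (simp add: ennreal_mult_less_top)
    qed
    finally show "(\<integral>\<^sup>+x. ennreal (norm (case x of (x, xa) \<Rightarrow> h x xa)) \<partial>(M \<Otimes>\<^sub>M (\<nu> \<Otimes>\<^sub>M \<nu>))) < \<infinity>" .
  qed (rule hm)
  have DV: "cross_density_integral y u v \<omega> = (\<integral>x. V x \<omega> \<partial>\<nu>)" if "\<omega> \<in> space M" for \<omega>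
  proof -
    have "(\<integral>x. V x \<omega> \<partial>\<nu>) = (\<integral>x. indicator {u..v} x *\<^sub>R V x \<omega> \<partial>lborel)"
      unfolding \<nu>_def using that by (intro integral_density) auto
    also have "\<dots> = cross_density_integral y u v \<omega>"
      unfolding cross_density_integral_def by (intro Bochner_Integration.integral_cong) (auto simp: V_def indicator_def max_def min_def)
    finally show ?thesis ..
  qed
  have bounded: "\<exists>b. \<forall>x. norm (V x \<omega>) \<le> b" for \<omega>
  proof (cases "\<omega> \<in> G")
    case True
    have "bounded ((\<lambda>x. cross_density (Complex x y) \<omega>) ` {u..v})"
      by (intro compact_imp_bounded compact_continuous_image cross_density_continuous True y) simp
    then obtain b where b: "\<And>x. x \<in> {u..v} \<Longrightarrow> norm (cross_density (Complex x y) \<omega>) \<le> b" by (meson bounded_iff imageI)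
    show ?thesis using uv by (intro exI[of _ b] allI) (auto simp: V_def intro!: b)
  qed (auto simp: V_def cross_density_def intro!: exI[of _ 0])
  have inner: "(\<integral>q. h \<omega> q \<partial>(\<nu> \<Otimes>\<^sub>M \<nu>)) = complex_of_real ((norm (cross_density_integral y u v \<omega>))\<^sup>2)" if \<omega>: "\<omega> \<in> space M" for \<omega>
  proof -
    obtain b where b: "\<And>x. norm (V x \<omega>) \<le> b" using bounded by blast
    have b0: "0 \<le> b" using b[of 0] norm_ge_zero order.trans by blast
    have ih: "integrable (\<nu> \<Otimes>\<^sub>M \<nu>) (h \<omega>)"
    proof (rule Q.integrable_const_bound)
      show "AE q in \<nu> \<Otimes>\<^sub>M \<nu>. norm (h \<omega> q) \<le> b * b"
        using b b0 by (auto simp: h_def norm_mult intro!: mult_mono)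
      show "h \<omega> \<in> borel_measurable (\<nu> \<Otimes>\<^sub>M \<nu>)"
        unfolding h_def using \<omega> by (intro borel_measurable_times measurable_compose[OF _ measurable_cnj] Vm) auto
    qed
    have "(\<integral>q. h \<omega> q \<partial>(\<nu> \<Otimes>\<^sub>M \<nu>)) = (\<integral>x. (\<integral>x'. h \<omega> (x, x') \<partial>\<nu>) \<partial>\<nu>)"
      using NN.integral_fst'[OF ih] by simp
    also have "\<dots> = (\<integral>x. V x \<omega> * cnj (cross_density_integral y u v \<omega>) \<partial>\<nu>)"
      by (simp add: h_def DV[OF \<omega>])
    also have "\<dots> = cross_density_integral y u v \<omega> * cnj (cross_density_integral y u v \<omega>)"
      by (simp add: DV[OF \<omega>])
    finally show ?thesis by (simp only: complex_norm_square)
  qed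
  let ?k = "\<lambda>q. (norm (cov_kernel \<alpha> (Complex (max u (min v (fst q))) y) (Complex (max u (min v (snd q))) y)))\<^sup>2"
  have outer: "(\<integral>\<omega>. h \<omega> q \<partial>M) = complex_of_real (?k q)" for q
    unfolding h_def V_def using y by (intro cross_density_covariance) auto
  have eq: "complex_of_real (\<integral>\<omega>. (norm (cross_density_integral y u v \<omega>))\<^sup>2 \<partial>M) = complex_of_real (\<integral>q. ?k q \<partial>(\<nu> \<Otimes>\<^sub>M \<nu>))"
  proof -
    have "complex_of_real (\<integral>\<omega>. (norm (cross_density_integral y u v \<omega>))\<^sup>2 \<partial>M) = (\<integral>\<omega>. (\<integral>q. h \<omega> q \<partial>(\<nu> \<Otimes>\<^sub>M \<nu>)) \<partial>M)"
      by (subst integral_complex_of_real[symmetric], intro Bochner_Integration.integral_cong) (simp_all add: inner)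
    also have "\<dots> = (\<integral>q. (\<integral>\<omega>. h \<omega> q \<partial>M) \<partial>(\<nu> \<Otimes>\<^sub>M \<nu>))"
      by (rule P.Fubini_integral[OF int, symmetric])
    also have "\<dots> = complex_of_real (\<integral>q. ?k q \<partial>(\<nu> \<Otimes>\<^sub>M \<nu>))"
      unfolding outer by (rule integral_complex_of_real)
    finally show ?thesis .
  qed
  have iD: "integrable M (\<lambda>\<omega>. (norm (cross_density_integral y u v \<omega>))\<^sup>2)"
  proof -
    have "integrable M (\<lambda>\<omega>. \<integral>q. h \<omega> q \<partial>(\<nu> \<Otimes>\<^sub>M \<nu>))" by (rule P.integrable_fst[OF int])
    then have "integrable M (\<lambda>\<omega>. complex_of_real ((norm (cross_density_integral y u v \<omega>))\<^sup>2))"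
      by (subst (asm) Bochner_Integration.integrable_cong[OF refl inner])
    then show ?thesis unfolding complex_of_real_integrable_eq .
  qed
  have ik: "integrable (\<nu> \<Otimes>\<^sub>M \<nu>) ?k"
    using P.integrable_snd[OF int] unfolding outer complex_of_real_integrable_eq .
  have km[measurable]: "(\<lambda>q. ennreal (?k q)) \<in> borel_measurable (\<nu> \<Otimes>\<^sub>M \<nu>)"
    using ik by simp
  have "(\<integral>\<^sup>+\<omega>. ennreal ((norm (cross_density_integral y u v \<omega>))\<^sup>2) \<partial>M) = (\<integral>\<^sup>+q. ennreal (?k q) \<partial>(\<nu> \<Otimes>\<^sub>M \<nu>))"
    using eq iD ik by (simp add: nn_integral_eq_integral)
  also have "\<dots> = (\<integral>\<^sup>+x. (\<integral>\<^sup>+x'. ennreal (?k (x, x')) \<partial>\<nu>) \<partial>\<nu>)"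
    by (rule N.nn_integral_fst[symmetric]) (rule km)
  also have "\<dots> = (\<integral>\<^sup>+x\<in>{u..v}. (\<integral>\<^sup>+x'\<in>{u..v}. ennreal (?k (x, x')) \<partial>lborel) \<partial>lborel)"
  proof -
    have k2: "(\<lambda>x'. ennreal (?k (x, x'))) \<in> borel_measurable borel" for x
      using measurable_compose[OF measurable_Pair1' km, of x] by simp
    have k1: "(\<lambda>x. \<integral>\<^sup>+x'. ennreal (?k (x, x')) \<partial>\<nu>) \<in> borel_measurable borel"
      using N.borel_measurable_nn_integral_fst[OF km] by simp
    have in_eq: "(\<integral>\<^sup>+x'. ennreal (?k (x, x')) \<partial>\<nu>) = (\<integral>\<^sup>+x'\<in>{u..v}. ennreal (?k (x, x')) \<partial>lborel)" for x
      unfolding \<nu>_def using k2 by (subst nn_integral_density) (auto intro!: nn_integral_cong simp: indicator_def)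
    have "(\<integral>\<^sup>+x. (\<integral>\<^sup>+x'. ennreal (?k (x, x')) \<partial>\<nu>) \<partial>\<nu>) = (\<integral>\<^sup>+x\<in>{u..v}. (\<integral>\<^sup>+x'. ennreal (?k (x, x')) \<partial>\<nu>) \<partial>lborel)"
      using k1 by (subst (1) \<nu>_def, subst nn_integral_density) (auto intro!: nn_integral_cong simp: indicator_def)
    then show ?thesis unfolding in_eq .
  qed
  also have "\<dots> = (\<integral>\<^sup>+x\<in>{u..v}. (\<integral>\<^sup>+x'\<in>{u..v}. ennreal ((norm (cov_kernel \<alpha> (Complex x y) (Complex x' y)))\<^sup>2) \<partial>lborel) \<partial>lborel)"
    by (intro nn_integral_cong) (auto simp: indicator_def max_def min_def intro!: nn_integral_cong)
  finally show ?thesis .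
qed

end

lemma nn_integral_abs_powr_le:
  fixes x u v e :: real
  assumes e: "- 1 < e" and x: "u \<le> x" "x \<le> v"
  shows "(\<integral>\<^sup>+x'\<in>{u..v}. ennreal (\<bar>x - x'\<bar> powr e) \<partial>lborel) \<le> ennreal (2 / (e + 1) * (v - u) powr (e + 1))"
proof -
  define R where "R = v - u"
  have R: "0 \<le> R" using x by (simp add: R_def)
  define g where "g = (\<lambda>w. ennreal (w powr e) * indicator {0<..R} w)"
  have [measurable]: "g \<in> borel_measurable borel" unfolding g_def by measurable
  have g: "(\<integral>\<^sup>+w. g w \<partial>lborel) = ennreal (R powr (e + 1) / (e + 1))"
    unfolding g_def by (rule nn_integral_powr_0[OF e R])
  have g1: "(\<integral>\<^sup>+x'. g (x' - x) \<partial>lborel) = (\<integral>\<^sup>+w. g w \<partial>lborel)"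
    using nn_integral_real_affine[of "\<lambda>x'. g (x' - x)" 1 x] by simp
  have g2: "(\<integral>\<^sup>+x'. g (x - x') \<partial>lborel) = (\<integral>\<^sup>+w. g w \<partial>lborel)"
    using nn_integral_real_affine[of "\<lambda>x'. g (x - x')" "- 1" x] by simp
  have "(\<integral>\<^sup>+x'\<in>{u..v}. ennreal (\<bar>x - x'\<bar> powr e) \<partial>lborel) \<le> (\<integral>\<^sup>+x'. g (x' - x) + g (x - x') \<partial>lborel)"
    using x by (intro nn_integral_mono) (auto simp: g_def R_def indicator_def abs_if)
  also have "\<dots> = ennreal (R powr (e + 1) / (e + 1)) + ennreal (R powr (e + 1) / (e + 1))"
    by (subst nn_integral_add) (simp_all add: g1 g2 g)
  also have "\<dots> = ennreal (2 / (e + 1) * R powr (e + 1))"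
    using e by (subst ennreal_plus[symmetric]) auto
  finally show ?thesis by (simp add: R_def)
qed

context Gamma_pair_paths
begin

text \<open>
  The modulus of \<open>x - x' + 2 * \<i> * y\<close> is at least \<open>\<bar>x - x'\<bar>\<close> and at least \<open>y\<close>. The negative exponent
  \<open>4 * \<alpha> - 4\<close> is split between the two so that the power of \<open>\<bar>x - x'\<bar>\<close> is still integrable.
\<close>

lemma cov_kernel_square_le:
  assumes y: "0 < y" and \<tau>: "\<tau> \<le> 1" "4 * \<alpha> \<le> 3 + \<tau>" and x: "x \<noteq> x'"
  shows "(norm (cov_kernel \<alpha> (Complex x y) (Complex x' y)))\<^sup>2 \<le>
    (cov_const \<alpha>)\<^sup>2 * y powr (4 * \<alpha> - 3 - \<tau>) * \<bar>x - x'\<bar> powr (\<tau> - 1)"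
proof -
  define r where "r = norm (Complex (x - x') (2 * y))"
  have r: "\<bar>x - x'\<bar> \<le> r" "y \<le> r" "0 < r"
    using abs_Re_le_cmod[of "Complex (x - x') (2 * y)"] abs_Im_le_cmod[of "Complex (x - x') (2 * y)"] y
    by (auto simp: r_def)
  have "(norm (cov_kernel \<alpha> (Complex x y) (Complex x' y)))\<^sup>2 = (cov_const \<alpha>)\<^sup>2 * r powr (4 * \<alpha> - 3 - \<tau>) * r powr (\<tau> - 1)"
  proof -
    have "(r powr (2 * \<alpha> - 2))\<^sup>2 = r powr (4 * \<alpha> - 3 - \<tau>) * r powr (\<tau> - 1)"
      by (simp add: power2_eq_square powr_add[symmetric])
    then show ?thesis
      unfolding norm_cov_kernel[OF y] r_def[symmetric] by (simp add: power_mult_distrib mult.assoc)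
  qed
  also have "\<dots> \<le> (cov_const \<alpha>)\<^sup>2 * y powr (4 * \<alpha> - 3 - \<tau>) * \<bar>x - x'\<bar> powr (\<tau> - 1)"
    using r y \<tau> x by (intro mult_mono powr_mono2') auto
  finally show ?thesis .
qed

lemma cross_density_integral_moment_bound:
  assumes y: "0 < y" and uv: "u \<le> v" and \<tau>: "0 < \<tau>" "\<tau> \<le> 1" "4 * \<alpha> \<le> 3 + \<tau>"
  shows "(\<integral>\<^sup>+\<omega>. ennreal ((norm (cross_density_integral y u v \<omega>))\<^sup>2) \<partial>M) \<le>
    ennreal ((cov_const \<alpha>)\<^sup>2 * (2 / \<tau>) * (y powr (4 * \<alpha> - 3 - \<tau>) * (v - u) powr (1 + \<tau>)))"
proof -
  define A where "A = (cov_const \<alpha>)\<^sup>2 * y powr (4 * \<alpha> - 3 - \<tau>)"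
  have A: "0 \<le> A" by (simp add: A_def)
  define B where "B = A * (2 / \<tau> * (v - u) powr \<tau>)"
  have B: "0 \<le> B" using A \<tau> by (simp add: B_def)
  have "(\<integral>\<^sup>+\<omega>. ennreal ((norm (cross_density_integral y u v \<omega>))\<^sup>2) \<partial>M) =
    (\<integral>\<^sup>+x\<in>{u..v}. (\<integral>\<^sup>+x'\<in>{u..v}. ennreal ((norm (cov_kernel \<alpha> (Complex x y) (Complex x' y)))\<^sup>2) \<partial>lborel) \<partial>lborel)"
    by (rule cross_density_integral_second_moment[OF y uv])
  also have "\<dots> \<le> (\<integral>\<^sup>+x\<in>{u..v}. ennreal B \<partial>lborel)"
  proof (intro nn_integral_mono)
    fix x
    have "(\<integral>\<^sup>+x'\<in>{u..v}. ennreal ((norm (cov_kernel \<alpha> (Complex x y) (Complex x' y)))\<^sup>2) \<partial>lborel) \<le> ennreal B"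
      if x: "x \<in> {u..v}"
    proof -
      have "(\<integral>\<^sup>+x'\<in>{u..v}. ennreal ((norm (cov_kernel \<alpha> (Complex x y) (Complex x' y)))\<^sup>2) \<partial>lborel) \<le>
        (\<integral>\<^sup>+x'. ennreal A * (ennreal (\<bar>x - x'\<bar> powr (\<tau> - 1)) * indicator {u..v} x') \<partial>lborel)"
      proof (rule nn_integral_mono_AE)
        show "AE x' in lborel. ennreal ((norm (cov_kernel \<alpha> (Complex x y) (Complex x' y)))\<^sup>2) * indicator {u..v} x' \<le>
            ennreal A * (ennreal (\<bar>x - x'\<bar> powr (\<tau> - 1)) * indicator {u..v} x')"
          using AE_lborel_singleton[of x]
        proof eventually_elim
          case (elim x')
          have "ennreal ((norm (cov_kernel \<alpha> (Complex x y) (Complex x' y)))\<^sup>2) \<le> ennreal A * ennreal (\<bar>x - x'\<bar> powr (\<tau> - 1))"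
            using cov_kernel_square_le[OF y \<tau>(2,3), of x x'] elim A
            by (simp add: ennreal_mult'[symmetric] A_def ennreal_leI)
          then show ?case by (auto simp: indicator_def)
        qed
      qed
      also have "\<dots> = ennreal A * (\<integral>\<^sup>+x'\<in>{u..v}. ennreal (\<bar>x - x'\<bar> powr (\<tau> - 1)) \<partial>lborel)"
        by (rule nn_integral_cmult) measurable
      also have "\<dots> \<le> ennreal A * ennreal (2 / \<tau> * (v - u) powr \<tau>)"
        using nn_integral_abs_powr_le[of "\<tau> - 1" u x v] \<tau> x by (intro mult_left_mono) auto
      also have "\<dots> = ennreal B" using A by (simp add: B_def ennreal_mult'[symmetric])
      finally show ?thesis .
    qed
    then show "(\<integral>\<^sup>+x'\<in>{u..v}. ennreal ((norm (cov_kernel \<alpha> (Complex x y) (Complex x' y)))\<^sup>2) \<partial>lborel) * indicator {u..v} x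
        \<le> ennreal B * indicator {u..v} x" by (auto simp: indicator_def)
  qed
  also have "\<dots> = ennreal (B * (v - u))"
    using uv B by (simp add: nn_integral_cmult ennreal_mult'[symmetric])
  also have "B * (v - u) = (cov_const \<alpha>)\<^sup>2 * (2 / \<tau>) * (y powr (4 * \<alpha> - 3 - \<tau>) * (v - u) powr (1 + \<tau>))"
    using uv by (simp add: B_def A_def powr_add mult_ac)
  finally show ?thesis .
qed

text \<open>
  A primitive in \<open>u\<close> of the integrand of the cross term at height \<open>y\<close>, with values also outside \<open>G\<close>.
\<close>

definition cross_primitive :: "real \<Rightarrow> 'a \<Rightarrow> real \<Rightarrow> real \<Rightarrow> real" where
  "cross_primitive N \<omega> y u = (\<integral>x. (if - N \<le> x \<and> x \<le> u then 4 * Im (cross_density (Complex x y) \<omega>) else 0) \<partial>lborel)"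

lemma cross_primitive_measurable[measurable (raw)]:
  assumes [measurable]: "f \<in> borel_measurable L" "g \<in> borel_measurable L" "h \<in> measurable L M"
  shows "(\<lambda>p. cross_primitive N (h p) (f p) (g p)) \<in> borel_measurable L"
  unfolding cross_primitive_def Complex_eq by measurable

lemma cross_primitive_eq:
  assumes "\<omega> \<in> G" "0 < y"
  shows "cross_primitive N \<omega> y u = integral {- N..u} (\<lambda>x. 4 * Im (cross_density (Complex x y) \<omega>))"
proof -
  have i: "set_integrable lborel {- N..u} (\<lambda>x. 4 * Im (cross_density (Complex x y) \<omega>))"
    using cross_density_continuous[OF assms] by (intro borel_integrable_atLeastAtMost' continuous_intros)
  have "cross_primitive N \<omega> y u = (LINT x:{- N..u}|lborel. 4 * Im (cross_density (Complex x y) \<omega>))"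
    unfolding cross_primitive_def set_lebesgue_integral_def
    by (intro Bochner_Integration.integral_cong) (auto simp: indicator_def)
  also have "\<dots> = integral {- N..u} (\<lambda>x. 4 * Im (cross_density (Complex x y) \<omega>))"
    using i by (rule set_borel_integral_eq_integral)
  finally show ?thesis .
qed

lemma cross_density_integrable:
  assumes "\<omega> \<in> G" "0 < y"
  shows "(\<lambda>x. 4 * Im (cross_density (Complex x y) \<omega>)) integrable_on {u..v}"
  using cross_density_continuous[OF assms] by (intro integrable_continuous_real continuous_intros)

lemma cross_primitive_diff:
  assumes "\<omega> \<in> G" "0 < y" "- N \<le> u" "u \<le> v"
  shows "cross_primitive N \<omega> y v - cross_primitive N \<omega> y u = integral {u..v} (\<lambda>x. 4 * Im (cross_density (Complex x y) \<omega>))"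
  using Henstock_Kurzweil_Integration.integral_combine[OF assms(3,4) cross_density_integrable[OF assms(1,2)]]
  unfolding cross_primitive_eq[OF assms(1,2)] by simp

lemma cross_primitive_diff_cross:
  assumes "\<omega> \<in> G" "0 < y" "- N \<le> u" "u \<le> v"
  shows "cross_primitive N \<omega> y v - cross_primitive N \<omega> y u = cross_integral (\<lambda>z. X1 z \<omega>) (\<lambda>z. X2 z \<omega>) y u v"
  unfolding cross_primitive_diff[OF assms] cross_integral_def using assms by (simp add: cross_density_def)

lemma cross_primitive_diff_D:
  assumes "\<omega> \<in> G" "0 < y" "- N \<le> u" "u \<le> v"
  shows "(cross_primitive N \<omega> y v - cross_primitive N \<omega> y u)\<^sup>2 \<le> 16 * (norm (cross_density_integral y u v \<omega>))\<^sup>2"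
proof -
  have i: "set_integrable lborel {u..v} (\<lambda>x. cross_density (Complex x y) \<omega>)"
    using cross_density_continuous[OF assms(1,2)] by (rule borel_integrable_atLeastAtMost')
  have "cross_density_integral y u v \<omega> = integral {u..v} (\<lambda>x. cross_density (Complex x y) \<omega>)"
    using set_borel_integral_eq_integral(2)[OF i] by (simp add: cross_density_integral_def set_lebesgue_integral_def)
  moreover have "((\<lambda>x. cross_density (Complex x y) \<omega>) has_integral integral {u..v} (\<lambda>x. cross_density (Complex x y) \<omega>)) {u..v}"
    using cross_density_continuous[OF assms(1,2)] by (intro integrable_integral integrable_continuous_real)
  ultimately have "((\<lambda>x. cross_density (Complex x y) \<omega>) has_integral cross_density_integral y u v \<omega>) {u..v}" by simp
  from has_integral_linear[OF this bounded_linear_Im]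
  have "((\<lambda>x. Im (cross_density (Complex x y) \<omega>)) has_integral Im (cross_density_integral y u v \<omega>)) {u..v}" by (simp add: o_def)
  then have "((\<lambda>x. 4 * Im (cross_density (Complex x y) \<omega>)) has_integral 4 * Im (cross_density_integral y u v \<omega>)) {u..v}"
    by (rule has_integral_mult_right)
  then have "cross_primitive N \<omega> y v - cross_primitive N \<omega> y u = 4 * Im (cross_density_integral y u v \<omega>)"
    unfolding cross_primitive_diff[OF assms] by (rule integral_unique)
  moreover have "(Im (cross_density_integral y u v \<omega>))\<^sup>2 \<le> (norm (cross_density_integral y u v \<omega>))\<^sup>2"
    by (simp add: cmod_power2)
  ultimately show ?thesis by (simp add: power_mult_distrib)
qed

lemma cross_primitive_moment:
  assumes y: "0 < y" and uv: "- N \<le> u" "- N \<le> v" and \<tau>: "0 < \<tau>" "\<tau> \<le> 1" "4 * \<alpha> \<le> 3 + \<tau>"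
  shows "(\<integral>\<^sup>+\<omega>. ennreal ((cross_primitive N \<omega> y u - cross_primitive N \<omega> y v)\<^sup>2) \<partial>M) \<le>
    ennreal (16 * ((cov_const \<alpha>)\<^sup>2 * (2 / \<tau>)) * (y powr (4 * \<alpha> - 3 - \<tau>) * \<bar>u - v\<bar> powr (1 + \<tau>)))"
proof -
  have *: "(\<integral>\<^sup>+\<omega>. ennreal ((cross_primitive N \<omega> y v - cross_primitive N \<omega> y u)\<^sup>2) \<partial>M) \<le>
    ennreal (16 * ((cov_const \<alpha>)\<^sup>2 * (2 / \<tau>)) * (y powr (4 * \<alpha> - 3 - \<tau>) * (v - u) powr (1 + \<tau>)))"
    if uv: "- N \<le> u" "u \<le> v" for u v
  proof -
    have [measurable]: "(\<lambda>\<omega>. cross_density_integral y u v \<omega>) \<in> borel_measurable M"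
      unfolding cross_density_integral_def Complex_eq by measurable
    have "(\<integral>\<^sup>+\<omega>. ennreal ((cross_primitive N \<omega> y v - cross_primitive N \<omega> y u)\<^sup>2) \<partial>M) \<le> (\<integral>\<^sup>+\<omega>. ennreal 16 * ennreal ((norm (cross_density_integral y u v \<omega>))\<^sup>2) \<partial>M)"
    proof (rule nn_integral_mono_AE)
      show "AE \<omega> in M. ennreal ((cross_primitive N \<omega> y v - cross_primitive N \<omega> y u)\<^sup>2) \<le> ennreal 16 * ennreal ((norm (cross_density_integral y u v \<omega>))\<^sup>2)"
        using AE_G
      proof eventually_elim
        case (elim \<omega>)
        have "ennreal ((cross_primitive N \<omega> y v - cross_primitive N \<omega> y u)\<^sup>2) \<le> ennreal (16 * (norm (cross_density_integral y u v \<omega>))\<^sup>2)"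
          by (intro ennreal_leI cross_primitive_diff_D elim y uv)
        then show ?case by (simp add: ennreal_mult')
      qed
    qed
    also have "\<dots> = ennreal 16 * (\<integral>\<^sup>+\<omega>. ennreal ((norm (cross_density_integral y u v \<omega>))\<^sup>2) \<partial>M)"
      by (rule nn_integral_cmult) measurable
    also have "\<dots> \<le> ennreal 16 * ennreal ((cov_const \<alpha>)\<^sup>2 * (2 / \<tau>) * (y powr (4 * \<alpha> - 3 - \<tau>) * (v - u) powr (1 + \<tau>)))"
      by (intro mult_left_mono cross_density_integral_moment_bound y uv \<tau>) simp
    also have "\<dots> = ennreal (16 * ((cov_const \<alpha>)\<^sup>2 * (2 / \<tau>) * (y powr (4 * \<alpha> - 3 - \<tau>) * (v - u) powr (1 + \<tau>))))"
      by (rule ennreal_mult'[symmetric]) simp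
    finally show ?thesis by (simp only: mult.assoc)
  qed
  show ?thesis
  proof (cases "u \<le> v")
    case True
    then show ?thesis using *[of u v] uv by (simp add: power2_commute abs_minus_commute)
  next
    case False
    then show ?thesis using *[of v u] uv by simp
  qed
qed

text \<open>
  The expected kernel is a product of a power of \<open>y\<close> and a power of \<open>\<bar>u - v\<bar>\<close>. The conditions
  on \<open>\<tau> + \<eta>\<close> and on \<open>2 * \<delta>\<close> say that both exponents exceed \<open>- 1\<close>; for \<open>\<delta> > 1 / 2\<close> and \<open>\<eta> > 0\<close> they are
  compatible only if \<open>4 * \<alpha> > 1\<close>.
\<close>

lemma control_finite_AE:
  assumes \<tau>: "0 < \<tau>" "\<tau> \<le> 1" "4 * \<alpha> \<le> 3 + \<tau>" "\<tau> + \<eta> < 4 * \<alpha> - 1" and \<delta>: "2 * \<delta> < 1 + \<tau>" and R: "0 \<le> R" and N: "0 \<le> N"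
  shows "AE \<omega> in M. control \<delta> \<eta> R (cross_primitive N \<omega>) (- N) N < \<infinity>"
proof -
  let ?L = "lborel \<Otimes>\<^sub>M (lborel \<Otimes>\<^sub>M lborel) :: (real \<times> real \<times> real) measure"
  define C where "C = 16 * ((cov_const \<alpha>)\<^sup>2 * (2 / \<tau>))"
  have C: "0 \<le> C" using \<tau> by (simp add: C_def)
  define a where "a = 1 - \<eta> + (4 * \<alpha> - 3 - \<tau>)"
  have a: "- 1 < a" using \<tau> by (simp add: a_def)
  define b where "b = \<tau> - 2 * \<delta>"
  have b: "- 1 < b" using \<delta> by (simp add: b_def)
  define k where "k = (\<lambda>\<omega> p. control_kernel \<delta> \<eta> R (cross_primitive N \<omega>) p * indicator ({- N..N} \<times> {- N..N}) (snd p))"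
  have km[measurable]: "(\<lambda>(\<omega>, p). k \<omega> p) \<in> borel_measurable (M \<Otimes>\<^sub>M ?L)"
    unfolding k_def control_kernel_def case_prod_unfold by measurable
  interpret P: pair_sigma_finite M ?L
    unfolding lborel_prod by unfold_locales
  define J where "J = (\<lambda>y. ennreal (y powr a) * indicator {0<..R} y)"
  define I where "I = (\<lambda>u v. ennreal (\<bar>u - v\<bar> powr b) * indicator {- N..N} v * indicator {- N..N} u)"
  have [measurable]: "J \<in> borel_measurable borel" unfolding J_def by measurable
  have [measurable]: "(\<lambda>p. I (fst p) (snd p)) \<in> borel_measurable (borel \<Otimes>\<^sub>M borel)" unfolding I_def by measurable
  have kD: "control \<delta> \<eta> R (cross_primitive N \<omega>) (- N) N = (\<integral>\<^sup>+p. k \<omega> p \<partial>?L)" for \<omega>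
    by (simp add: control_def k_def)
  have kb: "(\<integral>\<^sup>+\<omega>. k \<omega> (y, u, v) \<partial>M) \<le> ennreal C * (J y * I u v)" for y u v
  proof (cases "0 < y \<and> y \<le> R \<and> u \<in> {- N..N} \<and> v \<in> {- N..N} \<and> u \<noteq> v")
    case True
    define w where "w = y powr (1 - \<eta>) / \<bar>u - v\<bar> powr (2 * \<delta> + 1)"
    have w: "0 \<le> w" by (simp add: w_def)
    have "(\<integral>\<^sup>+\<omega>. k \<omega> (y, u, v) \<partial>M) = (\<integral>\<^sup>+\<omega>. ennreal w * ennreal ((cross_primitive N \<omega> y u - cross_primitive N \<omega> y v)\<^sup>2) \<partial>M)"
      using True by (intro nn_integral_cong) (simp add: k_def control_kernel_def w_def ennreal_mult'[symmetric])
    also have "\<dots> = ennreal w * (\<integral>\<^sup>+\<omega>. ennreal ((cross_primitive N \<omega> y u - cross_primitive N \<omega> y v)\<^sup>2) \<partial>M)"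
      by (rule nn_integral_cmult) measurable
    also have "\<dots> \<le> ennreal w * ennreal (C * (y powr (4 * \<alpha> - 3 - \<tau>) * \<bar>u - v\<bar> powr (1 + \<tau>)))"
      unfolding C_def using True by (intro mult_left_mono cross_primitive_moment \<tau>) auto
    also have "\<dots> = ennreal (w * (C * (y powr (4 * \<alpha> - 3 - \<tau>) * \<bar>u - v\<bar> powr (1 + \<tau>))))"
      using w by (simp add: ennreal_mult')
    also have "w * (C * (y powr (4 * \<alpha> - 3 - \<tau>) * \<bar>u - v\<bar> powr (1 + \<tau>))) = C * (y powr a * \<bar>u - v\<bar> powr b)"
    proof -
      have "y powr a = y powr (1 - \<eta>) * y powr (4 * \<alpha> - 3 - \<tau>)" unfolding a_def by (rule powr_add)
      moreover have "\<bar>u - v\<bar> powr b = \<bar>u - v\<bar> powr (1 + \<tau>) / \<bar>u - v\<bar> powr (2 * \<delta> + 1)"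
        by (simp add: b_def powr_diff[symmetric])
      ultimately show ?thesis by (simp add: w_def)
    qed
    also have "ennreal \<dots> = ennreal C * (J y * I u v)"
      using True C by (simp add: J_def I_def ennreal_mult'[symmetric])
    finally show ?thesis .
  next
    case False
    have "k \<omega> (y, u, v) = 0" for \<omega>
      using False by (auto simp: k_def control_kernel_def indicator_def)
    then show ?thesis by simp
  qed
  have "(\<integral>\<^sup>+\<omega>. control \<delta> \<eta> R (cross_primitive N \<omega>) (- N) N \<partial>M) = (\<integral>\<^sup>+p. (\<integral>\<^sup>+\<omega>. k \<omega> p \<partial>M) \<partial>?L)"
    unfolding kD by (rule P.Fubini'[symmetric]) (rule km)
  also have "\<dots> \<le> (\<integral>\<^sup>+p. ennreal C * (J (fst p) * I (fst (snd p)) (snd (snd p))) \<partial>?L)"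
  proof (rule nn_integral_mono)
    fix p :: "real \<times> real \<times> real"
    show "(\<integral>\<^sup>+\<omega>. k \<omega> p \<partial>M) \<le> ennreal C * (J (fst p) * I (fst (snd p)) (snd (snd p)))"
      using kb[of "fst p" "fst (snd p)" "snd (snd p)"] by simp
  qed
  also have "\<dots> = ennreal C * (\<integral>\<^sup>+p. J (fst p) * I (fst (snd p)) (snd (snd p)) \<partial>?L)"
    by (rule nn_integral_cmult) measurable
  also have "(\<integral>\<^sup>+p. J (fst p) * I (fst (snd p)) (snd (snd p)) \<partial>?L) = (\<integral>\<^sup>+y. J y \<partial>lborel) * (\<integral>\<^sup>+u. (\<integral>\<^sup>+v. I u v \<partial>lborel) \<partial>lborel)"
  proof -
    have m: "(\<lambda>p. J (fst p) * I (fst (snd p)) (snd (snd p))) \<in> borel_measurable (lborel \<Otimes>\<^sub>M (lborel :: (real \<times> real) measure))"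
    proof -
      have sets: "sets (lborel \<Otimes>\<^sub>M (lborel :: (real \<times> real) measure)) = sets ((borel :: real measure) \<Otimes>\<^sub>M (borel \<Otimes>\<^sub>M borel))"
        by (rule sets_pair_measure_cong) (simp_all only: borel_prod sets_lborel)
      show ?thesis unfolding measurable_cong_sets[OF sets refl] by measurable
    qed
    have "(\<integral>\<^sup>+p. J (fst p) * I (fst (snd p)) (snd (snd p)) \<partial>?L) =
      (\<integral>\<^sup>+p. J (fst p) * I (fst (snd p)) (snd (snd p)) \<partial>(lborel \<Otimes>\<^sub>M (lborel :: (real \<times> real) measure)))"
      by (simp add: lborel_prod)
    also have "\<dots> = (\<integral>\<^sup>+y. (\<integral>\<^sup>+q. J y * I (fst q) (snd q) \<partial>lborel) \<partial>lborel)"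
      using lborel.nn_integral_fst[OF m] by simp
    also have "\<dots> = (\<integral>\<^sup>+y. J y * (\<integral>\<^sup>+q. I (fst q) (snd q) \<partial>(lborel \<Otimes>\<^sub>M lborel)) \<partial>lborel)"
      unfolding lborel_prod[symmetric] by (intro nn_integral_cong nn_integral_cmult) measurable
    also have "\<dots> = (\<integral>\<^sup>+y. J y \<partial>lborel) * (\<integral>\<^sup>+q. I (fst q) (snd q) \<partial>(lborel \<Otimes>\<^sub>M lborel))"
      by (rule nn_integral_multc) measurable
    also have "(\<integral>\<^sup>+q. I (fst q) (snd q) \<partial>(lborel \<Otimes>\<^sub>M lborel)) = (\<integral>\<^sup>+u. (\<integral>\<^sup>+v. I u v \<partial>lborel) \<partial>lborel)"
      by (subst lborel.nn_integral_fst[symmetric]) (simp_all add: measurable_lborel1)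
    finally show ?thesis .
  qed
  finally have le: "(\<integral>\<^sup>+\<omega>. control \<delta> \<eta> R (cross_primitive N \<omega>) (- N) N \<partial>M) \<le>
    ennreal C * ((\<integral>\<^sup>+y. J y \<partial>lborel) * (\<integral>\<^sup>+u. (\<integral>\<^sup>+v. I u v \<partial>lborel) \<partial>lborel))" .
  have "(\<integral>\<^sup>+y. J y \<partial>lborel) * (\<integral>\<^sup>+u. (\<integral>\<^sup>+v. I u v \<partial>lborel) \<partial>lborel) < \<infinity>"
  proof -
    have J: "(\<integral>\<^sup>+y. J y \<partial>lborel) < \<infinity>"
      unfolding J_def nn_integral_powr_0[OF a R] by simp
    have "(\<integral>\<^sup>+u. (\<integral>\<^sup>+v. I u v \<partial>lborel) \<partial>lborel) \<le> (\<integral>\<^sup>+u. ennreal (2 / (b + 1) * (N - - N) powr (b + 1)) * indicator {- N..N} u \<partial>lborel)"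
    proof (intro nn_integral_mono)
      fix u :: real
      have "(\<integral>\<^sup>+v. I u v \<partial>lborel) = (\<integral>\<^sup>+v\<in>{- N..N}. ennreal (\<bar>u - v\<bar> powr b) \<partial>lborel) * indicator {- N..N} u"
        unfolding I_def by (rule nn_integral_multc) measurable
      also have "\<dots> \<le> ennreal (2 / (b + 1) * (N - - N) powr (b + 1)) * indicator {- N..N} u"
        using nn_integral_abs_powr_le[OF b, of "- N" u N] by (auto simp: indicator_def)
      finally show "(\<integral>\<^sup>+v. I u v \<partial>lborel) \<le> ennreal (2 / (b + 1) * (N - - N) powr (b + 1)) * indicator {- N..N} u" .
    qed
    also have "\<dots> < \<infinity>" using N by (simp add: nn_integral_cmult ennreal_mult_less_top)
    finally show ?thesis using J by (simp add: ennreal_mult_less_top)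
  qed
  then have "ennreal C * ((\<integral>\<^sup>+y. J y \<partial>lborel) * (\<integral>\<^sup>+u. (\<integral>\<^sup>+v. I u v \<partial>lborel) \<partial>lborel)) < \<infinity>"
    by (metis ennreal_less_top ennreal_mult_less_top infinity_ennreal_def)
  with le have fin: "(\<integral>\<^sup>+\<omega>. control \<delta> \<eta> R (cross_primitive N \<omega>) (- N) N \<partial>M) < \<infinity>"
    by (rule order.strict_trans1)
  have "(\<lambda>\<omega>. control \<delta> \<eta> R (cross_primitive N \<omega>) (- N) N) \<in> borel_measurable M"
    unfolding kD
    by (rule P.M2.borel_measurable_nn_integral) (rule km)
  then have "AE \<omega> in M. control \<delta> \<eta> R (cross_primitive N \<omega>) (- N) N \<noteq> \<infinity>"
    using fin by (intro nn_integral_PInf_AE) auto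
  then show ?thesis by eventually_elim (simp add: less_top)
qed

end

section \<open>Convergence of the areas\<close>

text \<open>
  For \<open>\<beta> > 1 / 2\<close> the product of the growth bounds of \<open>g1\<close> and \<open>g2\<close> is integrable in \<open>y\<close> down to 0.
\<close>

lemma areas_converge_regular:
  assumes g: "boundary_growth \<beta> g1" "boundary_growth \<beta> g2" and \<beta>: "1 / 2 < \<beta>" "\<beta> < 1" "0 < \<kappa>" "\<kappa> \<le> 2 * \<beta> - 1"
    and q: "0 < q" "1 \<le> (2 * \<beta> - \<kappa>) * (q / 2)"
  shows "converges_in_d q 2 (Levy_area g1 g2)"
proof (rule areas_converge[OF g, where \<kappa> = \<kappa>])
  fix N :: nat
  define N' where "N' = real (2 * N + 1)"
  obtain C1 where C1: "0 \<le> C1" "growth_bound \<beta> N' C1 g1" using g unfolding boundary_growth_def N'_def by blast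
  obtain C2 where C2: "0 \<le> C2" "growth_bound \<beta> N' C2 g2" using g unfolding boundary_growth_def N'_def by blast
  have hol: "g1 holomorphic_on {z. 0 < Im z}" "g2 holomorphic_on {z. 0 < Im z}"
    using g by (auto simp: boundary_growth_def)
  define K where "K = 4 * C1 * C2 / (2 * \<beta> - 1)"
  have K: "0 \<le> K" using C1 C2 \<beta> by (simp add: K_def)
  define W where "W = (\<lambda>s t. K * (t - s) powr (2 * \<beta> - \<kappa>))"
  define r where "r = q / 2"
  define B where "B = K powr r * (2 * real N + 1) powr ((2 * \<beta> - \<kappa>) * r)"
  have cross: "integral {y'..y} (\<lambda>y. \<bar>cross_integral g1 g2 y s t\<bar>) \<le> y powr \<kappa> * W s t"
    if st: "- real N \<le> s" "s < t" "t \<le> real N" and y: "0 < y'" "y' \<le> y" "y \<le> t - s" for s t y y'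
  proof -
    define h where "h = t - s"
    have h: "0 < h" using st by (simp add: h_def)
    have pw: "\<bar>cross_integral g1 g2 z s t\<bar> \<le> 4 * C1 * C2 * h * z powr (2 * \<beta> - 1 - 1)" if z: "z \<in> {y'..y}" for z
    proof -
      have z0: "0 < z" "z \<le> N'" using z y st by (auto simp: N'_def)
      have "norm (cross_integral g1 g2 z s t) \<le> integral {s..t} (\<lambda>x. 4 * C1 * C2 * z powr (2 * \<beta> - 1 - 1))"
        unfolding cross_integral_def
      proof (rule integral_norm_bound_integral)
        have c: "continuous_on {s..t} (\<lambda>x. f (Complex x z))" if "f holomorphic_on {z. 0 < Im z}" for f
          by (rule continuous_on_compose2[OF holomorphic_on_imp_continuous_on[OF that]])
             (use z0 in \<open>auto simp: Complex_eq intro!: continuous_intros\<close>)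
        show "(\<lambda>x. 4 * Im (g1 (Complex x z) * cnj (g2 (Complex x z)))) integrable_on {s..t}"
          by (intro integrable_continuous_real continuous_intros c hol)
        fix x assume x: "x \<in> {s..t}"
        have x': "\<bar>x\<bar> \<le> N'" using x st by (auto simp: N'_def)
        have "norm (4 * Im (g1 (Complex x z) * cnj (g2 (Complex x z)))) \<le> 4 * (norm (g1 (Complex x z)) * norm (g2 (Complex x z)))"
          using abs_Im_le_cmod[of "g1 (Complex x z) * cnj (g2 (Complex x z))"] by (simp add: abs_mult norm_mult)
        also have "\<dots> \<le> 4 * ((C1 * z powr (\<beta> - 1)) * (C2 * z powr (\<beta> - 1)))"
          using growth_boundD[OF C1(2) x' z0] growth_boundD[OF C2(2) x' z0] C1
          by (intro mult_left_mono mult_mono) auto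
        also have "\<dots> = 4 * C1 * C2 * z powr (2 * \<beta> - 1 - 1)"
          using powr_add[of z "\<beta> - 1" "\<beta> - 1"] by simp
        finally show "norm (4 * Im (g1 (Complex x z) * cnj (g2 (Complex x z)))) \<le> 4 * C1 * C2 * z powr (2 * \<beta> - 1 - 1)" .
      qed auto
      then show ?thesis using st by (simp add: h_def algebra_simps)
    qed
    have der: "((\<lambda>z. 4 * C1 * C2 * h * z powr (2 * \<beta> - 1 - 1)) has_integral
        4 * C1 * C2 * h / (2 * \<beta> - 1) * y powr (2 * \<beta> - 1) - 4 * C1 * C2 * h / (2 * \<beta> - 1) * y' powr (2 * \<beta> - 1)) {y'..y}"
      using y \<beta> by (intro fundamental_theorem_of_calculus has_vector_derivative_at_within[OF powr_has_vector_derivative]) auto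
    have ci: "(\<lambda>y. \<bar>cross_integral g1 g2 y s t\<bar>) integrable_on {y'..y}"
      using y hol by (intro integrable_continuous_real continuous_intros cross_integral_continuous) auto
    have "integral {y'..y} (\<lambda>y. \<bar>cross_integral g1 g2 y s t\<bar>) \<le> integral {y'..y} (\<lambda>z. 4 * C1 * C2 * h * z powr (2 * \<beta> - 1 - 1))"
      using der by (intro integral_le ci pw) auto
    also have "\<dots> = K * h * y powr (2 * \<beta> - 1) - K * h * y' powr (2 * \<beta> - 1)"
      using integral_unique[OF der] by (simp add: K_def)
    also have "\<dots> \<le> K * h * y powr (2 * \<beta> - 1)" using K h by simp
    also have "y powr (2 * \<beta> - 1) = y powr \<kappa> * y powr (2 * \<beta> - 1 - \<kappa>)" by (simp add: powr_add[symmetric])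
    also have "\<dots> \<le> y powr \<kappa> * h powr (2 * \<beta> - 1 - \<kappa>)"
      using y \<beta> by (intro mult_left_mono powr_mono2) (auto simp: h_def)
    also have "K * h * (y powr \<kappa> * h powr (2 * \<beta> - 1 - \<kappa>)) = y powr \<kappa> * W s t"
    proof -
      have "h powr (2 * \<beta> - \<kappa>) = h * h powr (2 * \<beta> - 1 - \<kappa>)"
        using h powr_add[of h 1 "2 * \<beta> - 1 - \<kappa>"] by simp
      then show ?thesis by (simp add: W_def h_def)
    qed
    finally show ?thesis using K h by (simp add: mult_left_mono)
  qed
  have part: "(\<Sum>l=1..n. W (p (l - 1)) (p l) powr (q / 2)) \<le> B"
    if p: "- real N \<le> s" "t \<le> real N" "is_partition s t n p" for s t n p
  proof -
    have "(\<Sum>l=1..n. W (p (l - 1)) (p l) powr r) = K powr r * (\<Sum>l=1..n. (p l - p (l - 1)) powr ((2 * \<beta> - \<kappa>) * r))"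
      using K by (simp add: W_def powr_mult powr_powr sum_distrib_left)
    also have "\<dots> \<le> B"
      unfolding B_def using p q by (intro mult_left_mono sum_mesh_powr_le) (auto simp: r_def)
    finally show ?thesis by (simp add: r_def)
  qed
  have "\<forall>u v. 0 \<le> W u v" using K by (simp add: W_def)
  with cross part show "cross_dominated \<kappa> (q / 2) g1 g2 N"
    by blast
qed (use \<beta> q in auto)

text \<open>
  The condition \<open>\<delta> * (q / 2) \<ge> 1\<close> is that the exponents of the length and of the control in \<open>W powr (q / 2)\<close>,
  namely \<open>(\<delta> - 1 / 2) * (q / 2)\<close> and \<open>q / 4\<close>, add up to at least 1.
\<close>

lemma (in Gamma_pair_paths) areas_converge_rough:
  assumes \<omega>: "\<omega> \<in> G"
    and g: "boundary_growth \<beta> (\<lambda>z. X1 z \<omega>)" "boundary_growth \<beta> (\<lambda>z. X2 z \<omega>)" and \<beta>: "\<eta> / 2 \<le> \<beta>" "\<beta> < 1"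
    and q: "0 < q" "1 \<le> (2 * \<beta> - \<eta> / 2) * (q / 2)" "1 \<le> \<delta> * (q / 2)"
    and \<delta>: "1 / 2 < \<delta>" "0 < \<eta>"
    and fin: "\<And>N::nat. control \<delta> \<eta> (2 * real N) (cross_primitive (real N) \<omega>) (- real N) (real N) < \<infinity>"
  shows "converges_in_d q 2 (Levy_area (\<lambda>z. X1 z \<omega>) (\<lambda>z. X2 z \<omega>))"
proof (rule areas_converge[OF g, where \<kappa> = "\<eta> / 2"])
  fix N :: nat
  define f where "f = cross_primitive (real N) \<omega>"
  define con where "con = control \<delta> \<eta> (2 * real N) f"
  define K where "K = sqrt (GRR_const \<delta> / \<eta>)"
  have K: "0 \<le> K" using GRR_const_pos[OF \<delta>(1)] \<delta> by (simp add: K_def)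
  define W where "W = (\<lambda>s t. K * (t - s) powr (\<delta> - 1 / 2) * enn2real (con s t) powr (1 / 2))"
  define C where "C = enn2real (con (- real N) (real N)) + 1"
  have C: "con (- real N) (real N) \<le> ennreal C" "0 < C"
  proof -
    have "con (- real N) (real N) = ennreal (enn2real (con (- real N) (real N)))"
      using fin[of N] by (simp add: con_def f_def)
    also have "\<dots> \<le> ennreal C" unfolding C_def by (intro ennreal_leI) simp
    finally show "con (- real N) (real N) \<le> ennreal C" .
    show "0 < C" by (simp add: C_def add_nonneg_pos)
  qed
  define B where "B = K powr (q / 2) * ((2 * real N + 1) powr ((\<delta> - 1 / 2) * (q / 2)) * C powr (q / 4) * 2 powr ((\<delta> - 1 / 2) * (q / 2) + q / 4))"
  have \<omega>M: "\<omega> \<in> space M" using sets.sets_into_space[OF G] \<omega> by blast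
  have m: "(\<lambda>(y, u). f y u) \<in> borel_measurable (borel \<Otimes>\<^sub>M borel)"
    unfolding f_def case_prod_unfold using \<omega>M by measurable
  have cross: "integral {y'..y} (\<lambda>y. \<bar>cross_integral (\<lambda>z. X1 z \<omega>) (\<lambda>z. X2 z \<omega>) y s t\<bar>) \<le> y powr (\<eta> / 2) * W s t"
    if st: "- real N \<le> s" "s < t" "t \<le> real N" and y: "0 < y'" "y' \<le> y" "y \<le> t - s" for s t y y'
  proof -
    have eq: "cross_integral (\<lambda>z. X1 z \<omega>) (\<lambda>z. X2 z \<omega>) z s t = f z t - f z s" if "z \<in> {y'..y}" for z
      unfolding f_def using that st y by (intro cross_primitive_diff_cross[symmetric] \<omega>) auto
    have "integral {y'..y} (\<lambda>y. \<bar>f y t - f y s\<bar>) \<le> y powr (\<eta> / 2) * (K * (t - s) powr (\<delta> - 1 / 2) * enn2real (con s t) powr (1 / 2))"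
      unfolding K_def con_def
    proof (rule integral_increment_control[OF m \<delta> st(2) y(1,2)])
      show "y \<le> 2 * real N" using y st by simp
      show "continuous_on {s..t} (f z)" if "0 < z" for z
      proof -
        have "continuous_on {- real N..t} (\<lambda>u. integral {- real N..u} (\<lambda>x. 4 * Im (cross_density (Complex x z) \<omega>)))"
          by (intro indefinite_integral_continuous_1 cross_density_integrable \<omega> that)
        then show ?thesis
          unfolding f_def cross_primitive_eq[OF \<omega> that, abs_def] using st by (elim continuous_on_subset) auto
      qed
      have "continuous_on {y'..y} (\<lambda>z. cross_integral (\<lambda>z. X1 z \<omega>) (\<lambda>z. X2 z \<omega>) z s t)"
        by (intro cross_integral_continuous hol \<omega> y)
      then show "continuous_on {y'..y} (\<lambda>z. f z t - f z s)"
        by (rule continuous_on_eq) (rule eq)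
      have "con s t \<le> con (- real N) (real N)" unfolding con_def using st by (intro control_mono) auto
      then show "control \<delta> \<eta> (2 * real N) f s t < \<infinity>"
        using fin[of N] unfolding con_def f_def by (rule order.strict_trans1)
    qed
    then show ?thesis
      unfolding W_def using eq by (subst Henstock_Kurzweil_Integration.integral_cong[where g = "\<lambda>y. \<bar>f y t - f y s\<bar>"]) auto
  qed
  have part: "(\<Sum>l=1..n. W (p (l - 1)) (p l) powr (q / 2)) \<le> B"
    if p: "- real N \<le> s" "t \<le> real N" "is_partition s t n p" for s t n p
  proof -
    have "W u v powr (q / 2) = K powr (q / 2) * ((v - u) powr ((\<delta> - 1 / 2) * (q / 2)) * enn2real (con u v) powr (q / 4))" for u v
      unfolding W_def using K by (simp add: powr_mult powr_powr mult.assoc)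
    then have "(\<Sum>l=1..n. W (p (l - 1)) (p l) powr (q / 2)) = K powr (q / 2) *
       (\<Sum>l=1..n. (p l - p (l - 1)) powr ((\<delta> - 1 / 2) * (q / 2)) * enn2real (con (p (l - 1)) (p l)) powr (q / 4))"
      by (simp add: sum_distrib_left)
    also have "\<dots> \<le> B"
      unfolding B_def con_def
    proof (rule mult_left_mono[OF control_powr_sum[OF m p(3,1,2)]])
      show "control \<delta> \<eta> (2 * real N) f (- real N) (real N) \<le> ennreal C" using C(1) by (simp add: con_def)
      have "(\<delta> - 1 / 2) * (q / 2) + q / 4 = \<delta> * (q / 2)" by (simp add: algebra_simps)
      then show "1 \<le> (\<delta> - 1 / 2) * (q / 2) + q / 4" using q by simp
    qed (use p q \<delta> C in auto)
    finally show ?thesis .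
  qed
  have "\<forall>u v. 0 \<le> W u v" using K by (simp add: W_def)
  with cross part show "cross_dominated (\<eta> / 2) (q / 2) (\<lambda>z. X1 z \<omega>) (\<lambda>z. X2 z \<omega>) N"
    by blast
qed (use \<beta> q \<delta> in auto)

theorem theorem4p10:
  fixes M :: "'a measure"
    and \<alpha> q :: real
    and X1 X2 :: "complex \<Rightarrow> 'a \<Rightarrow> complex"
  assumes "prob_space M"
    and "0 < \<alpha>" "\<alpha> < 1" "\<alpha> > 1 / 4" "\<alpha> \<noteq> 1 / 2"
    and "q > 1 / \<alpha>"
    and "is_Gamma_prime_plus M \<alpha> X1" "is_Gamma_prime_plus M \<alpha> X2"
    and "independent_processes M upper_half_plane X1 X2"
  shows "AE \<omega> in M.
      converges_in_d q 1 (Gamma_increment (\<lambda>z. X1 z \<omega>) (\<lambda>z. X2 z \<omega>)) \<and>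
      converges_in_d q 2 (Levy_area (\<lambda>z. X1 z \<omega>) (\<lambda>z. X2 z \<omega>))"
proof -
  interpret p1: Gamma_process M \<alpha> X1
    using assms by (intro Gamma_process.intro Gamma_process_axioms.intro)
  interpret p2: Gamma_process M \<alpha> X2
    using assms by (intro Gamma_process.intro Gamma_process_axioms.intro)
  have q: "0 < q" using assms(2,6) by (meson divide_pos_pos less_trans zero_less_one)
  have q\<alpha>: "1 / q < \<alpha>" using assms(2,6) q by (simp add: field_simps)
  \<comment> \<open>The excess of \<open>\<alpha>\<close> over \<open>1 / q\<close> pays for the loss from \<open>\<alpha>\<close> to \<open>\<beta>\<close> and for the rates of convergence.\<close>
  define c where "c = (\<alpha> - 1 / q) / 4"
  have c: "0 < c" "\<alpha> = 1 / q + 4 * c"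
  proof -
    show "0 < c" using q\<alpha> by (simp add: c_def)
    have "x = r + 4 * ((x - r) / 4)" for x r :: real by (simp add: field_simps)
    then show "\<alpha> = 1 / q + 4 * c" unfolding c_def .
  qed
  have growth: "AE \<omega> in M. boundary_growth \<beta> (\<lambda>z. X1 z \<omega>) \<and> boundary_growth \<beta> (\<lambda>z. X2 z \<omega>)" if "\<beta> < \<alpha>" for \<beta>
    using p1.growth_AE[OF that] p2.growth_AE[OF that] by eventually_elim simp
  have qmul: "1 \<le> x * q" if "1 / q \<le> x" for x using that q by (simp add: field_simps)
  have inc: "AE \<omega> in M. converges_in_d q 1 (Gamma_increment (\<lambda>z. X1 z \<omega>) (\<lambda>z. X2 z \<omega>))"
  proof -
    have "\<alpha> - c < \<alpha>" using c by simp
    from growth[OF this] show ?thesis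
    proof eventually_elim
      case (elim \<omega>)
      have "1 / q \<le> \<alpha> - c - c" using c by simp
      moreover have "0 < 2 * c + 1 / q" using q c by (intro add_pos_pos) auto
      ultimately show ?case
        using elim c q qmul[of "\<alpha> - c - c"] assms(3) by (intro increments_converge[of "\<alpha> - c" _ _ c]) auto
    qed
  qed
  have area: "AE \<omega> in M. converges_in_d q 2 (Levy_area (\<lambda>z. X1 z \<omega>) (\<lambda>z. X2 z \<omega>))"
  proof (cases "\<alpha> < 1 / 2")
    case False
    then have \<alpha>2: "1 / 2 < \<alpha>" using assms(5) by simp
    define d where "d = min c ((\<alpha> - 1 / 2) / 2)"
    have d: "0 < d" "d \<le> c" "2 * d \<le> \<alpha> - 1 / 2" using c(1) \<alpha>2 by (auto simp: d_def min_def)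
    have "\<alpha> - d < \<alpha>" using d by simp
    from growth[OF this] show ?thesis
    proof eventually_elim
      case (elim \<omega>)
      have "1 / q \<le> (2 * (\<alpha> - d) - d) / 2" using c d by simp
      from qmul[OF this] have "1 \<le> (2 * (\<alpha> - d) - d) * (q / 2)" by simp
      then show ?case
        using elim d q \<alpha>2 assms(3) by (intro areas_converge_regular[of "\<alpha> - d" _ _ d]) auto
    qed
  next
    case True
    interpret Gamma_pair M \<alpha> X1 X2
      using assms by unfold_locales
    obtain G1 where G1: "G1 \<in> sets M" "AE \<omega> in M. \<omega> \<in> G1"
      "\<And>\<omega>. \<omega> \<in> G1 \<Longrightarrow> (\<lambda>z. X1 z \<omega>) holomorphic_on {z. 0 < Im z}"
      using p1.analytic_set by blast
    obtain G2 where G2: "G2 \<in> sets M" "AE \<omega> in M. \<omega> \<in> G2"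
      "\<And>\<omega>. \<omega> \<in> G2 \<Longrightarrow> (\<lambda>z. X2 z \<omega>) holomorphic_on {z. 0 < Im z}"
      using p2.analytic_set by blast
    interpret Gamma_pair_paths M \<alpha> X1 X2 "G1 \<inter> G2"
      using G1 G2 by unfold_locales auto
    \<comment> \<open>\<open>\<delta>\<close> must exceed \<open>1 / 2\<close> (Garsia-Rodemich-Rumsey) and \<open>2 / q\<close> (variation), and must stay below \<open>2 * \<alpha>\<close>
      (moments of the cross term). The gap \<open>g\<close> to \<open>2 * \<alpha>\<close> leaves room for \<open>\<tau>\<close> strictly between
      \<open>2 * \<delta> - 1\<close> and \<open>4 * \<alpha> - 1\<close>.\<close>
    define \<delta> where "\<delta> = (max (1 / 2) (2 / q) + 2 * \<alpha>) / 2"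
    have m: "max (1 / 2) (2 / q) < 2 * \<alpha>" using q\<alpha> assms(4) by simp
    have \<delta>: "1 / 2 < \<delta>" "2 / q < \<delta>" "\<delta> < 2 * \<alpha>" using m by (auto simp: \<delta>_def)
    define g where "g = 2 * \<alpha> - \<delta>"
    define \<tau> where "\<tau> = 2 * \<delta> - 1 + g"
    define \<eta> where "\<eta> = min (g / 2) c"
    have g: "0 < g" using \<delta> by (simp add: g_def)
    have \<eta>: "0 < \<eta>" "\<eta> \<le> g / 2" "\<eta> \<le> c" using g c by (auto simp: \<eta>_def)
    have \<tau>: "0 < \<tau>" "\<tau> \<le> 1" "4 * \<alpha> \<le> 3 + \<tau>" "\<tau> + \<eta> < 4 * \<alpha> - 1" "2 * \<delta> < 1 + \<tau>"
      using \<delta> g \<eta> True by (auto simp: \<tau>_def g_def)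
    have "AE \<omega> in M. \<forall>N::nat. control \<delta> \<eta> (2 * real N) (cross_primitive (real N) \<omega>) (- real N) (real N) < \<infinity>"
      unfolding AE_all_countable by (intro allI control_finite_AE[OF \<tau>]) auto
    moreover have "\<alpha> - c < \<alpha>" using c by simp
    note growth[OF this]
    ultimately show ?thesis using AE_G
    proof eventually_elim
      case (elim \<omega>)
      show ?case
      proof (rule areas_converge_rough[of \<omega> "\<alpha> - c" \<eta> q \<delta>])
        have "1 / q \<le> (2 * (\<alpha> - c) - \<eta> / 2) / 2" using c \<eta> by simp
        from qmul[OF this] show "1 \<le> (2 * (\<alpha> - c) - \<eta> / 2) * (q / 2)" by simp
        have "1 / q \<le> \<delta> / 2" using \<delta> by simp
        from qmul[OF this] show "1 \<le> \<delta> * (q / 2)" by simp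
        have "0 < 1 / q" using q by simp
        then show "\<eta> / 2 \<le> \<alpha> - c" using c \<eta> by linarith
      qed (use elim q \<delta> \<eta> c(1) assms(3) in auto)
    qed
  qed
  from inc area show ?thesis by eventually_elim simp
qed

end
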